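(* Let $a<b$, $\Omega=(a,b)$, $T_0>0$, and let $m_0\ge 2$ be an integer. For each $\varepsilon\in(0,1]$ let $V,A_1$ be real-valued potentials and let $\Phi$ be the exact solution on $[0,T_0/\varepsilon]$ of the one-dimensional Dirac equation $$i\partial_t\Phi=(-i\sigma_1\partial_x+\sigma_3)\Phi+\varepsilon\left(V(t,x)I_2-A_1(t,x)\sigma_1\right)\Phi,\quad x\in\Omega,\ t>0,$$ with periodic boundary conditions $\Phi(t,a)=\Phi(t,b)$, $\partial_x\Phi(t,a)=\partial_x\Phi(t,b)$ and initial data $\Phi(0,x)=\Phi_0(x)$. Assume, with bounds by constants independent of $\varepsilon$: (A) $\|\Phi\|_{L^\infty([0,T_0/\varepsilon];(H^{m_0}_p)^2)}\lesssim 1$, $\|\partial_t\Phi\|_{L^\infty([0,T_0/\varepsilon];(L^2)^2)}\lesssim 1$, $\|\partial_{tt}\Phi\|_{L^\infty([0,T_0/\varepsilon];(L^2)^2)}\lesssim 1$; (B) $\|V\|_{W^{2,\infty}([0,T_0/\varepsilon];L^\infty)}+\|A_1\|_{W^{2,\infty}([0,T_0/\varepsilon];L^\infty)}\lesssim 1$. Let $\Phi^n_N(x)$ be the approximation obtained from the exponential wave integrator Fourier spectral (EWI-FS) method (defined in the context) with mesh size $h=(b-a)/N$ and time step $\tau$. Then there exist $\tau_0>0$ sufficiently small and independent of $\varepsilon$, and a constant $C_{T_0}$ depending on $T_0$ and independent of $h,\tau$ and $\varepsilon$, such that for any $0<\varepsilon\le 1$, when $0<\tau\le\tau_0$, $$\left\|\Phi(t_n,x)-\Phi^n_N(x)\right\|_{L^2}\le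 C_{T_0}\left(h^{m_0}+\tau^2\right),\qquad 0\le n\le\frac{T_0/\varepsilon}{\tau}.$$
   Context: $\Phi=\Phi(t,x)\in\mathbb{C}^2$; $I_2$ is the $2\times2$ identity matrix, $\sigma_1=\begin{pmatrix}0&1\\1&0\end{pmatrix}$, $\sigma_3=\begin{pmatrix}1&0\\0&-1\end{pmatrix}$. The initial data satisfy $\Phi_0(a)=\Phi_0(b)$, $\Phi_0'(a)=\Phi_0'(b)$. The space $H^k_p(\Omega)=\{u\in H^k(\Omega): \partial_x^l u(a)=\partial_x^l u(b),\ l=0,\dots,k-1\}$. The notation $A\lesssim B$ means $|A|\le CB$ with a generic constant $C>0$ independent of $h$, $\tau$ and $\varepsilon$. Discretization: $N$ is an even positive integer, $h=(b-a)/N$, $\tau>0$, $t_n=n\tau$, $\mathcal{T}_N=\{-N/2,-N/2+1,\dots,N/2-1\}$, $\mu_l=\frac{2\pi l}{b-a}$. Let $Z_N=\mathrm{span}\{e^{i\mu_l(x-a)}: l\in\mathcal{T}_N\}$ and $Y_N=Z_N\times Z_N$. For $U\in(L^2(\Omega))^2$, $\widehat{U}_l=\frac1{b-a}\int_a^bU(x)e^{-i\mu_l(x-a)}dx\in\mathbb{C}^2$ and $(P_NU)(x)=\sum_{l\in\mathcal{T}_N}\widehat{U}_le^{i\mu_l(x-a)}$. Let $\Gamma_l=\mu_l\sigma_1+\sigma_3$ (Hermitian, with eigenvalues $\pm\delta_l$, $\delta_l=\sqrt{1+\mu_l^2}$), $G(t)=G(t,x)=V(t,x)I_2-A_1(t,x)\sigma_1$,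 and $$Q_l^{(1)}(\tau)=-i\Gamma_l^{-1}\left[I_2-e^{-i\tau\Gamma_l}\right],\qquad Q_l^{(2)}(\tau)=-i\tau\Gamma_l^{-1}+\Gamma_l^{-2}\left[I_2-e^{-i\tau\Gamma_l}\right].$$ EWI-FS method: $\Phi_N^0=P_N\Phi_0$, and for $n\ge0$, $\Phi^{n+1}_N(x)=\sum_{l\in\mathcal{T}_N}\widehat{(\Phi^{n+1}_N)}_le^{i\mu_l(x-a)}\in Y_N$, where for $l\in\mathcal{T}_N$ $$\widehat{(\Phi^{1}_N)}_l=e^{-i\tau\Gamma_l}\widehat{(\Phi^0_N)}_l-\varepsilon\Gamma_l^{-1}\left[I_2-e^{-i\tau\Gamma_l}\right]\widehat{(G(t_0)\Phi^0_N)}_l,$$ and for $n\ge1$ $$\widehat{(\Phi^{n+1}_N)}_l=e^{-i\tau\Gamma_l}\widehat{(\Phi^n_N)}_l-i\varepsilon Q^{(1)}_l(\tau)\widehat{(G(t_n)\Phi^n_N)}_l-i\varepsilon Q^{(2)}_l(\tau)\,\delta_t^-\widehat{(G(t_n)\Phi^n_N)}_l,$$ with $\delta_t^-\widehat{(G(t_n)\Phi^n_N)}_l=\frac1\tau\left[\widehat{(G(t_n)\Phi^n_N)}_l-\widehat{(G(t_{n-1})\Phi^{n-1}_N)}_l\right]$. *)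

theory Defs
  imports "HOL-Analysis.Analysis" "HOL-Probability.Essential_Supremum"
begin

section \<open>Function spaces\<close>

text \<open>
  Elements of function spaces are represented by functions, read up to equality almost everywhere.
  A norm has values in \<^typ>\<open>ennreal\<close> and is \<^term>\<open>top :: ennreal\<close> exactly outside of the space, so that
  a bound \<open>norm u \<le> ennreal M\<close> includes membership. A function of time and space is a curried
  function \<open>u t x\<close>.
\<close>

definition test_functions :: "real \<Rightarrow> real \<Rightarrow> (real \<Rightarrow> real) set" where
  "test_functions a b =
     {\<phi>. (\<forall>n x. (deriv ^^ n) \<phi> field_differentiable at x) \<and>
          (\<exists>c d. a < c \<and> d < b \<and> (\<forall>x. x \<notin> {c..d} \<longrightarrow> \<phi> x = 0))}"

definition locally_integrable ::
    "real \<Rightarrow> real \<Rightarrow> (real \<Rightarrow> 'v::{banach,second_countable_topology}) \<Rightarrow> bool" where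
  "locally_integrable a b u \<longleftrightarrow>
     (\<forall>c d. a < c \<longrightarrow> d < b \<longrightarrow> integrable (lebesgue_on {c..d}) u)"

definition weak_deriv ::
    "real \<Rightarrow> real \<Rightarrow> nat \<Rightarrow> (real \<Rightarrow> 'v::{banach,second_countable_topology}) \<Rightarrow> (real \<Rightarrow> 'v) \<Rightarrow> bool"
  where
  "weak_deriv a b l u v \<longleftrightarrow>
     locally_integrable a b u \<and> locally_integrable a b v \<and>
     (\<forall>\<phi>\<in>test_functions a b.
        (\<integral>x. (deriv ^^ l) \<phi> x *\<^sub>R u x \<partial>lebesgue_on {a<..<b}) =
        (-1) ^ l *\<^sub>R (\<integral>x. \<phi> x *\<^sub>R v x \<partial>lebesgue_on {a<..<b}))"

text \<open>A weak derivative is unique up to equality almost everywhere, and it is only used up to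
  equality almost everywhere.\<close>

definition weak_dx ::
    "real \<Rightarrow> real \<Rightarrow> nat \<Rightarrow> (real \<Rightarrow> 'v::{banach,second_countable_topology}) \<Rightarrow> real \<Rightarrow> 'v" where
  "weak_dx a b l u = (SOME v. weak_deriv a b l u v)"

definition L2_norm ::
    "real \<Rightarrow> real \<Rightarrow> (real \<Rightarrow> 'v::{banach,second_countable_topology}) \<Rightarrow> ennreal" where
  "L2_norm a b u =
     (if u \<in> borel_measurable (lebesgue_on {a<..<b}) \<and>
         integrable (lebesgue_on {a<..<b}) (\<lambda>x. (norm (u x))\<^sup>2)
      then ennreal (sqrt (\<integral>x. (norm (u x))\<^sup>2 \<partial>lebesgue_on {a<..<b})) else top)"

definition Linf_norm ::
    "real \<Rightarrow> real \<Rightarrow> (real \<Rightarrow> 'v::{banach,second_countable_topology}) \<Rightarrow> ennreal" where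
  "Linf_norm a b u =
     (if u \<in> borel_measurable (lebesgue_on {a<..<b})
      then esssup (lebesgue_on {a<..<b}) (\<lambda>x. ennreal (norm (u x))) else top)"

text \<open>The boundary condition \<open>\<partial>\<^sub>x\<^sup>l u(a) = \<partial>\<^sub>x\<^sup>l u(b)\<close> refers to the continuous representative
  \<open>g\<close> of \<open>\<partial>\<^sub>x\<^sup>l u\<close> on the closed interval, which exists for \<open>l < k\<close> if \<open>u \<in> H\<^sup>k(a,b)\<close>.\<close>

definition periodic_bc ::
    "real \<Rightarrow> real \<Rightarrow> nat \<Rightarrow> (real \<Rightarrow> 'v::{banach,second_countable_topology}) \<Rightarrow> bool" where
  "periodic_bc a b l u \<longleftrightarrow>
     (\<exists>g. continuous_on {a..b} g \<and> weak_deriv a b l u g \<and> g a = g b)"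

definition H_space ::
    "real \<Rightarrow> real \<Rightarrow> nat \<Rightarrow> (real \<Rightarrow> 'v::{banach,second_countable_topology}) set" where
  "H_space a b k = {u. L2_norm a b u < top \<and>
     (\<forall>l\<le>k. \<exists>v. weak_deriv a b l u v \<and> L2_norm a b v < top)}"

definition Hp_space ::
    "real \<Rightarrow> real \<Rightarrow> nat \<Rightarrow> (real \<Rightarrow> 'v::{banach,second_countable_topology}) set" where
  "Hp_space a b k = {u \<in> H_space a b k. \<forall>l<k. periodic_bc a b l u}"

definition Hp_norm ::
    "real \<Rightarrow> real \<Rightarrow> nat \<Rightarrow> (real \<Rightarrow> 'v::{banach,second_countable_topology}) \<Rightarrow> ennreal" where
  "Hp_norm a b k u =
     (if u \<in> Hp_space a b k
      then ennreal (sqrt (\<Sum>l\<le>k. (enn2real (L2_norm a b (weak_dx a b l u)))\<^sup>2)) else top)"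

definition jointly_measurable ::
    "real \<Rightarrow> real \<Rightarrow> real \<Rightarrow> (real \<Rightarrow> real \<Rightarrow> 'v::{banach,second_countable_topology}) \<Rightarrow> bool" where
  "jointly_measurable T a b u \<longleftrightarrow>
     (\<lambda>(t, x). u t x) \<in> borel_measurable (lebesgue_on ({0<..<T} \<times> {a<..<b}))"

text \<open>The norm of \<open>L\<^sup>\<infinity>([0,T];X)\<close>, where \<open>X\<close> is the space of functions on \<open>(a,b)\<close> with norm \<open>N\<close>.\<close>

definition Linf_time ::
    "real \<Rightarrow> real \<Rightarrow> real \<Rightarrow> ((real \<Rightarrow> 'v) \<Rightarrow> ennreal) \<Rightarrow>
     (real \<Rightarrow> real \<Rightarrow> 'v::{banach,second_countable_topology}) \<Rightarrow> ennreal" where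
  "Linf_time T a b N u =
     (if jointly_measurable T a b u then esssup (lebesgue_on {0<..<T}) (\<lambda>t. N (u t)) else top)"

text \<open>\<open>v\<close> is the weak time derivative of \<open>u\<close>: \<open>\<integral> \<phi>'(t) u(t) dt = - \<integral> \<phi>(t) v(t) dt\<close> as functions
  of \<open>x\<close>, for all test functions \<open>\<phi>\<close> on \<open>(0,T)\<close>.\<close>

definition weak_dt ::
    "real \<Rightarrow> real \<Rightarrow> real \<Rightarrow> (real \<Rightarrow> real \<Rightarrow> 'v::{banach,second_countable_topology}) \<Rightarrow>
     (real \<Rightarrow> real \<Rightarrow> 'v) \<Rightarrow> bool" where
  "weak_dt T a b u v \<longleftrightarrow>
     jointly_measurable T a b u \<and> jointly_measurable T a b v \<and>
     (AE x in lebesgue_on {a<..<b}.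
        locally_integrable 0 T (\<lambda>t. u t x) \<and> locally_integrable 0 T (\<lambda>t. v t x)) \<and>
     (\<forall>\<phi>\<in>test_functions 0 T. AE x in lebesgue_on {a<..<b}.
        (\<integral>t. deriv \<phi> t *\<^sub>R u t x \<partial>lebesgue_on {0<..<T}) =
        - (\<integral>t. \<phi> t *\<^sub>R v t x \<partial>lebesgue_on {0<..<T}))"

text \<open>The norm of \<open>W\<^bsup>k,\<infinity>\<^esup>([0,T];L\<^sup>\<infinity>(a,b))\<close>. The infimum runs over the tuples \<open>(v 0, \<dots>, v k)\<close> of
  versions of the weak time derivatives of \<open>u\<close> up to order \<open>k\<close>, which all give the same value; it
  is \<^term>\<open>top :: ennreal\<close> if there are none.\<close>

definition W_Linf_norm ::
    "nat \<Rightarrow> real \<Rightarrow> real \<Rightarrow> real \<Rightarrow> (real \<Rightarrow> real \<Rightarrow> 'v::{banach,second_countable_topology}) \<Rightarrow> ennreal"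
  where
  "W_Linf_norm k T a b u =
     (INF v\<in>{v. v 0 = u \<and> (\<forall>j<k. weak_dt T a b (v j) (v (Suc j)))}.
        \<Sum>j\<le>k. Linf_time T a b (Linf_norm a b) (v j))"

text \<open>Functions in \<open>W\<^bsup>1,\<infinity>\<^esup>([0,T];X)\<close> are continuous with values in \<open>X\<close> after a change on a null set
  of times. The condition \<open>u \<in> C([0,T];X)\<close> selects this representative, so that the value \<open>u t\<close> at
  a given time is determined as an element of \<open>X\<close>.\<close>

definition time_continuous ::
    "real \<Rightarrow> ((real \<Rightarrow> 'v) \<Rightarrow> ennreal) \<Rightarrow> (real \<Rightarrow> real \<Rightarrow> 'v::real_normed_vector) \<Rightarrow> bool" where
  "time_continuous T N u \<longleftrightarrow>
     (\<forall>t\<in>{0..T}. N (u t) < top \<and>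
        ((\<lambda>s. N (\<lambda>x. u s x - u t x)) \<longlongrightarrow> 0) (at t within {0..T}))"


section \<open>The Dirac equation\<close>

definition sigma1 :: "complex^2^2" where
  "sigma1 = vector [vector [0, 1], vector [1, 0]]"

definition sigma3 :: "complex^2^2" where
  "sigma3 = vector [vector [1, 0], vector [0, -1]]"

definition G_mat :: "(real \<Rightarrow> real \<Rightarrow> real) \<Rightarrow> (real \<Rightarrow> real \<Rightarrow> real) \<Rightarrow> real \<Rightarrow> real \<Rightarrow> complex^2^2" where
  "G_mat V A1 t x = V t x *\<^sub>R mat 1 - A1 t x *\<^sub>R sigma1"

text \<open>\<open>\<Phi>t\<close> is the weak time derivative \<open>\<partial>\<^sub>t\<Phi>\<close>, and the equation holds almost everywhere: the
  potentials are merely bounded in \<open>x\<close>, so \<open>\<partial>\<^sub>t\<Phi>\<close> need not have a continuous representative.\<close>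

definition dirac_solution ::
    "real \<Rightarrow> real \<Rightarrow> real \<Rightarrow> real \<Rightarrow> (real \<Rightarrow> real \<Rightarrow> real) \<Rightarrow> (real \<Rightarrow> real \<Rightarrow> real) \<Rightarrow>
     (real \<Rightarrow> complex^2) \<Rightarrow> (real \<Rightarrow> real \<Rightarrow> complex^2) \<Rightarrow> (real \<Rightarrow> real \<Rightarrow> complex^2) \<Rightarrow> bool" where
  "dirac_solution T a b \<epsilon> V A1 \<Phi>0 \<Phi> \<Phi>t \<longleftrightarrow>
     time_continuous T (L2_norm a b) \<Phi> \<and>
     weak_dt T a b \<Phi> \<Phi>t \<and>
     (AE t in lebesgue_on {0<..<T}.
        (\<exists>v. weak_deriv a b 1 (\<Phi> t) v) \<and>
        (AE x in lebesgue_on {a<..<b}.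
           \<i> *s \<Phi>t t x =
             ((- \<i>) *s (sigma1 *v weak_dx a b 1 (\<Phi> t) x) + sigma3 *v \<Phi> t x)
             + \<epsilon> *\<^sub>R (G_mat V A1 t x *v \<Phi> t x))) \<and>
     (\<forall>t\<in>{0..T}. periodic_bc a b 0 (\<Phi> t) \<and> periodic_bc a b 1 (\<Phi> t)) \<and>
     (AE x in lebesgue_on {a<..<b}. \<Phi> 0 x = \<Phi>0 x)"


section \<open>The EWI-FS method\<close>

text \<open>For matrices of type \<^typ>\<open>complex^2^2\<close> the operations \<open>*\<close>, \<open>^\<close> and \<open>exp\<close> of the type classes
  are not the matrix operations, so powers are iterated matrix products. The matrix
  \<open>mat c\<close> is \<open>c\<close> times the identity.\<close>

definition mat_exp :: "complex^2^2 \<Rightarrow> complex^2^2" where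
  "mat_exp A = (\<Sum>n. (1 / fact n) *\<^sub>R (((**) A ^^ n) (mat 1)))"

definition mu :: "real \<Rightarrow> real \<Rightarrow> int \<Rightarrow> real" where
  "mu a b l = 2 * pi * of_int l / (b - a)"

definition modes :: "nat \<Rightarrow> int set" where
  "modes N = {- (int N div 2) .. int N div 2 - 1}"

definition fourier_coeff :: "real \<Rightarrow> real \<Rightarrow> (real \<Rightarrow> complex^2) \<Rightarrow> int \<Rightarrow> complex^2" where
  "fourier_coeff a b U l =
     (1 / (b - a)) *\<^sub>R
       (\<integral>x. exp (- \<i> * of_real (mu a b l * (x - a))) *s U x \<partial>lebesgue_on {a<..<b})"

definition trig_poly :: "real \<Rightarrow> real \<Rightarrow> nat \<Rightarrow> (int \<Rightarrow> complex^2) \<Rightarrow> real \<Rightarrow> complex^2" where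
  "trig_poly a b N c x = (\<Sum>l\<in>modes N. exp (\<i> * of_real (mu a b l * (x - a))) *s c l)"

definition P_N :: "real \<Rightarrow> real \<Rightarrow> nat \<Rightarrow> (real \<Rightarrow> complex^2) \<Rightarrow> real \<Rightarrow> complex^2" where
  "P_N a b N U = trig_poly a b N (fourier_coeff a b U)"

definition Gam :: "real \<Rightarrow> real \<Rightarrow> int \<Rightarrow> complex^2^2" where
  "Gam a b l = mu a b l *\<^sub>R sigma1 + sigma3"

definition expGam :: "real \<Rightarrow> real \<Rightarrow> real \<Rightarrow> int \<Rightarrow> complex^2^2" where
  "expGam a b \<tau> l = mat_exp (mat (- \<i> * of_real \<tau>) ** Gam a b l)"

definition Q1 :: "real \<Rightarrow> real \<Rightarrow> real \<Rightarrow> int \<Rightarrow> complex^2^2" where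
  "Q1 a b \<tau> l = mat (- \<i>) ** matrix_inv (Gam a b l) ** (mat 1 - expGam a b \<tau> l)"

definition Q2 :: "real \<Rightarrow> real \<Rightarrow> real \<Rightarrow> int \<Rightarrow> complex^2^2" where
  "Q2 a b \<tau> l =
     mat (- \<i> * of_real \<tau>) ** matrix_inv (Gam a b l)
     + matrix_inv (Gam a b l) ** matrix_inv (Gam a b l) ** (mat 1 - expGam a b \<tau> l)"

definition GPhi_coeff ::
    "real \<Rightarrow> real \<Rightarrow> (real \<Rightarrow> real \<Rightarrow> real) \<Rightarrow> (real \<Rightarrow> real \<Rightarrow> real) \<Rightarrow> real \<Rightarrow> (real \<Rightarrow> complex^2) \<Rightarrow>
     int \<Rightarrow> complex^2" where
  "GPhi_coeff a b V A1 t U = fourier_coeff a b (\<lambda>x. G_mat V A1 t x *v U x)"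

fun ewi_fs ::
    "real \<Rightarrow> real \<Rightarrow> real \<Rightarrow> (real \<Rightarrow> real \<Rightarrow> real) \<Rightarrow> (real \<Rightarrow> real \<Rightarrow> real) \<Rightarrow> (real \<Rightarrow> complex^2) \<Rightarrow>
     nat \<Rightarrow> real \<Rightarrow> nat \<Rightarrow> real \<Rightarrow> complex^2" where
  "ewi_fs a b \<epsilon> V A1 \<Phi>0 N \<tau> 0 = P_N a b N \<Phi>0"
| "ewi_fs a b \<epsilon> V A1 \<Phi>0 N \<tau> (Suc 0) =
     (let U0 = ewi_fs a b \<epsilon> V A1 \<Phi>0 N \<tau> 0 in
      trig_poly a b N (\<lambda>l.
        expGam a b \<tau> l *v fourier_coeff a b U0 l
        - \<epsilon> *\<^sub>R ((matrix_inv (Gam a b l) ** (mat 1 - expGam a b \<tau> l))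
                 *v GPhi_coeff a b V A1 0 U0 l)))"
| "ewi_fs a b \<epsilon> V A1 \<Phi>0 N \<tau> (Suc (Suc n)) =
     (let U = ewi_fs a b \<epsilon> V A1 \<Phi>0 N \<tau> (Suc n);
          U' = ewi_fs a b \<epsilon> V A1 \<Phi>0 N \<tau> n;
          t = real (Suc n) * \<tau>;
          t' = real n * \<tau> in
      trig_poly a b N (\<lambda>l.
        expGam a b \<tau> l *v fourier_coeff a b U l
        - (\<i> * of_real \<epsilon>) *s (Q1 a b \<tau> l *v GPhi_coeff a b V A1 t U l)
        - (\<i> * of_real \<epsilon>) *s (Q2 a b \<tau> l *v
            ((1 / \<tau>) *\<^sub>R (GPhi_coeff a b V A1 t U l - GPhi_coeff a b V A1 t' U' l)))))"

end

theory Submission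
  imports Defs
begin

text \<open>
  The error \<open>\<Phi>(t\<^sub>n) - \<Phi>\<^sub>N\<^sup>n\<close> is split at \<open>P\<^sub>N\<Phi>(t\<^sub>n)\<close>. The projection error is of order \<open>h\<^bsup>m0\<^esup>\<close>
  by spatial regularity (\<open>projection_error\<close>): the Fourier coefficients of \<open>\<partial>\<^sub>x\<^sup>k \<Phi>\<close> are those of
  \<open>\<Phi>\<close> times \<open>(i \<mu>\<^sub>l)\<^sup>k\<close>, by repeated integration by parts, and the trigonometric system is
  complete, by the Stone-Weierstrass theorem on the circle.

  For the remaining part, the Fourier coefficients \<open>c\<^sub>l\<close> of \<open>\<Phi>\<close> satisfy \<open>c\<^sub>l' = -i (\<Gamma>\<^sub>l c\<^sub>l + \<epsilon>
  g\<^sub>l)\<close>, where \<open>g\<^sub>l\<close> is the coefficient of \<open>G \<Phi>\<close> (\<open>coefficient_ode\<close>, \<open>dirac_fourier\<close>). A step of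
  the method solves the same equation exactly, with \<open>g\<^sub>l\<close> replaced by a linear extrapolation of
  numerical values (\<open>expGam_J\<close>). After multiplication by the unitary integrating factor
  \<open>e\<^sup>i\<^sup>s\<^sup>\<Gamma>\<close>, the difference has a derivative of size \<open>\<epsilon>\<close> times the defect of the forcing
  (\<open>one_step\<close>). The defect consists of the extrapolation error of \<open>G \<Phi>\<close>, which is \<open>O(\<tau>\<^sup>2)\<close>, and
  of errors at earlier levels. As every increment carries the factor \<open>\<epsilon> \<tau>\<close> and there are at most
  \<open>T0 / (\<epsilon> \<tau>)\<close> steps, a discrete Gronwall argument (\<open>two_step_Gronwall\<close>) gives a bound that does
  not depend on \<open>\<epsilon>\<close> (\<open>error_bound\<close>).

  The extrapolation error has to be estimated from weak time derivatives that are merely bounded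
  almost everywhere. Pairing with a fixed function \<open>f\<close> of \<open>x\<close> reduces this to scalar functions
  of time (\<open>weak_dt_pairing\<close>), for which the second derivative is tested against smoothed hat
  functions (\<open>weak_deriv_2_extrapolation\<close>). A choice of \<open>f\<close> dual to the extrapolation error
  itself turns the scalar bounds into bounds in the norms of \<open>L\<^sup>2\<close> and \<open>L\<^sup>\<infinity>\<close>
  (\<open>l2_time_increments\<close>, \<open>Linf_time_increments\<close>), and \<open>product_extrapolation\<close> combines those for
  the potentials and for \<open>\<Phi>\<close>.
\<close>

section \<open>Smooth functions and smooth steps\<close>

text \<open>
  Smoothness is expressed through iterates of \<^const>\<open>deriv\<close>, as for test functions. The version of
  order \<open>n\<close> serves inductive closure proofs: differentiating a product leaves a sum of products,
  of which one derivative less is required.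
\<close>

definition smooth_upto :: "nat \<Rightarrow> (real \<Rightarrow> real) \<Rightarrow> bool" where
  "smooth_upto n f \<longleftrightarrow> (\<forall>k\<le>n. \<forall>x. (deriv ^^ k) f field_differentiable at x)"

definition smooth :: "(real \<Rightarrow> real) \<Rightarrow> bool" where
  "smooth f \<longleftrightarrow> (\<forall>n x. (deriv ^^ n) f field_differentiable at x)"

lemma smooth_iff_upto: "smooth f \<longleftrightarrow> (\<forall>n. smooth_upto n f)"
  by (auto simp: smooth_def smooth_upto_def)

lemma smooth_upto_0: "smooth_upto 0 f \<longleftrightarrow> (\<forall>x. f field_differentiable at x)"
  by (simp add: smooth_upto_def)

lemma smooth_upto_Suc:
  "smooth_upto (Suc n) f \<longleftrightarrow> (\<forall>x. f field_differentiable at x) \<and> smooth_upto n (deriv f)"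
proof -
  have "(\<forall>k\<le>Suc n. \<forall>x. (deriv ^^ k) f field_differentiable at x) \<longleftrightarrow>
      (\<forall>x. f field_differentiable at x) \<and>
      (\<forall>k\<le>n. \<forall>x. (deriv ^^ (Suc k)) f field_differentiable at x)"
    by (metis Suc_le_mono funpow_0 not0_implies_Suc zero_le)
  thus ?thesis
    by (simp add: smooth_upto_def funpow_Suc_right del: funpow.simps)
qed

lemma smooth_uptoI:
  assumes "\<And>x. (f has_real_derivative f' x) (at x)" "smooth_upto n f'"
  shows "smooth_upto (Suc n) f"
proof -
  have "deriv f = f'" using assms(1) by (intro ext DERIV_imp_deriv)
  thus ?thesis using assms by (auto simp: smooth_upto_Suc field_differentiable_def)
qed

lemma smooth_upto_deriv:
  assumes "smooth_upto (Suc n) f"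
  shows "(f has_real_derivative deriv f x) (at x)" "smooth_upto n (deriv f)"
  using assms by (auto simp: smooth_upto_Suc field_differentiable_derivI)

lemma smooth_upto_mono: "smooth_upto n f \<Longrightarrow> m \<le> n \<Longrightarrow> smooth_upto m f"
  by (auto simp: smooth_upto_def)

lemma smooth_upto_lin:
  "smooth_upto n f \<Longrightarrow> smooth_upto n g \<Longrightarrow> smooth_upto n (\<lambda>x. c * f x + d * g x)"
proof (induction n arbitrary: f g)
  case 0 thus ?case
    by (auto simp: smooth_upto_0 intro!: derivative_intros)
next
  case (Suc n)
  show ?case
  proof (rule smooth_uptoI)
    show "((\<lambda>x. c * f x + d * g x) has_real_derivative c * deriv f x + d * deriv g x) (at x)" for x
      using Suc.prems[THEN smooth_upto_deriv(1)] by (auto intro!: derivative_eq_intros)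
    show "smooth_upto n (\<lambda>x. c * deriv f x + d * deriv g x)"
      using Suc.prems by (intro Suc.IH smooth_upto_deriv)
  qed
qed

lemma smooth_upto_mult:
  "smooth_upto n f \<Longrightarrow> smooth_upto n g \<Longrightarrow> smooth_upto n (\<lambda>x. f x * g x)"
proof (induction n arbitrary: f g)
  case 0 thus ?case
    by (auto simp: smooth_upto_0 field_differentiable_mult)
next
  case (Suc n)
  show ?case
  proof (rule smooth_uptoI)
    show "((\<lambda>x. f x * g x) has_real_derivative 1 * (deriv f x * g x) + 1 * (f x * deriv g x)) (at
        x)" for x
      using Suc.prems[THEN smooth_upto_deriv(1)]
      by (auto intro!: derivative_eq_intros simp: algebra_simps)
    have "smooth_upto n f" "smooth_upto n g"
      using Suc.prems by (auto intro: smooth_upto_mono)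
    thus "smooth_upto n (\<lambda>x. 1 * (deriv f x * g x) + 1 * (f x * deriv g x))"
      using Suc.prems by (intro smooth_upto_lin Suc.IH smooth_upto_deriv)
  qed
qed

lemma smooth_upto_affine:
  "smooth_upto n f \<Longrightarrow> smooth_upto n (\<lambda>x. f (c * x + d))"
proof (induction n arbitrary: f)
  case 0
  { fix x
    have "(f has_real_derivative deriv f (c * x + d)) (at (c * x + d))"
      using 0 by (auto simp: smooth_upto_0 field_differentiable_derivI)
    hence "((\<lambda>x. f (c * x + d)) has_real_derivative deriv f (c * x + d) * c) (at x)"
      by (rule DERIV_chain2) (auto intro!: derivative_eq_intros) }
  thus ?case by (auto simp: smooth_upto_0 field_differentiable_def)
next
  case (Suc n)
  show ?case
  proof (rule smooth_uptoI)
    show "((\<lambda>x. f (c * x + d)) has_real_derivative c * deriv f (c * x + d) + 0 * deriv f (c * x +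
        d)) (at x)" for x
      by (rule DERIV_chain2[OF smooth_upto_deriv(1)[OF Suc.prems], THEN DERIV_cong])
        (auto intro!: derivative_eq_intros)
    show "smooth_upto n (\<lambda>x. c * deriv f (c * x + d) + 0 * deriv f (c * x + d))"
      using Suc.prems by (intro smooth_upto_lin Suc.IH smooth_upto_deriv)
  qed
qed

lemma smooth_lin: "smooth f \<Longrightarrow> smooth g \<Longrightarrow> smooth (\<lambda>x. c * f x + d * g x)"
  by (simp add: smooth_iff_upto smooth_upto_lin)
lemma smooth_mult: "smooth f \<Longrightarrow> smooth g \<Longrightarrow> smooth (\<lambda>x. f x * g x)"
  by (simp add: smooth_iff_upto smooth_upto_mult)
lemma smooth_affine: "smooth f \<Longrightarrow> smooth (\<lambda>x. f (c * x + d))"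
  by (simp add: smooth_iff_upto smooth_upto_affine)

lemma smooth_deriv: "smooth f \<Longrightarrow> smooth (deriv f)"
  by (auto simp: smooth_iff_upto intro: smooth_upto_deriv)

lemma smooth_DERIV: "smooth f \<Longrightarrow> (f has_real_derivative deriv f x) (at x)"
  by (auto simp: smooth_iff_upto intro: smooth_upto_deriv)

lemma smooth_antideriv:
  assumes "\<And>x. (f has_real_derivative f' x) (at x)" "smooth f'"
  shows "smooth f"
proof -
  have "smooth_upto n f" for n
    by (rule smooth_upto_mono[OF smooth_uptoI[OF assms(1)], of n])
      (use assms(2) in \<open>auto simp: smooth_iff_upto\<close>)
  thus ?thesis by (simp add: smooth_iff_upto)
qed

lemma smooth_continuous: "smooth f \<Longrightarrow> continuous_on S f"
  by (meson DERIV_continuous_on has_field_derivative_at_within smooth_DERIV)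

lemma poly_times_exp_tendsto_0:
  fixes p :: "real poly"
  shows "((\<lambda>y. poly p y * exp (- y)) \<longlongrightarrow> 0) at_top"
proof -
  have "((\<lambda>y. y ^ k * poly p y * exp (- y)) \<longlongrightarrow> 0) at_top" for k
  proof (induction p arbitrary: k)
    case 0 show ?case by simp
  next
    case (pCons c p)
    have "((\<lambda>y. c * (y ^ k / exp y) + y ^ Suc k * poly p y * exp (- y)) \<longlongrightarrow> c * 0 + 0) at_top"
      by (intro tendsto_intros tendsto_power_div_exp_0 pCons.IH)
    thus ?case by (simp add: algebra_simps exp_minus divide_inverse)
  qed
  from this[of 0] show ?thesis by simp
qed

text \<open>
  The functions \<open>p(1/x) exp(-1/x)\<close>, continued by zero to \<open>x \<le> 0\<close>, form a class that is closed
  under differentiation, so that all of them are smooth although the formula changes at \<open>0\<close>.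
\<close>

definition flat_exp :: "real poly \<Rightarrow> real \<Rightarrow> real" where
  "flat_exp p x = (if x > 0 then poly p (1 / x) * exp (- (1 / x)) else 0)"

lemma flat_exp_deriv:
  "(flat_exp p has_real_derivative flat_exp ([:0,0,1:] * (p - pderiv p)) x) (at x)"
proof -
  consider "x > 0" | "x < 0" | "x = 0" by linarith
  thus ?thesis
  proof cases
    case 1
    have "((\<lambda>x. poly p (1 / x) * exp (- (1 / x))) has_real_derivative
        flat_exp ([:0,0,1:] * (p - pderiv p)) x) (at x)"
      using 1 by (auto intro!: derivative_eq_intros DERIV_chain2[OF poly_DERIV]
          simp: flat_exp_def field_simps power2_eq_square)
    thus ?thesis
    proof (rule has_field_derivative_transform_within_open)
      show "open {0::real<..}" by simp
    qed (use 1 in \<open>auto simp: flat_exp_def\<close>)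
  next
    case 2
    have "((\<lambda>x. 0) has_real_derivative flat_exp ([:0,0,1:] * (p - pderiv p)) x) (at x)"
      using 2 by (simp add: flat_exp_def)
    thus ?thesis
    proof (rule has_field_derivative_transform_within_open)
      show "open {..<0::real}" by simp
    qed (use 2 in \<open>auto simp: flat_exp_def\<close>)
  next
    case 3
    have r: "((\<lambda>y. flat_exp p y / y) \<longlongrightarrow> 0) (at_right 0)"
    proof (rule Lim_transform_eventually)
      show "((\<lambda>y. poly (pCons 0 p) (inverse y) * exp (- inverse y)) \<longlongrightarrow> 0) (at_right (0::real))"
        by (rule filterlim_compose[OF poly_times_exp_tendsto_0 filterlim_inverse_at_top_right])
      show "eventually (\<lambda>y. poly (pCons 0 p) (inverse y) * exp (- inverse y) = flat_exp p y / y)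
          (at_right (0::real))"
        by (rule eventually_mono[OF eventually_at_right_less[of 0]])
          (auto simp: flat_exp_def divide_inverse)
    qed
    have l: "((\<lambda>y. flat_exp p y / y) \<longlongrightarrow> 0) (at_left 0)"
      by (rule Lim_transform_eventually[OF tendsto_const])
        (auto simp: flat_exp_def eventually_at_filter)
    have "((\<lambda>y. flat_exp p y / y) \<longlongrightarrow> 0) (at 0)"
      using l r by (rule filterlim_split_at)
    thus ?thesis using 3 by (simp add: has_field_derivative_iff flat_exp_def)
  qed
qed

lemma smooth_flat_exp: "smooth (flat_exp p)"
proof -
  have "smooth_upto n (flat_exp p)" for n
  proof (induction n arbitrary: p)
    case 0 show ?case
      using flat_exp_deriv by (auto simp: smooth_upto_0 field_differentiable_def)
  next
    case (Suc n) show ?case by (rule smooth_uptoI[OF flat_exp_deriv Suc.IH])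
  qed
  thus ?thesis by (simp add: smooth_iff_upto)
qed

lemma continuous_antiderivative:
  fixes f :: "real \<Rightarrow> real"
  assumes "continuous_on UNIV f"
  obtains F where "\<And>x. (F has_real_derivative f x) (at x)"
proof -
  have "\<exists>F. \<forall>x. -\<infinity> < ereal x \<longrightarrow> ereal x < \<infinity> \<longrightarrow> (F has_vector_derivative f x) (at x)"
    by (rule einterval_antiderivative)
      (use assms continuous_on_eq_continuous_at in auto)
  thus ?thesis using that by (auto simp: has_real_derivative_iff_has_vector_derivative)
qed

text \<open>
  The step is an antiderivative of a bump, normalised by its total increment. The bump is the
  product of two reflected copies of \<open>exp(-1/x)\<close> and is positive exactly on \<open>(-1,1)\<close>.
\<close>

lemma smooth_step_exists:
  "\<exists>\<beta>. smooth \<beta> \<and> mono \<beta> \<and> (\<forall>x\<le>-1. \<beta> x = 0) \<and> (\<forall>x\<ge>1. \<beta> x = (1::real))"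
proof -
  \<comment> \<open>The factors 1 and -1 bring both arguments into the form to which closure under affine
    substitution applies.\<close>
  define r where "r = (\<lambda>x. flat_exp 1 (1 * x + 1) * flat_exp 1 ((-1) * x + 1))"
  have r: "smooth r"
    unfolding r_def by (intro smooth_mult smooth_affine smooth_flat_exp)
  have r0: "r x = 0" if "x \<le> -1 \<or> x \<ge> 1" for x using that by (auto simp: r_def flat_exp_def)
  have rp: "r x > 0" if "-1 < x" "x < 1" for x using that by (auto simp: r_def flat_exp_def)
  have rn: "r x \<ge> 0" for x by (auto simp: r_def flat_exp_def)
  obtain F where F: "\<And>x. (F has_real_derivative r x) (at x)"
    using continuous_antiderivative[OF smooth_continuous[OF r]] by blast
  have Fm: "F x \<le> F y" if "x \<le> y" for x y
    using that F rn by (meson DERIV_nonneg_imp_nondecreasing)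
  have F01: "F (-1) < F 1"
  proof (rule DERIV_pos_imp_increasing_open[of "-1" 1 F])
    show "continuous_on {-1..1} F"
      by (rule DERIV_continuous_on[OF has_field_derivative_at_within[OF F]])
    show "\<exists>y. (F has_real_derivative y) (at x) \<and> 0 < y" if "-1 < x" "x < 1" for x
      using F rp[OF that] by blast
  qed simp
  have Fc: "F x = F y" if "\<And>z. x \<le> z \<Longrightarrow> z \<le> y \<Longrightarrow> r z = 0" "x \<le> y" for x y
  proof (cases "x = y")
    case False
    hence "x < y" using that by simp
    from MVT2[OF this, of F r] F obtain z where "x < z" "z < y" "F y - F x = (y - x) * r z" by blast
    thus ?thesis using that(1)[of z] by simp
  qed simp
  define k where "k = F 1 - F (-1)"
  have k: "k > 0" using F01 by (simp add: k_def)
  have sF: "smooth F" by (rule smooth_antideriv[OF F r])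
  define \<beta> where "\<beta> = (\<lambda>x. (1 / k) * (F x) + (- F (-1) / k) * 1)"
  have "smooth (\<lambda>x. 0)" using smooth_lin[OF r r, of 0 0] by simp
  hence one: "smooth (\<lambda>x. 1)"
    by (rule smooth_antideriv[rotated]) (rule DERIV_const)
  have "smooth \<beta>" unfolding \<beta>_def by (intro smooth_lin sF one)
  moreover have "mono \<beta>"
    unfolding \<beta>_def using Fm k by (auto intro!: monoI simp: divide_right_mono)
  moreover have "\<beta> x = 0" if "x \<le> -1" for x
    using Fc[of x "-1"] r0 that k by (auto simp: \<beta>_def)
  moreover have "\<beta> x = 1" if "x \<ge> 1" for x
  proof -
    have "F x = F 1" using Fc[of 1 x] r0 that by simp
    hence "\<beta> x = k / k" unfolding \<beta>_def by (simp add: k_def diff_divide_distrib[symmetric])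
    thus ?thesis using k by simp
  qed
  ultimately show ?thesis by blast
qed

definition smooth_step :: "real \<Rightarrow> real" where
  "smooth_step = (SOME \<beta>. smooth \<beta> \<and> mono \<beta> \<and> (\<forall>x\<le>-1. \<beta> x = 0) \<and> (\<forall>x\<ge>1. \<beta> x = (1::real)))"

lemma smooth_step: "smooth smooth_step" "mono smooth_step" "x \<le> -1 \<Longrightarrow> smooth_step x = 0" "x \<ge> 1 \<Longrightarrow>
    smooth_step x = 1"
  using someI_ex[OF smooth_step_exists] by (auto simp: smooth_step_def)

lemma step_bounds: "0 \<le> smooth_step x" "smooth_step x \<le> 1"
  using monoD[OF smooth_step(2), of "min x (-1)" x] monoD[OF smooth_step(2), of x "max x 1"]
      smooth_step(3)[of "min x (-1)"] smooth_step(4)[of "max x 1"]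
  by auto

lemma step_deriv_nonneg: "deriv smooth_step x \<ge> 0"
  by (rule mono_on_imp_deriv_nonneg[of UNIV smooth_step])
    (use smooth_step(2) smooth_DERIV[OF smooth_step(1)] in auto)

text \<open>
  The antiderivative of the step is a smoothed positive part: it vanishes on the left and is
  affine with slope one on the right. Second differences of it are smoothed hat functions.
\<close>

definition smooth_ramp :: "real \<Rightarrow> real" where
  "smooth_ramp = (SOME B. (\<forall>x. (B has_real_derivative smooth_step x) (at x)) \<and> B (-1) = 0)"

lemma smooth_ramp: "(smooth_ramp has_real_derivative smooth_step x) (at x)" "smooth_ramp (-1) = 0"
proof -
  obtain F where F: "\<And>x. (F has_real_derivative smooth_step x) (at x)"
    using continuous_antiderivative[OF smooth_continuous[OF smooth_step(1)]] by blast
  have "\<exists>B. (\<forall>x. (B has_real_derivative smooth_step x) (at x)) \<and> B (-1) = 0"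
    by (rule exI[of _ "\<lambda>x. F x - F (-1)"]) (auto intro!: derivative_eq_intros F)
  from someI_ex[OF this] show "(smooth_ramp has_real_derivative smooth_step x) (at x)" "smooth_ramp
      (-1) = 0"
    by (auto simp: smooth_ramp_def)
qed

lemma ramp_left: "x \<le> -1 \<Longrightarrow> smooth_ramp x = 0"
proof (cases "x = -1")
  case False
  assume "x \<le> -1"
  hence "x < -1" using False by simp
  from MVT2[OF this smooth_ramp(1)] smooth_ramp(2) smooth_step(3) show ?thesis by auto
qed (simp add: smooth_ramp)

lemma ramp_right: "x \<ge> 1 \<Longrightarrow> smooth_ramp x = smooth_ramp 1 + (x - 1)"
proof (cases "x = 1")
  case False
  assume "x \<ge> 1"
  hence "1 < x" using False by simp
  from MVT2[OF this smooth_ramp(1)] smooth_step(4) show ?thesis by auto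
qed (simp add: smooth_ramp)

lemma ramp_diff: "\<bar>smooth_ramp x - smooth_ramp y\<bar> \<le> \<bar>x - y\<bar>"
proof -
  have "norm (smooth_ramp x - smooth_ramp y) \<le> 1 * norm (x - y)"
    by (rule field_differentiable_bound[of UNIV smooth_ramp smooth_step])
      (use smooth_ramp(1) step_bounds in auto)
  thus ?thesis by simp
qed

abbreviation ivl :: "real \<Rightarrow> real \<Rightarrow> real measure" where
  "ivl a b \<equiv> lebesgue_on {a<..<b}"

section \<open>Weak derivatives on an interval\<close>

lemma test_smooth: "\<phi> \<in> test_functions a b \<Longrightarrow> smooth \<phi>"
  by (simp add: test_functions_def smooth_def)

lemma integrable_ivl_iff:
  fixes q :: "real \<Rightarrow> 'v::euclidean_space"
  shows "integrable (ivl a b) q \<longleftrightarrow> q absolutely_integrable_on {a..b}"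
  by (simp add: absolutely_integrable_on_Icc_iff_Ioo, simp add: set_integrable_def
      integrable_restrict_space)

lemma integrable_ivl_continuous:
  fixes g :: "real \<Rightarrow> 'v::euclidean_space"
  assumes "continuous_on {a..b} g"
  shows "integrable (ivl a b) g"
  using absolutely_integrable_continuous_real[OF assms] by (simp add: integrable_ivl_iff)

lemma integrable_ivl_subset:
  fixes q :: "real \<Rightarrow> 'v::euclidean_space"
  assumes "integrable (ivl a b) q" "S \<subseteq> {a<..<b}" "S \<in> sets lebesgue"
  shows "integrable (lebesgue_on S) q"
proof -
  have "q absolutely_integrable_on {a<..<b}"
    using assms(1) by (simp add: set_integrable_def integrable_restrict_space)
  hence "q absolutely_integrable_on S" by (rule set_integrable_subset) (use assms in auto)
  thus ?thesis using assms(3) by (rule absolutely_integrable_imp_integrable)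
qed

lemma finite_measure_ivl: "finite_measure (ivl a b)"
  by (rule finite_measure_lebesgue_on) (rule lmeasurable_interval)

lemma integral_ivl_eq:
  fixes g :: "real \<Rightarrow> 'v::euclidean_space"
  assumes "integrable (ivl a b) g"
  shows "integral\<^sup>L (ivl a b) g = integral {a..b} g"
  by (simp add: lebesgue_integral_eq_integral[OF assms] integral_open_interval_real)

text \<open>
  Rescaling to width \<open>h\<close> around \<open>s\<close> turns the second derivative of the ramp into an
  approximation of the Dirac mass at \<open>s\<close>, the first derivative into one of a jump, and the ramp
  into one of a kink.
\<close>

definition bump :: "real \<Rightarrow> real \<Rightarrow> real \<Rightarrow> real" where
  "bump h s x = deriv smooth_step ((x - s) / h) / h"

definition scaled_step :: "real \<Rightarrow> real \<Rightarrow> real \<Rightarrow> real" where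
  "scaled_step h s x = smooth_step ((x - s) / h)"

definition scaled_ramp :: "real \<Rightarrow> real \<Rightarrow> real \<Rightarrow> real" where
  "scaled_ramp h s x = h * smooth_ramp ((x - s) / h)"

lemma DERIV_scaled_step: "h > 0 \<Longrightarrow> (scaled_step h s has_real_derivative bump h s x) (at x)"
  unfolding scaled_step_def bump_def
  by (rule DERIV_chain2[OF smooth_DERIV[OF smooth_step(1)], THEN DERIV_cong])
    (auto intro!: derivative_eq_intros)

lemma DERIV_scaled_ramp: "h > 0 \<Longrightarrow> (scaled_ramp h s has_real_derivative scaled_step h s x) (at x)"
  unfolding scaled_step_def scaled_ramp_def
  by (rule DERIV_cmult[OF DERIV_chain2[OF smooth_ramp(1)], THEN DERIV_cong])
    (auto intro!: derivative_eq_intros)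

lemma smooth_scaled_step: "smooth (scaled_step h s)"
proof -
  have "scaled_step h s = (\<lambda>x. smooth_step ((1 / h) * x + (- s / h)))"
    by (auto simp: scaled_step_def fun_eq_iff diff_divide_distrib)
  thus ?thesis using smooth_affine[OF smooth_step(1)] by metis
qed

lemma smooth_scaled_ramp: "h > 0 \<Longrightarrow> smooth (scaled_ramp h s)"
  by (rule smooth_antideriv[OF DERIV_scaled_ramp smooth_scaled_step])

lemma scaled_step_simps:
  assumes "h > 0"
  shows "x \<le> s - h \<Longrightarrow> scaled_step h s x = 0" "x \<ge> s + h \<Longrightarrow> scaled_step h s x = 1"
    "0 \<le> scaled_step h s x" "scaled_step h s x \<le> 1"
  using assms step_bounds by (auto simp: scaled_step_def field_simps intro!: smooth_step)

lemma scaled_ramp_simps: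
  assumes "h > 0"
  shows "x \<le> s - h \<Longrightarrow> scaled_ramp h s x = 0" "x \<ge> s + h \<Longrightarrow> scaled_ramp h s x = h * (smooth_ramp 1 - 1)
      + (x - s)"
    "\<bar>scaled_ramp h s x - scaled_ramp h t x\<bar> \<le> \<bar>s - t\<bar>"
proof -
  show "x \<le> s - h \<Longrightarrow> scaled_ramp h s x = 0"
    using assms ramp_left[of "(x - s) / h"] by (auto simp: scaled_ramp_def field_simps)
  show "x \<ge> s + h \<Longrightarrow> scaled_ramp h s x = h * (smooth_ramp 1 - 1) + (x - s)"
    using assms ramp_right[of "(x - s) / h"] by (simp add: scaled_ramp_def field_simps)
  have "\<bar>scaled_ramp h s x - scaled_ramp h t x\<bar> = h * \<bar>smooth_ramp ((x - s) / h) - smooth_ramp ((x -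
      t) / h)\<bar>"
    using assms by (simp add: scaled_ramp_def right_diff_distrib[symmetric] abs_mult)
  also have "\<dots> \<le> h * \<bar>(x - s) / h - (x - t) / h\<bar>"
    using assms by (intro mult_left_mono ramp_diff) auto
  also have "\<dots> = \<bar>s - t\<bar>"
    using assms by (simp add: diff_divide_distrib[symmetric] abs_divide)
  finally show "\<bar>scaled_ramp h s x - scaled_ramp h t x\<bar> \<le> \<bar>s - t\<bar>" .
qed

lemma bump_nonneg: "h > 0 \<Longrightarrow> bump h s x \<ge> 0"
  by (simp add: bump_def step_deriv_nonneg)

lemma bump_eq_0: "h > 0 \<Longrightarrow> \<bar>x - s\<bar> > h \<Longrightarrow> bump h s x = 0"
proof -
  assume h: "h > 0" and x: "\<bar>x - s\<bar> > h"
  define c :: real where "c = (if x < s then 0 else 1)"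
  have "((\<lambda>x. c) has_real_derivative bump h s x) (at x)"
    using DERIV_scaled_step[OF h]
  proof (rule has_field_derivative_transform_within_open)
    show "open {y. \<bar>y - s\<bar> > h \<and> (y < s \<longleftrightarrow> x < s)}"
    proof (cases "x < s")
      case True
      hence "{y. \<bar>y - s\<bar> > h \<and> (y < s \<longleftrightarrow> x < s)} = {..<s - h}" using h by auto
      thus ?thesis by simp
    next
      case False
      hence "{y. \<bar>y - s\<bar> > h \<and> (y < s \<longleftrightarrow> x < s)} = {s + h<..}" using h by auto
      thus ?thesis by simp
    qed
  qed (use x h in \<open>auto simp: c_def scaled_step_simps\<close>)
  thus ?thesis using DERIV_unique[OF _ DERIV_const] by blast
qed

lemma continuous_bump: "h > 0 \<Longrightarrow> continuous_on S (bump h s)"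
  unfolding bump_def
  by (intro continuous_intros continuous_on_compose2[OF smooth_continuous[OF smooth_deriv[OF
      smooth_step(1)], of UNIV]]) auto

lemma integral_bump:
  assumes "h > 0" "a \<le> s - h" "s + h \<le> b"
  shows "integral\<^sup>L (ivl a b) (bump h s) = 1"
proof -
  have "(bump h s has_integral scaled_step h s b - scaled_step h s a) {a..b}"
    by (rule fundamental_theorem_of_calculus)
      (use assms DERIV_scaled_step[of h] in \<open>auto simp:
          has_real_derivative_iff_has_vector_derivative[symmetric]
         intro: has_field_derivative_at_within\<close>)
  hence "integral {a..b} (bump h s) = 1"
    using assms by (simp add: scaled_step_simps integral_unique)
  thus ?thesis
    using integral_ivl_eq[OF integrable_ivl_continuous[OF continuous_bump]] assms by metis
qed

text \<open>
  The bumps are non-negative, have mass one and shrink to \<open>s\<close>, so the integral is an average of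
  values of \<open>g\<close> near \<open>s\<close>.
\<close>

lemma bump_limit:
  fixes g :: "real \<Rightarrow> 'v::euclidean_space"
  assumes s: "a < s" "s < b" and g: "continuous_on {a..b} g"
    and h: "\<And>n::nat. h n > 0" "h \<longlonglongrightarrow> 0"
  shows "(\<lambda>n. \<integral>x. bump (h n) s x *\<^sub>R g x \<partial>ivl a b) \<longlonglongrightarrow> g s"
proof (rule metric_LIMSEQ_I)
  fix e :: real assume e: "e > 0"
  have "continuous (at s within {a..b}) g"
    using g s by (auto simp: continuous_on_eq_continuous_within)
  then obtain d where d: "d > 0" "\<And>x. x \<in> {a..b} \<Longrightarrow> dist x s < d \<Longrightarrow> dist (g x) (g s) < e / 2"
    using e by (metis continuous_within_eps_delta half_gt_zero)
  define \<delta> where "\<delta> = min (d / 2) (min (s - a) (b - s))"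
  have \<delta>: "\<delta> > 0" using d s by (auto simp: \<delta>_def)
  then obtain n0 where n0: "\<And>n. n \<ge> n0 \<Longrightarrow> h n < \<delta>"
    using h(2) by (metis LIMSEQ_D abs_of_pos diff_zero h(1) real_norm_def)
  have "dist (\<integral>x. bump (h n) s x *\<^sub>R g x \<partial>ivl a b) (g s) < e" if n: "n \<ge> n0" for n
  proof -
    let ?k = "bump (h n) s"
    have hn: "h n < \<delta>" "h n > 0" using n0 n h by auto
    have one: "integral\<^sup>L (ivl a b) ?k = 1"
      by (rule integral_bump) (use hn in \<open>auto simp: \<delta>_def\<close>)
    have i1: "integrable (ivl a b) (\<lambda>x. ?k x *\<^sub>R g x)"
      by (intro integrable_ivl_continuous continuous_intros continuous_bump g hn)
    have i2: "integrable (ivl a b) (\<lambda>x. ?k x *\<^sub>R g s)"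
      by (intro integrable_ivl_continuous continuous_intros continuous_bump hn)
    have ik: "integrable (ivl a b) ?k"
      by (intro integrable_ivl_continuous continuous_intros continuous_bump hn)
    have i3: "integrable (ivl a b) (\<lambda>x. ?k x *\<^sub>R (g x - g s))"
      by (intro integrable_ivl_continuous continuous_intros continuous_bump g hn)
    have "(\<integral>x. ?k x *\<^sub>R g x \<partial>ivl a b) - g s = (\<integral>x. ?k x *\<^sub>R g x \<partial>ivl a b) - (\<integral>x. ?k x *\<^sub>R g s \<partial>ivl a b)"
      using ik by (simp add: one)
    also have "\<dots> = (\<integral>x. ?k x *\<^sub>R (g x - g s) \<partial>ivl a b)"
      by (simp add: Bochner_Integration.integral_diff[OF i1 i2, symmetric] scaleR_diff_right)
    finally have eq: "(\<integral>x. ?k x *\<^sub>R g x \<partial>ivl a b) - g s = (\<integral>x. ?k x *\<^sub>R (g x - g s) \<partial>ivl a b)" .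
    have "norm (\<integral>x. ?k x *\<^sub>R (g x - g s) \<partial>ivl a b) \<le> (\<integral>x. norm (?k x *\<^sub>R (g x - g s)) \<partial>ivl a b)"
      by (rule integral_norm_bound)
    also have "\<dots> \<le> (\<integral>x. ?k x * (e / 2) \<partial>ivl a b)"
    proof (rule integral_mono)
      show "integrable (ivl a b) (\<lambda>x. norm (?k x *\<^sub>R (g x - g s)))" using i3 by (rule integrable_norm)
      show "integrable (ivl a b) (\<lambda>x. ?k x * (e / 2))" using ik by simp
      fix x assume "x \<in> space (ivl a b)"
      hence x: "x \<in> {a..b}" by auto
      show "norm (?k x *\<^sub>R (g x - g s)) \<le> ?k x * (e / 2)"
      proof (cases "\<bar>x - s\<bar> > h n")
        case True thus ?thesis using bump_eq_0 hn by simp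
      next
        case False
        hence "dist x s < d" using hn d(1) by (auto simp: \<delta>_def dist_real_def)
        hence "norm (g x - g s) \<le> e / 2" using d(2)[OF x] by (simp add: dist_norm less_imp_le)
        thus ?thesis using mult_left_mono[of _ "e / 2" "bump (h n) s x"] bump_nonneg[of "h n" s x]
            hn by auto
      qed
    qed
    also have "\<dots> = e / 2" by (simp add: one)
    finally show ?thesis using e eq by (simp add: dist_norm)
  qed
  thus "\<exists>no. \<forall>n\<ge>no. dist (\<integral>x. bump (h n) s x *\<^sub>R g x \<partial>ivl a b) (g s) < e" by blast
qed

lemma step_test_function:
  assumes "h > 0" "a < s - h" "s \<le> t" "t + h < b"
  shows "(\<lambda>x. scaled_step h s x - scaled_step h t x) \<in> test_functions a b"
proof -
  have "smooth (\<lambda>x. 1 * scaled_step h s x + (-1) * scaled_step h t x)"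
    by (intro smooth_lin smooth_scaled_step)
  hence "smooth (\<lambda>x. scaled_step h s x - scaled_step h t x)" by simp
  moreover have "\<forall>x. x \<notin> {s-h..t+h} \<longrightarrow> scaled_step h s x - scaled_step h t x = 0"
    using assms by (auto simp: scaled_step_simps)
  ultimately show ?thesis using assms
    unfolding test_functions_def smooth_def by blast
qed

lemma deriv_scaled_step_diff: "h > 0 \<Longrightarrow> deriv (\<lambda>x. scaled_step h s x - scaled_step h t x) = (\<lambda>x. bump
    h s x - bump h t x)"
  by (intro ext DERIV_imp_deriv) (auto intro!: derivative_eq_intros DERIV_scaled_step)

lemma scaled_step_limit:
  assumes h: "\<And>n::nat. h n > 0" "h \<longlonglongrightarrow> 0" and x: "x \<noteq> s"
  shows "(\<lambda>n. scaled_step (h n) s x) \<longlonglongrightarrow> (if x < s then 0 else 1)"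
proof (rule tendsto_eventually)
  have "eventually (\<lambda>n. h n < \<bar>x - s\<bar>) sequentially"
    using h(2) x by (intro order_tendstoD) auto
  thus "eventually (\<lambda>n. scaled_step (h n) s x = (if x < s then 0 else 1)) sequentially"
    by eventually_elim (use h(1) in \<open>auto simp: scaled_step_simps\<close>)
qed

lemma integrable_ivl_cmult:
  fixes q :: "real \<Rightarrow> 'v::euclidean_space"
  assumes "integrable (ivl a b) q" "smooth \<phi>"
  shows "integrable (ivl a b) (\<lambda>x. \<phi> x *\<^sub>R q x)"
proof -
  have "continuous_on {a..b} \<phi>" using assms(2) by (rule smooth_continuous)
  hence "bounded (\<phi> ` {a..b})" using compact_continuous_image compact_imp_bounded by blast
  then obtain B where B: "\<And>x. x \<in> {a..b} \<Longrightarrow> \<bar>\<phi> x\<bar> \<le> B" unfolding bounded_iff by fastforce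
  have m: "\<phi> \<in> borel_measurable (ivl a b)"
    using integrable_ivl_continuous[OF smooth_continuous[OF assms(2)], of a b] by (rule
        borel_measurable_integrable)
  show ?thesis
  proof (rule Bochner_Integration.integrable_bound)
    show "integrable (ivl a b) (\<lambda>x. B *\<^sub>R q x)" using assms(1) by simp
    show "(\<lambda>x. \<phi> x *\<^sub>R q x) \<in> borel_measurable (ivl a b)"
      by (rule borel_measurable_scaleR[OF m borel_measurable_integrable[OF assms(1)]])
    show "AE x in ivl a b. norm (\<phi> x *\<^sub>R q x) \<le> norm (B *\<^sub>R q x)"
    proof (rule AE_I2)
      fix x assume "x \<in> space (ivl a b)"
      hence "\<bar>\<phi> x\<bar> \<le> \<bar>B\<bar>" using B[of x] by auto
      thus "norm (\<phi> x *\<^sub>R q x) \<le> norm (B *\<^sub>R q x)" by (simp add: mult_right_mono)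
    qed
  qed
qed

text \<open>
  The difference of two steps is bounded by one and tends to the indicator function of \<open>[s,t]\<close>
  away from the end points, so dominated convergence applies to every integrable \<open>q\<close>.
\<close>

lemma step_test_limit:
  fixes q :: "real \<Rightarrow> 'v::euclidean_space"
  assumes q: "integrable (ivl a b) q" and st: "a < s" "s \<le> t" "t < b"
    and h: "\<And>n::nat. h n > 0" "h \<longlonglongrightarrow> 0"
  shows "(\<lambda>n. \<integral>x. (scaled_step (h n) s x - scaled_step (h n) t x) *\<^sub>R q x \<partial>ivl a b) \<longlonglongrightarrow> integral {s..t} q"
proof -
  have n: "AE x in ivl a b. x \<noteq> s \<and> x \<noteq> t"
  proof -
    have "AE x in lebesgue. x \<notin> {s, t}"
      by (rule AE_not_in) (simp add: negligible_iff_null_sets[symmetric])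
    thus ?thesis by (subst AE_restrict_space_iff) (auto elim: eventually_mono)
  qed
  have "(\<lambda>n. \<integral>x. (scaled_step (h n) s x - scaled_step (h n) t x) *\<^sub>R q x \<partial>ivl a b)
      \<longlonglongrightarrow> (\<integral>x. indicator {s..t} x *\<^sub>R q x \<partial>ivl a b)"
  proof (rule integral_dominated_convergence)
    show "integrable (ivl a b) (\<lambda>x. norm (q x))" using q by simp
    show "(\<lambda>x. indicator {s..t} x *\<^sub>R q x) \<in> borel_measurable (ivl a b)"
      by (rule borel_measurable_scaleR[OF borel_measurable_indicator borel_measurable_integrable[OF q]])
        (use st in \<open>auto simp: sets_restrict_space intro!: image_eqI[of _ _ "{s..t}"]\<close>)
    show "(\<lambda>x. (scaled_step (h i) s x - scaled_step (h i) t x) *\<^sub>R q x) \<in> borel_measurable (ivl a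
        b)" for i
    proof -
      have "smooth (\<lambda>x. 1 * scaled_step (h i) s x + (-1) * scaled_step (h i) t x)"
        by (intro smooth_lin smooth_scaled_step)
      from integrable_ivl_cmult[OF q this] show ?thesis by (simp add: borel_measurable_integrable)
    qed
    show "AE x in ivl a b. (\<lambda>i. (scaled_step (h i) s x - scaled_step (h i) t x) *\<^sub>R q x) \<longlonglongrightarrow> indicator
        {s..t} x *\<^sub>R q x"
      using n
    proof eventually_elim
      case (elim x)
      hence "(\<lambda>i. (scaled_step (h i) s x - scaled_step (h i) t x) *\<^sub>R q x) \<longlonglongrightarrow>
         ((if x < s then 0 else 1) - (if x < t then 0 else 1)) *\<^sub>R q x"
        by (intro tendsto_intros scaled_step_limit h) auto
      also have "((if x < s then 0 else 1) - (if x < t then 0 else 1)) *\<^sub>R q x = indicator {s..t} x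
          *\<^sub>R q x"
        using elim st by (auto simp: indicator_def)
      finally show ?case .
    qed
    show "AE x in ivl a b. norm ((scaled_step (h i) s x - scaled_step (h i) t x) *\<^sub>R q x) \<le> norm (q
        x)" for i
    proof (rule AE_I2)
      fix x
      have "\<bar>scaled_step (h i) s x - scaled_step (h i) t x\<bar> \<le> 1"
        using scaled_step_simps(3,4)[OF h(1)[of i], of s x] scaled_step_simps(3,4)[OF h(1)[of i], of
            t x] by auto
      thus "norm ((scaled_step (h i) s x - scaled_step (h i) t x) *\<^sub>R q x) \<le> norm (q x)"
        by (simp add: mult_left_le_one_le)
    qed
  qed
  also have "(\<integral>x. indicator {s..t} x *\<^sub>R q x \<partial>ivl a b) = integral {s..t} q"
  proof -
    have sub: "{s..t} \<subseteq> {a<..<b}" using st by auto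
    have "(\<integral>x. indicator {s..t} x *\<^sub>R q x \<partial>ivl a b) = integral\<^sup>L (lebesgue_on {s..t}) q"
    proof -
      have "(\<lambda>x. indicator {a<..<b} x *\<^sub>R indicator {s..t} x *\<^sub>R q x) = (\<lambda>x. indicator {s..t} x *\<^sub>R q x)"
        using sub by (auto simp: indicator_def fun_eq_iff)
      thus ?thesis by (simp add: integral_restrict_space)
    qed
    also have "\<dots> = integral {s..t} q"
      by (rule lebesgue_integral_eq_integral[OF integrable_ivl_subset[OF q sub]]) auto
    finally show ?thesis .
  qed
  finally show ?thesis .
qed

lemma vanishing_radii:
  assumes "(d::real) > 0"
  shows "\<exists>h :: nat \<Rightarrow> real. (\<forall>n. 0 < h n) \<and> (\<forall>n. h n \<le> d) \<and> h \<longlonglongrightarrow> 0"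
proof (intro exI conjI)
  show "(\<lambda>n. d / real (Suc n)) \<longlonglongrightarrow> 0"
    using tendsto_mult[OF tendsto_const LIMSEQ_inverse_real_of_nat, of d] by (simp add: divide_inverse)
qed (use assms in \<open>auto simp: field_simps\<close>)

text \<open>
  Test with a smoothed indicator function of \<open>[s,t]\<close>. Its derivative is a difference of two
  bumps, which evaluates the continuous function \<open>p\<close> at \<open>s\<close> and \<open>t\<close> in the limit.
\<close>

lemma weak_deriv_1_continuous_interior:
  fixes p q :: "real \<Rightarrow> 'v::euclidean_space"
  assumes wd: "weak_deriv a b 1 p q" and p: "continuous_on {a..b} p" and q: "integrable (ivl a b) q"
    and st: "a < s" "s \<le> t" "t < b"
  shows "p t - p s = integral {s..t} q"
proof -
  define \<delta> where "\<delta> = min (s - a) (b - t) / 2"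
  have \<delta>: "\<delta> > 0" "a < s - \<delta>" "t + \<delta> < b" using st by (auto simp: \<delta>_def min_def field_simps)
  obtain h :: "nat \<Rightarrow> real" where h: "\<And>n. h n > 0" "\<And>n. h n \<le> \<delta>" and hl: "h \<longlonglongrightarrow> 0"
    using vanishing_radii[OF \<delta>(1)] by blast
  have eq: "(\<integral>x. bump (h n) s x *\<^sub>R p x \<partial>ivl a b) - (\<integral>x. bump (h n) t x *\<^sub>R p x \<partial>ivl a b)
     = - (\<integral>x. (scaled_step (h n) s x - scaled_step (h n) t x) *\<^sub>R q x \<partial>ivl a b)" for n
  proof -
    have "(\<lambda>x. scaled_step (h n) s x - scaled_step (h n) t x) \<in> test_functions a b"
      by (rule step_test_function) (use h[of n] \<delta> st in auto)
    hence "(\<integral>x. (bump (h n) s x - bump (h n) t x) *\<^sub>R p x \<partial>ivl a b)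
      = - (\<integral>x. (scaled_step (h n) s x - scaled_step (h n) t x) *\<^sub>R q x \<partial>ivl a b)"
      using wd by (force simp: weak_deriv_def deriv_scaled_step_diff[OF h(1)])
    moreover have "integrable (ivl a b) (\<lambda>x. bump (h n) r x *\<^sub>R p x)" for r
      by (intro integrable_ivl_continuous continuous_intros continuous_bump p h)
    ultimately show ?thesis by (simp add: scaleR_diff_left)
  qed
  have "(\<lambda>n. (\<integral>x. bump (h n) s x *\<^sub>R p x \<partial>ivl a b) - (\<integral>x. bump (h n) t x *\<^sub>R p x \<partial>ivl a b)) \<longlonglongrightarrow> p s - p t"
    using st by (intro tendsto_intros bump_limit p h hl) auto
  moreover have "(\<lambda>n. - (\<integral>x. (scaled_step (h n) s x - scaled_step (h n) t x) *\<^sub>R q x \<partial>ivl a b)) \<longlonglongrightarrow> -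
      integral {s..t} q"
    using st by (intro tendsto_intros step_test_limit q h hl) auto
  ultimately have "p s - p t = - integral {s..t} q" unfolding eq by (rule LIMSEQ_unique)
  thus ?thesis by (simp add: algebra_simps)
qed

lemma weak_deriv_1_continuous:
  fixes p q :: "real \<Rightarrow> 'v::euclidean_space"
  assumes wd: "weak_deriv a b 1 p q" and p: "continuous_on {a..b} p" and q: "integrable (ivl a b) q"
    and st: "a \<le> s" "s \<le> t" "t \<le> b"
  shows "p t - p s = integral {s..t} q"
proof (cases "a < b")
  case False
  hence "s = t" using st by simp
  thus ?thesis by simp
next
  case ab: True
  have qi: "q integrable_on {a..b}"
    using q by (simp add: integrable_ivl_iff absolutely_integrable_on_def)
  define F where "F = (\<lambda>x. p x - integral {a..x} q)"
  have Fc: "continuous_on {a..b} F"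
    unfolding F_def by (intro continuous_intros p indefinite_integral_continuous_1 qi)
  have add: "integral {a..y} q = integral {a..x} q + integral {x..y} q" if "a \<le> x" "x \<le> y" "y \<le> b"
      for x y
    using Henstock_Kurzweil_Integration.integral_combine[of a x y q] that
      integrable_on_subinterval[OF qi, of a y] by auto
  define m where "m = (a + b) / 2"
  have m: "a < m" "m < b" using ab by (auto simp: m_def)
  have Fm: "F x = F m" if "x \<in> {a<..<b}" for x
  proof (cases "x \<le> m")
    case True
    thus ?thesis using weak_deriv_1_continuous_interior[OF wd p q, of x m] add[of x m] m that
      by (auto simp: F_def algebra_simps)
  next
    case False
    thus ?thesis using weak_deriv_1_continuous_interior[OF wd p q, of m x] add[of m x] m that
      by (auto simp: F_def algebra_simps)
  qed
  have "F x = F m" if "x \<in> {a..b}" for x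
    using continuous_constant_on_closure[of "{a<..<b}" F "F m" x] Fc Fm that ab by simp
  hence "F t = F s" using st by simp
  thus ?thesis using add[of s t] st by (auto simp: F_def algebra_simps)
qed

text \<open>
  The expression on the left applies the second-order difference \<open>\<delta>\<^sub>t\<^sub>+\<^sub>s - (1 + \<theta>) \<delta>\<^sub>t + \<theta>
  \<delta>\<^sub>t\<^sub>-\<^sub>\<tau>\<close> with \<open>\<theta> = s / \<tau>\<close> to \<open>p\<close>. It annihilates affine functions, hence it is the second
  derivative of a hat function supported in \<open>[t - \<tau>, t + s]\<close>, of height at most \<open>2 \<tau>\<close>. The
  smoothed hat is a test function, and the weak derivative \<open>r\<close> is integrated against it over a
  length of about \<open>2 \<tau>\<close>.
\<close>

lemma weak_deriv_2_extrapolation_interior: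
  fixes p r :: "real \<Rightarrow> real"
  assumes wd: "weak_deriv a b 2 p r" and p: "continuous_on {a..b} p" and r: "integrable (ivl a b) r"
    and K: "AE x in ivl a b. \<bar>r x\<bar> \<le> K" "K \<ge> 0"
    and st: "a < t - \<tau>" "0 \<le> s" "s \<le> \<tau>" "0 < \<tau>" "t + s < b"
  shows "\<bar>p (t + s) - p t - (s / \<tau>) * (p t - p (t - \<tau>))\<bar> \<le> 4 * K * \<tau>\<^sup>2"
proof -
  define \<theta> where "\<theta> = s / \<tau>"
  have \<theta>: "0 \<le> \<theta>" "\<theta> * \<tau> = s" using st by (auto simp: \<theta>_def)
  define \<delta> where "\<delta> = min (t - \<tau> - a) (b - t - s) / 2"
  have \<delta>: "\<delta> > 0" "a < t - \<tau> - \<delta>" "t + s + \<delta> < b" using st by (auto simp: \<delta>_def min_def field_simps)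
  obtain h :: "nat \<Rightarrow> real" where h: "\<And>n. h n > 0" "\<And>n. h n \<le> \<delta>" and hl: "h \<longlonglongrightarrow> 0"
    using vanishing_radii[OF \<delta>(1)] by blast
  let ?B = "\<lambda>n x. \<integral>y. bump (h n) x y *\<^sub>R p y \<partial>ivl a b"
  define I where "I = (\<lambda>n. ?B n (t + s) - (1 + \<theta>) * ?B n t + \<theta> * ?B n (t - \<tau>))"
  have bound: "\<bar>I n\<bar> \<le> 2 * \<tau> * K * (2 * \<tau> + 2 * h n)" for n
  proof -
    define \<phi> where "\<phi> = (\<lambda>x. scaled_ramp (h n) (t + s) x - (1 + \<theta>) * scaled_ramp (h n) t x + \<theta> *
        scaled_ramp (h n) (t - \<tau>) x)"
    define \<phi>1 where "\<phi>1 = (\<lambda>x. scaled_step (h n) (t + s) x - (1 + \<theta>) * scaled_step (h n) t x + \<theta> *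
        scaled_step (h n) (t - \<tau>) x)"
    define \<phi>2 where "\<phi>2 = (\<lambda>x. bump (h n) (t + s) x - (1 + \<theta>) * bump (h n) t x + \<theta> * bump (h n) (t -
        \<tau>) x)"
    have d1: "deriv \<phi> = \<phi>1" unfolding \<phi>_def \<phi>1_def
      by (intro ext DERIV_imp_deriv) (auto intro!: derivative_eq_intros DERIV_scaled_ramp h)
    have d2: "deriv \<phi>1 = \<phi>2" unfolding \<phi>1_def \<phi>2_def
      by (intro ext DERIV_imp_deriv) (auto intro!: derivative_eq_intros DERIV_scaled_step h)
    have "smooth (\<lambda>x. 1 * (1 * scaled_ramp (h n) (t + s) x + (- (1 + \<theta>)) * scaled_ramp (h n) t x) +
        \<theta> * scaled_ramp (h n) (t - \<tau>) x)"
      by (intro smooth_lin smooth_scaled_ramp h)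
    hence sm: "smooth \<phi>" by (simp add: \<phi>_def algebra_simps)
    have zl: "\<phi> x = 0" if "x < t - \<tau> - h n" for x
      using that st h(1)[of n] by (auto simp: \<phi>_def scaled_ramp_simps)
    have zr: "\<phi> x = 0" if "x > t + s + h n" for x
    proof -
      \<comment> \<open>On the far right the three ramps are affine; the coefficients sum to zero and so do the first
        moments.\<close>
      have "\<phi> x = - s + \<theta> * \<tau>"
        using that st h(1)[of n] by (auto simp: \<phi>_def scaled_ramp_simps algebra_simps)
      thus ?thesis using \<theta> by simp
    qed
    have tf: "\<phi> \<in> test_functions a b"
      unfolding test_functions_def mem_Collect_eq
    proof (intro conjI exI)
      show "\<forall>n x. (deriv ^^ n) \<phi> field_differentiable at x" using sm by (simp add: smooth_def)
      show "a < t - \<tau> - h n" "t + s + h n < b" using \<delta> h(2)[of n] by auto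
      show "\<forall>x. x \<notin> {t - \<tau> - h n..t + s + h n} \<longrightarrow> \<phi> x = 0" using zl zr by auto
    qed
    have \<phi>b: "\<bar>\<phi> x\<bar> \<le> 2 * \<tau>" for x
    proof -
      \<comment> \<open>Grouping into differences of ramps gives the height without using the shape of the hat.\<close>
      have "\<phi> x = (scaled_ramp (h n) (t + s) x - scaled_ramp (h n) t x) - \<theta> * (scaled_ramp (h n) t x
          - scaled_ramp (h n) (t - \<tau>) x)"
        by (simp add: \<phi>_def algebra_simps)
      also have "\<bar>\<dots>\<bar> \<le> \<bar>scaled_ramp (h n) (t + s) x - scaled_ramp (h n) t x\<bar> + \<theta> * \<bar>scaled_ramp (h
          n) t x - scaled_ramp (h n) (t - \<tau>) x\<bar>"
        using \<theta> by (intro order_trans[OF abs_triangle_ineq4]) (auto simp: abs_mult)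
      also have "\<dots> \<le> \<bar>(t + s) - t\<bar> + \<theta> * \<bar>t - (t - \<tau>)\<bar>"
        using \<theta> h by (intro add_mono mult_left_mono scaled_ramp_simps) auto
      also have "\<dots> = 2 * s" using \<theta> st by simp
      finally show ?thesis using st by simp
    qed
    have "(\<integral>x. (deriv ^^ 2) \<phi> x *\<^sub>R p x \<partial>ivl a b) = (-1) ^ 2 *\<^sub>R (\<integral>x. \<phi> x *\<^sub>R r x \<partial>ivl a b)"
      using wd tf unfolding weak_deriv_def by blast
    hence e1: "(\<integral>x. \<phi>2 x *\<^sub>R p x \<partial>ivl a b) = (\<integral>x. \<phi> x *\<^sub>R r x \<partial>ivl a b)"
      by (simp add: numeral_2_eq_2 d1 d2)
    have bi: "integrable (ivl a b) (\<lambda>y. bump (h n) x y * p y)" for x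
      by (intro integrable_ivl_continuous continuous_intros continuous_bump p h)
    have "(\<integral>x. \<phi>2 x *\<^sub>R p x \<partial>ivl a b) = (\<integral>x. bump (h n) (t + s) x * p x - (1 + \<theta>) * (bump (h n) t x
        * p x) + \<theta> * (bump (h n) (t - \<tau>) x * p x) \<partial>ivl a b)"
      by (rule Bochner_Integration.integral_cong) (auto simp: \<phi>2_def algebra_simps)
    also have "\<dots> = I n"
      using bi by (simp add: I_def)
    finally have "\<bar>I n\<bar> = \<bar>\<integral>x. \<phi> x * r x \<partial>ivl a b\<bar>" using e1 by simp
    also have "\<dots> \<le> (\<integral>x. \<bar>\<phi> x * r x\<bar> \<partial>ivl a b)" by (rule integral_abs_bound)
    also have "\<dots> \<le> (\<integral>x. (2 * \<tau> * K) * indicator {t - \<tau> - h n..t + s + h n} x \<partial>ivl a b)"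
    proof (rule integral_mono_AE)
      show "integrable (ivl a b) (\<lambda>x. \<bar>\<phi> x * r x\<bar>)" using integrable_ivl_cmult[OF r sm] by simp
      show "integrable (ivl a b) (\<lambda>x. (2 * \<tau> * K) * indicator {t - \<tau> - h n..t + s + h n} x)"
      proof (intro integrable_mult_right integrable_real_indicator)
        show "{t - \<tau> - h n..t + s + h n} \<in> sets (ivl a b)"
          using \<delta> h(2)[of n] by (auto simp: sets_restrict_space intro!: image_eqI[of _ _ "{t - \<tau> - h
              n..t + s + h n}"])
        show "emeasure (ivl a b) {t - \<tau> - h n..t + s + h n} < \<infinity>"
          using finite_measure.emeasure_finite[OF finite_measure_ivl] by (simp add: less_top)
      qed
      show "AE x in ivl a b. \<bar>\<phi> x * r x\<bar> \<le> (2 * \<tau> * K) * indicator {t - \<tau> - h n..t + s + h n} x"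
        using K(1)
      proof eventually_elim
        case (elim x)
        show ?case
        proof (cases "x \<in> {t - \<tau> - h n..t + s + h n}")
          case True
          thus ?thesis using mult_mono[OF \<phi>b elim] st by (auto simp: abs_mult)
        next
          case False
          thus ?thesis using zl zr by (auto simp: not_le)
        qed
      qed
    qed
    also have "\<dots> = 2 * \<tau> * K * (\<tau> + s + 2 * h n)"
    proof -
      have "{a<..<b} \<inter> {t - \<tau> - h n..t + s + h n} = {t - \<tau> - h n..t + s + h n}"
        using \<delta> h(2)[of n] by auto
      moreover have "{t - \<tau> - h n..t + s + h n} \<subseteq> {a<..<b}" using \<delta> h(2)[of n] by auto
      hence "measure (ivl a b) {t - \<tau> - h n..t + s + h n} = measure lebesgue {t - \<tau> - h n..t + s + h n}"
        by (intro measure_restrict_space) auto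
      ultimately show ?thesis using st h(1)[of n] by (simp add: Int_commute)
    qed
    also have "\<dots> \<le> 2 * \<tau> * K * (2 * \<tau> + 2 * h n)"
      using st K(2) by (intro mult_left_mono) auto
    finally show ?thesis .
  qed
  have "(\<lambda>n. \<bar>I n\<bar>) \<longlonglongrightarrow> \<bar>p (t + s) - (1 + \<theta>) * p t + \<theta> * p (t - \<tau>)\<bar>"
    unfolding I_def using st by (intro tendsto_intros bump_limit p h hl) auto
  moreover have "(\<lambda>n. 2 * \<tau> * K * (2 * \<tau> + 2 * h n)) \<longlonglongrightarrow> 2 * \<tau> * K * (2 * \<tau> + 2 * 0)"
    by (intro tendsto_intros hl)
  ultimately have "\<bar>p (t + s) - (1 + \<theta>) * p t + \<theta> * p (t - \<tau>)\<bar> \<le> 2 * \<tau> * K * (2 * \<tau> + 2 * 0)"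
    using bound by (intro LIMSEQ_le) auto
  thus ?thesis by (simp add: \<theta>_def[symmetric] algebra_simps power2_eq_square)
qed

text \<open>
  When a node lies at an end of the interval, contract the three nodes towards the midpoint.
  This keeps the ratio \<open>s / \<tau>\<close>, and continuity of \<open>p\<close> gives the claim in the limit.
\<close>

lemma weak_deriv_2_extrapolation:
  fixes p r :: "real \<Rightarrow> real"
  assumes wd: "weak_deriv a b 2 p r" and p: "continuous_on {a..b} p" and r: "integrable (ivl a b) r"
    and K: "AE x in ivl a b. \<bar>r x\<bar> \<le> K" "K \<ge> 0"
    and st: "a \<le> t - \<tau>" "0 \<le> s" "s \<le> \<tau>" "0 < \<tau>" "t + s \<le> b"
  shows "\<bar>p (t + s) - p t - (s / \<tau>) * (p t - p (t - \<tau>))\<bar> \<le> 4 * K * \<tau>\<^sup>2"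
proof -
  define m where "m = (a + b) / 2"
  define g where "g = (\<lambda>l x. m + l * (x - m))"
  have ab: "a < b" using st by linarith
  have gin: "a < g l x \<and> g l x < b" if "0 < l" "l < 1" "a \<le> x" "x \<le> b" for l x
  proof -
    define P Q R S where "P = l * (b - a)" and "Q = l * (x - m)" and "R = l * (b - m)" and "S = l *
        (a - m)"
    have "P < 1 * (b - a)" unfolding P_def using that ab by (intro mult_strict_right_mono) auto
    moreover have "Q \<le> R" "S \<le> Q" unfolding Q_def R_def S_def using that by auto
    moreover have "2 * R = P" "2 * S = - P"
      by (simp_all add: m_def field_simps P_def R_def S_def)
    moreover have "2 * m = a + b" by (simp add: m_def)
    ultimately show ?thesis unfolding g_def Q_def[symmetric] by auto
  qed
  have gin': "g l x \<in> {a..b}" if "0 < l" "l \<le> 1" "x \<in> {a..b}" for l x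
    using gin[of l x] that by (cases "l = 1") (auto simp: g_def)
  define D where "D = (\<lambda>l. \<bar>p (g l (t + s)) - p (g l t) - (s / \<tau>) * (p (g l t) - p (g l (t - \<tau>)))\<bar>)"
  have lim: "((\<lambda>l. p (g l x)) \<longlongrightarrow> p x) (at_left 1)" if "x \<in> {a..b}" for x
  proof -
    have "continuous_on {0<..1} (\<lambda>l. p (g l x))"
      by (rule continuous_on_compose2[OF p]) (use that gin' in \<open>auto simp: g_def intro!:
          continuous_intros\<close>)
    hence "((\<lambda>l. p (g l x)) \<longlongrightarrow> p (g 1 x)) (at 1 within {0<..1})"
      by (auto simp: continuous_on_def)
    moreover have "at_left (1::real) = at 1 within {0<..1}"
      by (rule at_within_nhd[of _ "{0<..}"]) auto
    ultimately show ?thesis by (simp add: g_def)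
  qed
  have "(D \<longlongrightarrow> \<bar>p (t + s) - p t - (s / \<tau>) * (p t - p (t - \<tau>))\<bar>) (at_left 1)"
    unfolding D_def using st by (intro tendsto_intros lim) auto
  moreover have "eventually (\<lambda>l. D l \<le> 4 * K * \<tau>\<^sup>2) (at_left 1)"
  proof -
    have "eventually (\<lambda>l::real. l \<in> {0<..<1}) (at_left 1)" by (rule eventually_at_left_real) simp
    thus ?thesis
    proof eventually_elim
      case (elim l)
      hence l: "0 < l" "l < 1" by auto
      have e: "g l (t + s) = g l t + l * s" "g l (t - \<tau>) = g l t - l * \<tau>" "s / \<tau> = (l * s) / (l * \<tau>)"
        using l by (auto simp: g_def algebra_simps)
      have "D l \<le> 4 * K * (l * \<tau>)\<^sup>2"
        unfolding D_def e(1,2) unfolding e(3)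
        by (rule weak_deriv_2_extrapolation_interior[OF wd p r K])
          (use l st gin[of l "t + s"] gin[of l "t - \<tau>"] e in \<open>auto intro!: mult_left_mono\<close>)
      also have "\<dots> \<le> 4 * K * \<tau>\<^sup>2"
        using l st K by (intro mult_left_mono power_mono) (auto simp: mult_left_le_one_le)
      finally show ?case .
    qed
  qed
  ultimately show ?thesis
    by (intro tendsto_upperbound[of D _ "at_left 1"]) auto
qed

lemma completion_ex_borel_measurable_euclidean:
  fixes g :: "'a \<Rightarrow> 'v::euclidean_space"
  assumes g: "g \<in> borel_measurable (completion M)"
  shows "\<exists>g'\<in>borel_measurable M. (AE x in M. g x = g' x)"
proof -
  have "\<forall>b. \<exists>g'\<in>borel_measurable M. (AE x in M. g x \<bullet> b = g' x)"
    using g by (intro allI completion_ex_borel_measurable_real borel_measurable_inner) auto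
  then obtain G where G: "\<And>b. G b \<in> borel_measurable M" "\<And>b. AE x in M. g x \<bullet> b = G b x"
    by metis
  have "AE x in M. \<forall>b\<in>Basis. g x \<bullet> b = G b x"
    using G(2) by (subst AE_ball_countable) (simp_all add: countable_finite)
  hence "AE x in M. g x = (\<Sum>b\<in>Basis. G b x *\<^sub>R b)"
  proof eventually_elim
    case (elim x)
    have "g x = (\<Sum>b\<in>Basis. (g x \<bullet> b) *\<^sub>R b)" by (simp add: euclidean_representation)
    thus ?case using elim by simp
  qed
  moreover have "(\<lambda>x. \<Sum>b\<in>Basis. G b x *\<^sub>R b) \<in> borel_measurable M"
    by (rule borel_measurable_sum, rule borel_measurable_scaleR[OF G(1) borel_measurable_const])
  ultimately show ?thesis by (rule bexI)
qed

text \<open>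
  Compact intervals are stable under intersection and generate the Borel sets, so the integral
  of a Borel version of \<open>g\<close> vanishes on every Borel set, which forces \<open>g = 0\<close> almost everywhere.
\<close>

lemma AE_zero_if_interval_integrals_zero:
  fixes g :: "real \<Rightarrow> 'v::euclidean_space"
  assumes g: "integrable lebesgue g"
    and z: "\<And>s t. s \<le> t \<Longrightarrow> (LINT x:{s..t}|lebesgue. g x) = 0"
    and tot: "integral\<^sup>L lebesgue g = 0"
  shows "AE x in lebesgue. g x = 0"
proof -
  obtain g' where g': "g' \<in> borel_measurable lborel" "AE x in lborel. g x = g' x"
    using completion_ex_borel_measurable_euclidean[OF borel_measurable_integrable[OF g]] by blast
  have ae: "AE x in lebesgue. g x = g' x" by (rule AE_completion[OF g'(2)])
  have g'i: "integrable lebesgue g'"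
    by (rule integrable_cong_AE_imp[OF g measurable_completion]) (use ae g'(1) in auto)
  have g'l: "integrable lborel g'" using g'i g'(1) by (simp add: integrable_completion)
  have eq: "(LINT x:A|lborel. g' x) = (LINT x:A|lebesgue. g x)" if A: "A \<in> sets borel" for A
  proof -
    have "(LINT x:A|lborel. g' x) = (LINT x:A|lebesgue. g' x)"
      unfolding set_lebesgue_integral_def
      by (rule integral_completion[symmetric]) (use A g'(1) in auto)
    also have "\<dots> = (LINT x:A|lebesgue. g x)"
      unfolding set_lebesgue_integral_def
    proof (rule integral_cong_AE)
      have A': "(indicator A :: real \<Rightarrow> real) \<in> borel_measurable lebesgue"
        using A by (intro borel_measurable_indicator) auto
      show "(\<lambda>x. indicator A x *\<^sub>R g' x) \<in> borel_measurable lebesgue"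
        by (rule borel_measurable_scaleR[OF A' measurable_completion[OF g'(1)]])
      show "(\<lambda>x. indicator A x *\<^sub>R g x) \<in> borel_measurable lebesgue"
        by (rule borel_measurable_scaleR[OF A' borel_measurable_integrable[OF g]])
      show "AE x in lebesgue. indicator A x *\<^sub>R g' x = indicator A x *\<^sub>R g x"
        using ae by eventually_elim simp
    qed
    finally show ?thesis .
  qed
  have "(LINT x:A|lborel. g' x) = 0" if A: "A \<in> sets lborel" for A
  proof -
    let ?G = "range (\<lambda>(a,b). {a..b::real})"
    have b: "(borel :: real measure) = sigma UNIV ?G" by (rule borel_eq_atLeastAtMost)
    have A': "A \<in> sigma_sets UNIV ?G" using A by (simp add: b)
    have sb: "B \<in> sets borel" if "B \<in> sigma_sets UNIV ?G" for B using that by (simp add: b)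
    have "Int_stable ?G" by (auto simp: Int_stable_def)
    moreover have "?G \<subseteq> Pow UNIV" by auto
    ultimately show ?thesis using A'
    proof (induction rule: sigma_sets_induct_disjoint)
      case (basic B)
      then obtain s t where B: "B = {s..t}" by auto
      show ?case
      proof (cases "s \<le> t")
        case True thus ?thesis using z[OF True] eq[of B] by (simp add: B)
      next
        case False thus ?thesis by (simp add: B set_lebesgue_integral_def)
      qed
    next
      case empty show ?case by (simp add: set_lebesgue_integral_def)
    next
      case (compl B)
      note Bb = sb[OF compl(1)]
      have s1: "set_integrable lborel C g'" if "C \<in> sets borel" for C
        using integrable_mult_indicator[OF _ g'l, of C] that by (simp add: set_integrable_def)
      have "(LINT x:UNIV|lborel. g' x) = (LINT x:B \<union> (UNIV - B)|lborel. g' x)" by simp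
      also have "\<dots> = (LINT x:B|lborel. g' x) + (LINT x:(UNIV - B)|lborel. g' x)"
        by (rule set_integral_Un) (use Bb s1 in auto)
      also have "(LINT x:UNIV|lborel. g' x) = 0"
        using eq[of UNIV] tot by (simp add: set_lebesgue_integral_def)
      finally show ?case using compl(2) by simp
    next
      case (union F)
      have "(LINT x:(\<Union>i. F i)|lborel. g' x) = (\<Sum>i. (LINT x:(F i)|lborel. g' x))"
      proof (rule lebesgue_integral_countable_add)
        have Fb: "F i \<in> sets borel" for i using union(2) by (intro sb) auto
        thus "F i \<in> sets lborel" for i by simp
        show "F i \<inter> F j = {}" if "i \<noteq> j" for i j
          using union(1) that by (auto simp: disjoint_family_on_def)
        show "set_integrable lborel (\<Union>i. F i) g'"
          using integrable_mult_indicator[OF _ g'l, of "\<Union>i. F i"] Fb by (simp add: set_integrable_def)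
      qed
      thus ?case using union(3) by simp
    qed
  qed
  hence "AE x in lborel. g' x = 0" by (intro sigma_finite_measure.density_zero[OF
      sigma_finite_lborel] g'l)
  hence "AE x in lebesgue. g' x = 0" by (rule AE_completion)
  with ae show ?thesis by eventually_elim simp
qed

lemma test_integrable:
  fixes u :: "real \<Rightarrow> 'v::euclidean_space"
  assumes u: "locally_integrable a b u" and \<phi>: "\<phi> \<in> test_functions a b"
  shows "integrable lebesgue (\<lambda>x. \<phi> x *\<^sub>R u x)"
    "integral\<^sup>L (ivl a b) (\<lambda>x. \<phi> x *\<^sub>R u x) = integral\<^sup>L lebesgue (\<lambda>x. \<phi> x *\<^sub>R u x)"
    "integrable (ivl a b) (\<lambda>x. \<phi> x *\<^sub>R u x)"
proof -
  obtain c d where cd: "a < c" "d < b" "\<And>x. x \<notin> {c..d} \<Longrightarrow> \<phi> x = 0"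
    using \<phi> by (auto simp: test_functions_def)
  have "integrable (lebesgue_on {c..d}) u" using u cd by (auto simp: locally_integrable_def)
  hence "integrable (ivl c d) u" 
    using absolutely_integrable_on_Icc_iff_Ioo[of c d u]
    by (simp add: set_integrable_def integrable_restrict_space)
  hence "(\<lambda>x. \<phi> x *\<^sub>R u x) absolutely_integrable_on {c..d}"
    using integrable_ivl_cmult[OF _ test_smooth[OF \<phi>]] by (simp add: integrable_ivl_iff)
  hence "integrable lebesgue (\<lambda>x. indicator {c..d} x *\<^sub>R \<phi> x *\<^sub>R u x)"
    by (simp add: set_integrable_def)
  also have "(\<lambda>x. indicator {c..d} x *\<^sub>R \<phi> x *\<^sub>R u x) = (\<lambda>x. \<phi> x *\<^sub>R u x)"
    using cd(3) by (auto simp: indicator_def fun_eq_iff)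
  finally show i: "integrable lebesgue (\<lambda>x. \<phi> x *\<^sub>R u x)" .
  have e: "(\<lambda>x. indicator {a<..<b} x *\<^sub>R \<phi> x *\<^sub>R u x) = (\<lambda>x. \<phi> x *\<^sub>R u x)"
  proof
    fix x show "indicator {a<..<b} x *\<^sub>R \<phi> x *\<^sub>R u x = \<phi> x *\<^sub>R u x"
      using cd(1,2) cd(3)[of x] by (cases "x \<in> {c..d}") auto
  qed
  show "integrable (ivl a b) (\<lambda>x. \<phi> x *\<^sub>R u x)"
    using i by (simp add: integrable_restrict_space e del: scaleR_scaleR)
  show "integral\<^sup>L (ivl a b) (\<lambda>x. \<phi> x *\<^sub>R u x) = integral\<^sup>L lebesgue (\<lambda>x. \<phi> x *\<^sub>R u x)"
    by (simp add: integral_restrict_space e del: scaleR_scaleR)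
qed

lemma test_functions_mono: "a \<le> c \<Longrightarrow> d \<le> b \<Longrightarrow> test_functions c d \<subseteq> test_functions a b"
proof
  fix \<phi> assume ab: "a \<le> c" "d \<le> b" and "\<phi> \<in> test_functions c d"
  then obtain r s where "\<forall>n x. (deriv ^^ n) \<phi> field_differentiable at x"
      "c < r" "s < d" "\<forall>x. x \<notin> {r..s} \<longrightarrow> \<phi> x = 0"
    unfolding test_functions_def by blast
  moreover from this ab have "a < r" "s < b" by auto
  ultimately show "\<phi> \<in> test_functions a b" unfolding test_functions_def by blast
qed

lemma locally_integrable_subinterval:
  assumes "locally_integrable a b (u :: real \<Rightarrow> 'v::euclidean_space)" "a < c" "d < b"
  shows "integrable (ivl c d) u"
proof -
  have "integrable (lebesgue_on {c..d}) u" using assms by (auto simp: locally_integrable_def)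
  thus ?thesis
    using absolutely_integrable_on_Icc_iff_Ioo[of c d u]
    by (simp add: set_integrable_def integrable_restrict_space)
qed

text \<open>
  The fundamental lemma of the calculus of variations: smoothed indicator functions are test
  functions, so the integral of \<open>w\<close> over every compact subinterval vanishes.
\<close>

lemma AE_zero_if_test_integrals_zero:
  fixes w :: "real \<Rightarrow> 'v::euclidean_space"
  assumes w: "locally_integrable a b w"
    and z: "\<And>\<phi>. \<phi> \<in> test_functions a b \<Longrightarrow> (\<integral>x. \<phi> x *\<^sub>R w x \<partial>ivl a b) = 0"
  shows "AE x in ivl a b. w x = 0"
proof -
  have int0: "integral {s..t} w = 0" if st: "a < s" "s \<le> t" "t < b" for s t
  proof -
    define c d where "c = (a + s) / 2" and "d = (b + t) / 2"
    have cd: "a < c" "c < s" "t < d" "d < b" using st by (auto simp: c_def d_def)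
    define \<delta> where "\<delta> = min (s - c) (d - t) / 2"
    have \<delta>: "\<delta> > 0" "c < s - \<delta>" "t + \<delta> < d" using cd by (auto simp: \<delta>_def min_def field_simps)
    obtain h :: "nat \<Rightarrow> real" where h: "\<And>n. h n > 0" "\<And>n. h n \<le> \<delta>" and hl: "h \<longlonglongrightarrow> 0"
      using vanishing_radii[OF \<delta>(1)] by blast
    have lim: "(\<lambda>n. \<integral>x. (scaled_step (h n) s x - scaled_step (h n) t x) *\<^sub>R w x \<partial>ivl c d) \<longlonglongrightarrow> integral
        {s..t} w"
      by (rule step_test_limit) (use cd st h hl in \<open>auto intro!: locally_integrable_subinterval[OF w]\<close>)
    have "(\<integral>x. (scaled_step (h n) s x - scaled_step (h n) t x) *\<^sub>R w x \<partial>ivl c d) = 0" for n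
    proof -
      have t: "(\<lambda>x. scaled_step (h n) s x - scaled_step (h n) t x) \<in> test_functions c d"
        by (rule step_test_function) (use h[of n] \<delta> st in auto)
      moreover have "test_functions c d \<subseteq> test_functions a b" using cd by (intro
          test_functions_mono) auto
      ultimately have t': "(\<lambda>x. scaled_step (h n) s x - scaled_step (h n) t x) \<in> test_functions a b"
          by auto
      have "locally_integrable c d w" using w cd by (auto simp: locally_integrable_def)
      thus ?thesis using z[OF t'] test_integrable(2)[OF _ t, of w] test_integrable(2)[OF w t'] by simp
    qed
    thus ?thesis using lim LIMSEQ_unique[OF tendsto_const, of 0 "integral {s..t} w"] by simp
  qed
  have sub: "AE x in lebesgue. x \<in> {c..d} \<longrightarrow> w x = 0" if cd: "a < c" "c \<le> d" "d < b" for c d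
  proof -
    have li: "w absolutely_integrable_on {c..d}"
      using locally_integrable_subinterval[OF w, of c d] cd by (simp add: integrable_ivl_iff)
    let ?g = "\<lambda>x. indicator {c..d} x *\<^sub>R w x"
    have gi: "integrable lebesgue ?g" using li by (simp add: set_integrable_def)
    have tot: "(LINT x:{s..t}|lebesgue. w x) = 0" if "c \<le> s" "t \<le> d" for s t
    proof (cases "s \<le> t")
      case True
      have "w absolutely_integrable_on {s..t}" using li by (rule set_integrable_subset) (use that in
          auto)
      hence "(LINT x:{s..t}|lebesgue. w x) = integral {s..t} w" by (rule
          set_lebesgue_integral_eq_integral)
      thus ?thesis using int0[of s t] True that cd by simp
    qed (simp add: set_lebesgue_integral_def)
    have "AE x in lebesgue. ?g x = 0"
    proof (rule AE_zero_if_interval_integrals_zero[OF gi])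
      show "integral\<^sup>L lebesgue ?g = 0" using tot[of c d] by (simp add: set_lebesgue_integral_def)
      fix s t :: real
      have "(LINT x:{s..t}|lebesgue. ?g x) = (LINT x:{max s c..min t d}|lebesgue. w x)"
        unfolding set_lebesgue_integral_def
        by (rule Bochner_Integration.integral_cong) (auto simp: indicator_def)
      thus "(LINT x:{s..t}|lebesgue. ?g x) = 0" using tot[of "max s c" "min t d"] by simp
    qed
    thus ?thesis by eventually_elim (auto simp: indicator_def)
  qed
  have "AE x in lebesgue. \<forall>n::nat. x \<in> {a + 1 / real (Suc n)..b - 1 / real (Suc n)} \<longrightarrow> w x = 0"
  proof (subst AE_all_countable, rule allI)
    fix n :: nat
    define e where "e = 1 / real (Suc n)"
    have e: "e > 0" by (simp add: e_def)
    have "AE x in lebesgue. x \<in> {a + e..b - e} \<longrightarrow> w x = 0"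
    proof (cases "a + e \<le> b - e")
      case True
      show ?thesis by (rule sub[OF _ True]) (use e in auto)
    qed simp
    thus "AE x in lebesgue. x \<in> {a + 1 / real (Suc n)..b - 1 / real (Suc n)} \<longrightarrow> w x = 0"
      by (simp only: e_def)
  qed
  hence "AE x in lebesgue. x \<in> {a<..<b} \<longrightarrow> w x = 0"
  proof eventually_elim
    case (elim x)
    show ?case
    proof
      assume x: "x \<in> {a<..<b}"
      then obtain n :: nat where "inverse (real (Suc n)) < min (x - a) (b - x)"
        using reals_Archimedean[of "min (x - a) (b - x)"] by auto
      hence "x \<in> {a + 1 / real (Suc n)..b - 1 / real (Suc n)}" by (auto simp: inverse_eq_divide)
      thus "w x = 0" using elim by blast
    qed
  qed
  thus ?thesis by (subst AE_restrict_space_iff; simp)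
qed

lemma locally_integrable_diff:
  "locally_integrable a b u \<Longrightarrow> locally_integrable a b v \<Longrightarrow> locally_integrable a b (\<lambda>x. u x - v x)"
  by (simp add: locally_integrable_def)

lemma weak_deriv_unique:
  fixes u v w :: "real \<Rightarrow> 'v::euclidean_space"
  assumes v: "weak_deriv a b l u v" and w: "weak_deriv a b l u w"
  shows "AE x in ivl a b. v x = w x"
proof -
  have lv: "locally_integrable a b v" and lw: "locally_integrable a b w"
    using v w by (auto simp: weak_deriv_def)
  have "AE x in ivl a b. v x - w x = 0"
  proof (rule AE_zero_if_test_integrals_zero[OF locally_integrable_diff[OF lv lw]])
    fix \<phi> assume \<phi>: "\<phi> \<in> test_functions a b"
    have "(\<integral>x. (deriv ^^ l) \<phi> x *\<^sub>R u x \<partial>ivl a b) = (-1) ^ l *\<^sub>R (\<integral>x. \<phi> x *\<^sub>R v x \<partial>ivl a b)"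
      "(\<integral>x. (deriv ^^ l) \<phi> x *\<^sub>R u x \<partial>ivl a b) = (-1) ^ l *\<^sub>R (\<integral>x. \<phi> x *\<^sub>R w x \<partial>ivl a b)"
      using v w \<phi> unfolding weak_deriv_def by blast+
    hence "(-1) ^ l *\<^sub>R (\<integral>x. \<phi> x *\<^sub>R v x \<partial>ivl a b) = (-1) ^ l *\<^sub>R (\<integral>x. \<phi> x *\<^sub>R w x \<partial>ivl a b)"
      by (rule trans[OF sym])
    hence "(\<integral>x. \<phi> x *\<^sub>R v x \<partial>ivl a b) = (\<integral>x. \<phi> x *\<^sub>R w x \<partial>ivl a b)"
      by (rule scaleR_left_imp_eq[rotated]) simp
    hence "(\<integral>x. \<phi> x *\<^sub>R v x - \<phi> x *\<^sub>R w x \<partial>ivl a b) = 0"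
      by (subst Bochner_Integration.integral_diff[OF test_integrable(3)[OF lv \<phi>]
          test_integrable(3)[OF lw \<phi>]]) simp
    thus "(\<integral>x. \<phi> x *\<^sub>R (v x - w x) \<partial>ivl a b) = 0"
      by (simp only: scaleR_diff_right)
  qed
  thus ?thesis by eventually_elim simp
qed

section \<open>Square-integrable functions\<close>

text \<open>The domain and the real value of \<^const>\<open>L2_norm\<close>, which let estimates be carried out in the reals.\<close>

definition sqint :: "real \<Rightarrow> real \<Rightarrow> (real \<Rightarrow> 'v::euclidean_space) \<Rightarrow> bool" where
  "sqint a b u \<longleftrightarrow> u \<in> borel_measurable (ivl a b) \<and> integrable (ivl a b) (\<lambda>x. (norm (u x))\<^sup>2)"

definition l2 :: "real \<Rightarrow> real \<Rightarrow> (real \<Rightarrow> 'v::euclidean_space) \<Rightarrow> real" where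
  "l2 a b u = sqrt (\<integral>x. (norm (u x))\<^sup>2 \<partial>ivl a b)"

lemma L2_norm_eq: "L2_norm a b u = (if sqint a b u then ennreal (l2 a b u) else top)"
  by (simp add: L2_norm_def sqint_def l2_def)

lemma L2_norm_less_top: "L2_norm a b u < top \<longleftrightarrow> sqint a b u"
  by (simp add: L2_norm_eq)

lemma l2_nonneg: "l2 a b u \<ge> 0"
  by (simp add: l2_def)

lemma L2_norm_le_ennreal:
  "K \<ge> 0 \<Longrightarrow> L2_norm a b u \<le> ennreal K \<longleftrightarrow> sqint a b u \<and> l2 a b u \<le> K"
  by (auto simp: L2_norm_eq top_unique)

lemma l2_sq: "(l2 a b u)\<^sup>2 = (\<integral>x. (norm (u x))\<^sup>2 \<partial>ivl a b)"
  by (simp add: l2_def)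

lemma sqint_bound:
  assumes "sqint a b u" "w \<in> borel_measurable (ivl a b)" "AE x in ivl a b. norm (w x) \<le> K * norm (u x)"
  shows "sqint a b w"
proof -
  have "integrable (ivl a b) (\<lambda>x. (norm (w x))\<^sup>2)"
  proof (rule Bochner_Integration.integrable_bound)
    show "integrable (ivl a b) (\<lambda>x. K\<^sup>2 * (norm (u x))\<^sup>2)" using assms(1) by (auto simp: sqint_def)
    show "(\<lambda>x. (norm (w x))\<^sup>2) \<in> borel_measurable (ivl a b)"
      by (intro borel_measurable_power measurable_compose[OF assms(2) borel_measurable_norm])
    show "AE x in ivl a b. norm ((norm (w x))\<^sup>2) \<le> norm (K\<^sup>2 * (norm (u x))\<^sup>2)"
      using assms(3) by eventually_elim (auto simp: power_mult_distrib[symmetric] intro!: power_mono)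
  qed
  thus ?thesis using assms(2) by (simp add: sqint_def)
qed

lemma l2_mono_AE:
  assumes "sqint a b u" "sqint a b w" "AE x in ivl a b. norm (w x) \<le> norm (u x)"
  shows "l2 a b w \<le> l2 a b u"
  unfolding l2_def
  by (intro real_sqrt_le_mono integral_mono_AE)
    (use assms in \<open>auto simp: sqint_def elim!: eventually_mono intro!: power_mono\<close>)

lemma sqint_scaleR: "sqint a b u \<Longrightarrow> sqint a b (\<lambda>x. c *\<^sub>R u x)"
  by (auto simp: sqint_def power_mult_distrib)

lemma l2_scaleR: "l2 a b (\<lambda>x. c *\<^sub>R u x) = \<bar>c\<bar> * l2 a b u"
  by (simp add: l2_def power_mult_distrib real_sqrt_mult)

lemma sqint_add:
  assumes "sqint a b u" "sqint a b w"
  shows "sqint a b (\<lambda>x. u x + w x)"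
proof -
  have m: "(\<lambda>x. u x + w x) \<in> borel_measurable (ivl a b)" using assms by (auto simp: sqint_def)
  have "integrable (ivl a b) (\<lambda>x. (norm (u x + w x))\<^sup>2)"
  proof (rule Bochner_Integration.integrable_bound)
    show "integrable (ivl a b) (\<lambda>x. 2 * (norm (u x))\<^sup>2 + 2 * (norm (w x))\<^sup>2)"
      using assms by (auto simp: sqint_def)
    show "(\<lambda>x. (norm (u x + w x))\<^sup>2) \<in> borel_measurable (ivl a b)"
      by (intro borel_measurable_power measurable_compose[OF m borel_measurable_norm])
    have "(norm (u x + w x))\<^sup>2 \<le> 2 * (norm (u x))\<^sup>2 + 2 * (norm (w x))\<^sup>2" for x
    proof -
      have "(norm (u x + w x))\<^sup>2 \<le> (norm (u x) + norm (w x))\<^sup>2"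
        by (intro power_mono norm_triangle_ineq) auto
      also have "\<dots> \<le> 2 * (norm (u x))\<^sup>2 + 2 * (norm (w x))\<^sup>2"
        using sum_squares_bound[of "norm (u x)" "norm (w x)"] by (simp add: power2_sum)
      finally show ?thesis .
    qed
    thus "AE x in ivl a b. norm ((norm (u x + w x))\<^sup>2) \<le> norm (2 * (norm (u x))\<^sup>2 + 2 * (norm (w x))\<^sup>2)"
      by (intro AE_I2) auto
  qed
  thus ?thesis using m by (simp add: sqint_def)
qed

lemma sqint_minus: "sqint a b u \<Longrightarrow> sqint a b (\<lambda>x. - u x)"
  using sqint_scaleR[of a b u "-1"] by simp

lemma sqint_diff: "sqint a b u \<Longrightarrow> sqint a b w \<Longrightarrow> sqint a b (\<lambda>x. u x - w x)"
  using sqint_add[OF _ sqint_minus[of a b w], of u] by simp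

lemma sqint_norm: "sqint a b u \<Longrightarrow> sqint a b (\<lambda>x. norm (u x))"
  by (auto simp: sqint_def)

lemma l2_norm: "l2 a b (\<lambda>x. norm (u x)) = l2 a b u"
  by (simp add: l2_def)

lemma integrable_inner_sqint:
  assumes "sqint a b u" "sqint a b w"
  shows "integrable (ivl a b) (\<lambda>x. u x \<bullet> w x)"
proof (rule Bochner_Integration.integrable_bound)
  show "integrable (ivl a b) (\<lambda>x. (norm (u x))\<^sup>2 + (norm (w x))\<^sup>2)"
    using assms by (auto simp: sqint_def)
  show "(\<lambda>x. u x \<bullet> w x) \<in> borel_measurable (ivl a b)"
    using assms by (auto simp: sqint_def intro!: borel_measurable_inner)
  have "\<bar>u x \<bullet> w x\<bar> \<le> (norm (u x))\<^sup>2 + (norm (w x))\<^sup>2" for x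
  proof -
    have "\<bar>u x \<bullet> w x\<bar> \<le> norm (u x) * norm (w x)" by (rule Cauchy_Schwarz_ineq2)
    thus ?thesis using sum_squares_bound[of "norm (u x)" "norm (w x)"]
        mult_nonneg_nonneg[of "norm (u x)" "norm (w x)"] by simp
  qed
  thus "AE x in ivl a b. norm (u x \<bullet> w x) \<le> norm ((norm (u x))\<^sup>2 + (norm (w x))\<^sup>2)"
    by (intro AE_I2) auto
qed

lemma l2_sq_lin:
  assumes "sqint a b u" "sqint a b w"
  shows "(l2 a b (\<lambda>x. u x + c *\<^sub>R w x))\<^sup>2 = (l2 a b u)\<^sup>2 + 2 * c * (\<integral>x. u x \<bullet> w x \<partial>ivl a b) + c\<^sup>2 *
      (l2 a b w)\<^sup>2"
proof -
  have "(l2 a b (\<lambda>x. u x + c *\<^sub>R w x))\<^sup>2 = (\<integral>x. (norm (u x))\<^sup>2 + 2 * c * (u x \<bullet> w x) + c\<^sup>2 * (norm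
      (w x))\<^sup>2 \<partial>ivl a b)"
    unfolding l2_sq power2_norm_eq_inner by (rule Bochner_Integration.integral_cong[OF refl])
      (simp add: inner_simps algebra_simps inner_commute power2_eq_square)
  thus ?thesis using assms integrable_inner_sqint[OF assms] by (simp add: l2_sq sqint_def)
qed

lemma l2_Cauchy_Schwarz:
  assumes "sqint a b u" "sqint a b w"
  shows "\<bar>\<integral>x. u x \<bullet> w x \<partial>ivl a b\<bar> \<le> l2 a b u * l2 a b w"
proof -
  let ?B = "\<integral>x. u x \<bullet> w x \<partial>ivl a b" and ?U = "l2 a b u" and ?W = "l2 a b w"
  have q: "0 \<le> ?U\<^sup>2 + 2 * c * ?B + c\<^sup>2 * ?W\<^sup>2" for c
    using l2_sq_lin[OF assms, of c] by (metis zero_le_power2)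
  have "?B\<^sup>2 \<le> (?U * ?W)\<^sup>2"
  proof (cases "?W = 0")
    case True
    have "?B = 0"
    proof (rule ccontr)
      assume B: "?B \<noteq> 0"
      have "0 \<le> ?U\<^sup>2 + 2 * (- (?U\<^sup>2 + 1) / (2 * ?B)) * ?B" using q[of "- (?U\<^sup>2 + 1) / (2 * ?B)"]
          True by simp
      also have "\<dots> = -1" using B by (simp add: field_simps)
      finally show False by simp
    qed
    thus ?thesis by simp
  next
    case False
    have "0 \<le> ?U\<^sup>2 + 2 * (- ?B / ?W\<^sup>2) * ?B + (- ?B / ?W\<^sup>2)\<^sup>2 * ?W\<^sup>2" by (rule q)
    also have "\<dots> = ?U\<^sup>2 - ?B\<^sup>2 / ?W\<^sup>2" using False by (simp add: field_simps power2_eq_square)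
    finally have "?B\<^sup>2 / ?W\<^sup>2 \<le> ?U\<^sup>2" by simp
    thus ?thesis using False by (simp add: field_simps power_mult_distrib)
  qed
  thus ?thesis using l2_nonneg[of a b u] l2_nonneg[of a b w]
    by (metis abs_le_square_iff abs_of_nonneg mult_nonneg_nonneg)
qed

lemma l2_triangle:
  assumes "sqint a b u" "sqint a b w"
  shows "l2 a b (\<lambda>x. u x + w x) \<le> l2 a b u + l2 a b w"
proof -
  have "(l2 a b (\<lambda>x. u x + w x))\<^sup>2 = (l2 a b u)\<^sup>2 + 2 * (\<integral>x. u x \<bullet> w x \<partial>ivl a b) + (l2 a b w)\<^sup>2"
    using l2_sq_lin[OF assms, of 1] by simp
  also have "\<dots> \<le> (l2 a b u)\<^sup>2 + 2 * (l2 a b u * l2 a b w) + (l2 a b w)\<^sup>2"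
    using l2_Cauchy_Schwarz[OF assms] by simp
  also have "\<dots> = (l2 a b u + l2 a b w)\<^sup>2" by (simp add: power2_sum)
  finally show ?thesis using l2_nonneg by (metis add_nonneg_nonneg power2_le_imp_le)
qed

lemma l2_triangle_diff:
  assumes "sqint a b u" "sqint a b w"
  shows "l2 a b (\<lambda>x. u x - w x) \<le> l2 a b u + l2 a b w"
  using l2_triangle[OF assms(1) sqint_minus[OF assms(2)]] l2_scaleR[of a b "-1" w] by simp

lemma l2_cong_AE:
  assumes "sqint a b u" "w \<in> borel_measurable (ivl a b)" "AE x in ivl a b. u x = w x"
  shows "sqint a b w" "l2 a b w = l2 a b u"
proof -
  show s: "sqint a b w" 
    by (rule sqint_bound[OF assms(1,2), of 1]) (use assms(3) in \<open>auto elim: eventually_mono\<close>)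
  show "l2 a b w = l2 a b u"
    by (intro antisym l2_mono_AE assms(1) s) (use assms(3) in \<open>auto elim: eventually_mono\<close>)
qed

lemma sqint_const: "sqint a b (\<lambda>x. c)"
  using finite_measure.integrable_const[OF finite_measure_ivl] by (auto simp: sqint_def)

lemma sqint_bounded:
  assumes "w \<in> borel_measurable (ivl a b)" "AE x in ivl a b. norm (w x) \<le> K"
  shows "sqint a b w"
  by (rule sqint_bound[OF sqint_const[of a b "1::real"] assms(1), of K]) (use assms in auto)

lemma sqint_continuous: "continuous_on {a..b} u \<Longrightarrow> sqint a b (u :: real \<Rightarrow> 'v::euclidean_space)"
  unfolding sqint_def
  by (intro conjI borel_measurable_integrable integrable_ivl_continuous continuous_intros)

lemma sqint_integrable: "sqint a b u \<Longrightarrow> integrable (ivl a b) u"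
proof (rule Bochner_Integration.integrable_bound)
  assume s: "sqint a b u"
  show "integrable (ivl a b) (\<lambda>x. 1 + (norm (u x))\<^sup>2)"
    using s sqint_const[of a b "1::real"] by (intro Bochner_Integration.integrable_add) (auto simp:
        sqint_def)
  show "u \<in> borel_measurable (ivl a b)" using s by (simp add: sqint_def)
  have "norm (u x) \<le> 1 + (norm (u x))\<^sup>2" for x
    using sum_squares_bound[of 1 "norm (u x)"] norm_ge_zero[of "u x"] unfolding power_one by linarith
  thus "AE x in ivl a b. norm (u x) \<le> norm (1 + (norm (u x))\<^sup>2)" by (intro AE_I2) auto
qed

lemma l2_bounded:
  assumes ab: "a \<le> b" and "w \<in> borel_measurable (ivl a b)" "AE x in ivl a b. norm (w x) \<le> K" "K \<ge> 0"
  shows "l2 a b w \<le> K * sqrt (b - a)"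
proof -
  have "l2 a b w \<le> l2 a b (\<lambda>x. K)"
    by (rule l2_mono_AE[OF sqint_const sqint_bounded[OF assms(2,3)]]) (use assms in auto)
  also have "\<dots> = K * sqrt (b - a)"
    using assms by (simp add: l2_def measure_restrict_space space_restrict_space real_sqrt_mult)
  finally show ?thesis .
qed

section \<open>Fourier coefficients and trigonometric sums\<close>

lemma norm_vec_smult: "norm (c *s v) = norm c * norm (v :: complex^2)"
  by (simp add: norm_vec_def norm_mult L2_set_right_distrib)

lemma bounded_bilinear_smult: "bounded_bilinear ((*s) :: complex \<Rightarrow> complex^2 \<Rightarrow> complex^2)"
  by (rule bounded_bilinear.intro)
    (auto simp: vec_eq_iff algebra_simps norm_vec_smult intro!: exI[of _ 1])

interpretation smult: bounded_bilinear "(*s) :: complex \<Rightarrow> complex^2 \<Rightarrow> complex^2"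
  by (rule bounded_bilinear_smult)

lemma smult_of_real: "complex_of_real r *s v = r *\<^sub>R (v :: complex^2)"
  by (simp add: vec_eq_iff scaleR_conv_of_real[where 'a=complex])

text \<open>
  Real inner products are used throughout; multiplication by a complex scalar has the conjugate
  as adjoint, and this is how Fourier coefficients arise from real pairings.
\<close>

lemma inner_smult: "(c *s u) \<bullet> v = u \<bullet> (cnj c *s (v :: complex^2))"
  by (simp add: inner_vec_def inner_complex_def sum_2 algebra_simps)

definition fmode :: "real \<Rightarrow> real \<Rightarrow> int \<Rightarrow> real \<Rightarrow> complex" where
  "fmode a b l x = exp (\<i> * of_real (mu a b l * (x - a)))"

lemma mu_add: "mu a b (k + l) = mu a b k + mu a b l"
  by (simp add: mu_def ring_distribs add_divide_distrib)

lemma fmode_simps: "fmode a b (k + l) x = fmode a b k x * fmode a b l x" "fmode a b 0 x = 1"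
  "cnj (fmode a b l x) = fmode a b (- l) x" "norm (fmode a b l x) = 1"
proof -
  show "fmode a b (k + l) x = fmode a b k x * fmode a b l x"
    by (simp add: fmode_def mu_add exp_add[symmetric] algebra_simps)
  show "fmode a b 0 x = 1" by (simp add: fmode_def mu_def)
  show "cnj (fmode a b l x) = fmode a b (- l) x" by (simp add: fmode_def mu_def exp_cnj)
  show "norm (fmode a b l x) = 1" by (simp add: fmode_def)
qed

lemma fourier_coeff_fmode: "fourier_coeff a b U l = (1 / (b - a)) *\<^sub>R (\<integral>x. fmode a b (- l) x *s U x
    \<partial>ivl a b)"
  by (simp add: fourier_coeff_def fmode_def mu_def)

lemma fmode_a: "fmode a b l a = 1" by (simp add: fmode_def)

lemma fmode_b: "a < b \<Longrightarrow> fmode a b l b = 1"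
proof -
  assume "a < b"
  hence "mu a b l * (b - a) = of_int l * (pi * 2)" by (simp add: mu_def)
  hence "fmode a b l b = exp (\<i> * of_real (of_int l * (pi * 2)))" by (simp only: fmode_def)
  also have "\<dots> = 1" by simp
  finally show ?thesis .
qed

lemma fmode_deriv: "(fmode a b l has_vector_derivative (\<i> * of_real (mu a b l)) * fmode a b l x) (at
    x within S)"
proof -
  let ?m = "\<i> * complex_of_real (mu a b l)"
  have "((\<lambda>z. exp (?m * (z - of_real a))) has_field_derivative ?m * exp (?m * (of_real x - of_real
      a))) (at (of_real x))"
    by (auto intro!: derivative_eq_intros)
  from has_vector_derivative_real_field[OF this, of S]
  show ?thesis by (simp add: fmode_def[abs_def] mult.assoc)
qed

lemma continuous_fmode: "continuous_on S (fmode a b l)"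
  unfolding fmode_def by (intro continuous_intros)

lemma integral_fmode:
  assumes "a < b"
  shows "integral\<^sup>L (ivl a b) (fmode a b l) = (if l = 0 then of_real (b - a) else 0)"
proof (cases "l = 0")
  case True
  have "fmode a b 0 = (\<lambda>x. 1)" by (simp add: fun_eq_iff fmode_simps)
  thus ?thesis using assms True by (simp add: measure_restrict_space space_restrict_space
      scaleR_conv_of_real)
next
  case False
  define m where "m = \<i> * complex_of_real (mu a b l)"
  have m: "m \<noteq> 0" using False assms by (simp add: m_def mu_def)
  have "((\<lambda>x. fmode a b l x) has_integral (fmode a b l b / m - fmode a b l a / m)) {a..b}"
  proof (rule fundamental_theorem_of_calculus)
    fix x assume "x \<in> {a..b}"
    have "((\<lambda>x. fmode a b l x * (1 / m)) has_vector_derivative (m * fmode a b l x) * (1 / m)) (at x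
        within {a..b})"
      unfolding m_def by (intro has_vector_derivative_mult_left fmode_deriv)
    thus "((\<lambda>x. fmode a b l x / m) has_vector_derivative fmode a b l x) (at x within {a..b})" using
        m by simp
  qed (use assms in auto)
  hence "integral {a..b} (fmode a b l) = 0" using assms by (simp add: fmode_a fmode_b integral_unique)
  thus ?thesis using False integral_ivl_eq[OF integrable_ivl_continuous[OF continuous_fmode], of a b
      a b l] by simp
qed

lemma integrable_fmode_smult:
  assumes "integrable (ivl a b) U"
  shows "integrable (ivl a b) (\<lambda>x. fmode c d l x *s (U x :: complex^2))"
proof (rule Bochner_Integration.integrable_bound[OF assms])
  have "fmode c d l \<in> borel_measurable (ivl a b)"
    by (intro borel_measurable_integrable integrable_ivl_continuous continuous_fmode)
  thus "(\<lambda>x. fmode c d l x *s U x) \<in> borel_measurable (ivl a b)"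
    using borel_measurable_integrable[OF assms]
    by (rule borel_measurable_continuous_Pair)
      (intro smult.continuous_on continuous_intros)
qed (simp add: norm_vec_smult fmode_simps)

lemma fourier_coeff_add:
  assumes "integrable (ivl a b) U" "integrable (ivl a b) W"
  shows "fourier_coeff a b (\<lambda>x. U x + W x) l = fourier_coeff a b U l + fourier_coeff a b W l"
  using integrable_fmode_smult[OF assms(1)] integrable_fmode_smult[OF assms(2)]
  by (simp add: fourier_coeff_fmode smult.add_right scaleR_add_right)

lemma fourier_coeff_diff:
  assumes "integrable (ivl a b) U" "integrable (ivl a b) W"
  shows "fourier_coeff a b (\<lambda>x. U x - W x) l = fourier_coeff a b U l - fourier_coeff a b W l"
  using integrable_fmode_smult[OF assms(1)] integrable_fmode_smult[OF assms(2)]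
  by (simp add: fourier_coeff_fmode smult.diff_right scaleR_diff_right)

lemma fourier_coeff_scaleR:
  "fourier_coeff a b (\<lambda>x. c *\<^sub>R U x) l = c *\<^sub>R fourier_coeff a b U l"
  by (simp add: fourier_coeff_fmode smult.scaleR_right)

lemma fourier_coeff_smult:
  assumes "integrable (ivl a b) U"
  shows "fourier_coeff a b (\<lambda>x. c *s U x) l = c *s fourier_coeff a b U l"
proof -
  have e: "(\<lambda>x. fmode a b (- l) x *s (c *s U x)) = (\<lambda>x. c *s (fmode a b (- l) x *s U x))"
    by (simp add: vec_eq_iff fun_eq_iff algebra_simps)
  have "(\<integral>x. c *s (fmode a b (- l) x *s U x) \<partial>ivl a b) = c *s (\<integral>x. fmode a b (- l) x *s U x \<partial>ivl a b)"
    by (rule integral_bounded_linear[OF smult.bounded_linear_right integrable_fmode_smult[OF assms]])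
  thus ?thesis unfolding fourier_coeff_fmode e by (simp only: smult.scaleR_right)
qed

lemma fourier_coeff_matrix:
  assumes "integrable (ivl a b) U"
  shows "fourier_coeff a b (\<lambda>x. A *v U x) l = A *v fourier_coeff a b U l"
proof -
  have e: "(\<lambda>x. fmode a b (- l) x *s (A *v U x)) = (\<lambda>x. A *v (fmode a b (- l) x *s U x))"
    by (simp add: vector_scalar_commute)
  have bl: "bounded_linear (\<lambda>x. A *v x)" by (rule matrix_vector_mul_bounded_linear)
  have "(\<integral>x. A *v (fmode a b (- l) x *s U x) \<partial>ivl a b) = A *v (\<integral>x. fmode a b (- l) x *s U x \<partial>ivl a b)"
    by (rule integral_bounded_linear[OF bl integrable_fmode_smult[OF assms]])
  thus ?thesis unfolding fourier_coeff_fmode e by (simp only: linear_scale[OF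
      bounded_linear.linear[OF bl]])
qed

lemma fourier_coeff_cong:
  assumes "AE x in ivl a b. U x = W x" "integrable (ivl a b) U" "W \<in> borel_measurable (ivl a b)"
  shows "fourier_coeff a b U l = fourier_coeff a b W l"
proof -
  have W: "integrable (ivl a b) W" by (rule integrable_cong_AE_imp[OF assms(2,3)]) (use assms(1) in
      \<open>auto elim: eventually_mono\<close>)
  have "(\<integral>x. fmode a b (- l) x *s U x \<partial>ivl a b) = (\<integral>x. fmode a b (- l) x *s W x \<partial>ivl a b)"
    by (rule integral_cong_AE)
      (use assms(1) integrable_fmode_smult[OF assms(2)] integrable_fmode_smult[OF W] in \<open>auto elim:
          eventually_mono intro: borel_measurable_integrable\<close>)
  thus ?thesis by (simp add: fourier_coeff_fmode)
qed

text \<open>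
  The same sum as \<^const>\<open>trig_poly\<close>, over an arbitrary set of frequencies: the completeness argument
  needs sets larger than \<^term>\<open>modes N\<close>.
\<close>

definition trig_sum :: "real \<Rightarrow> real \<Rightarrow> int set \<Rightarrow> (int \<Rightarrow> complex^2) \<Rightarrow> real \<Rightarrow> complex^2" where
  "trig_sum a b A c x = (\<Sum>l\<in>A. fmode a b l x *s c l)"

lemma trig_poly_trig_sum: "trig_poly a b N c = trig_sum a b (modes N) c"
  by (simp add: trig_poly_def trig_sum_def fmode_def fun_eq_iff)

lemma continuous_trig_sum: "continuous_on S (trig_sum a b A c)"
  unfolding trig_sum_def by (intro continuous_intros smult.continuous_on continuous_fmode)

lemma integrable_trig_sum: "integrable (ivl a b) (trig_sum c d A f)"
  by (intro integrable_ivl_continuous continuous_trig_sum)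

lemma sqint_trig_sum: "sqint a b (trig_sum c d A f)"
  by (intro sqint_continuous continuous_trig_sum)

lemma fourier_coeff_trig_sum:
  assumes "a < b" "finite A"
  shows "fourier_coeff a b (trig_sum a b A c) l = (if l \<in> A then c l else 0)"
proof -
  have e: "fmode a b (- l) x *s trig_sum a b A c x = (\<Sum>k\<in>A. fmode a b (k - l) x *s c k)" for x
    unfolding trig_sum_def smult.sum_right
    using fmode_simps(1)[of a b _ "- l" x] by (intro sum.cong) (auto simp: mult.commute)
  have i: "integrable (ivl a b) (\<lambda>x. fmode a b k x *s v)" for k and v :: "complex^2"
    by (intro integrable_ivl_continuous smult.continuous_on[OF continuous_fmode continuous_on_const])
  have "(\<integral>x. fmode a b (- l) x *s trig_sum a b A c x \<partial>ivl a b) = (\<Sum>k\<in>A. (\<integral>x. fmode a b (k - l) x *s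
      c k \<partial>ivl a b))"
    unfolding e by (rule Bochner_Integration.integral_sum) (rule i)
  also have "\<dots> = (\<Sum>k\<in>A. (if k = l then of_real (b - a) else 0) *s c k)"
  proof (rule sum.cong[OF refl])
    fix k
    have "(\<integral>x. fmode a b (k - l) x *s c k \<partial>ivl a b) = (\<integral>x. fmode a b (k - l) x \<partial>ivl a b) *s c k"
      by (rule integral_bounded_linear[OF smult.bounded_linear_left])
        (intro integrable_ivl_continuous continuous_fmode)
    thus "(\<integral>x. fmode a b (k - l) x *s c k \<partial>ivl a b) = (if k = l then of_real (b - a) else 0) *s c k"
      using assms integral_fmode[of a b "k - l"] by simp
  qed
  also have "\<dots> = (\<Sum>k\<in>A. if k = l then of_real (b - a) *s c l else 0)"
    by (intro sum.cong) auto
  also have "\<dots> = (if l \<in> A then of_real (b - a) *s c l else 0)"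
    using assms by simp
  also have "of_real (b - a) *s c l = (b - a) *\<^sub>R c l" by (rule smult_of_real)
  finally show ?thesis using assms by (auto simp: fourier_coeff_fmode)
qed

lemma inner_trig_sum:
  assumes "a < b" "integrable (ivl a b) f" 
  shows "(\<integral>x. f x \<bullet> trig_sum a b A c x \<partial>ivl a b) = (b - a) * (\<Sum>l\<in>A. fourier_coeff a b f l \<bullet> c l)"
proof -
  have e: "f x \<bullet> trig_sum a b A c x = (\<Sum>l\<in>A. (fmode a b (- l) x *s f x) \<bullet> c l)" for x
    unfolding trig_sum_def inner_sum_right
    by (intro sum.cong) (auto simp: inner_smult fmode_simps)
  have i: "integrable (ivl a b) (\<lambda>x. (fmode a b (- l) x *s f x) \<bullet> c l)" for l
    by (rule integrable_bounded_linear[OF bounded_linear_inner_left integrable_fmode_smult[OF assms(2)]])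
  have "(\<integral>x. f x \<bullet> trig_sum a b A c x \<partial>ivl a b) = (\<Sum>l\<in>A. \<integral>x. (fmode a b (- l) x *s f x) \<bullet> c l \<partial>ivl a b)"
    unfolding e by (rule Bochner_Integration.integral_sum) (rule i)
  also have "\<dots> = (\<Sum>l\<in>A. (\<integral>x. fmode a b (- l) x *s f x \<partial>ivl a b) \<bullet> c l)"
    by (intro sum.cong refl integral_bounded_linear[OF bounded_linear_inner_left]
        integrable_fmode_smult assms)
  also have "\<dots> = (\<Sum>l\<in>A. (b - a) * (fourier_coeff a b f l \<bullet> c l))"
    using assms by (intro sum.cong) (auto simp: fourier_coeff_fmode)
  finally show ?thesis by (simp add: sum_distrib_left)
qed

text \<open>
  Only the last sum depends on \<open>c\<close>. With \<open>c\<close> the Fourier coefficients this is Bessel's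
  inequality; for general \<open>c\<close> it says that the Fourier sum is the best approximation.
\<close>

lemma l2_sq_diff_trig_sum:
  assumes ab: "a < b" and A: "finite A" and f: "sqint a b f"
  shows "(l2 a b (\<lambda>x. f x - trig_sum a b A c x))\<^sup>2 = (l2 a b f)\<^sup>2
     - (b - a) * (\<Sum>l\<in>A. (norm (fourier_coeff a b f l))\<^sup>2)
     + (b - a) * (\<Sum>l\<in>A. (norm (fourier_coeff a b f l - c l))\<^sup>2)"
proof -
  have 1: "(l2 a b (\<lambda>x. f x - trig_sum a b A c x))\<^sup>2 = (l2 a b f)\<^sup>2 - 2 * (\<integral>x. f x \<bullet> trig_sum a b A
      c x \<partial>ivl a b) + (l2 a b (trig_sum a b A c))\<^sup>2"
    using l2_sq_lin[OF f sqint_trig_sum, of "-1"] by simp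
  have "(l2 a b (trig_sum a b A c))\<^sup>2 = (\<integral>x. trig_sum a b A c x \<bullet> trig_sum a b A c x \<partial>ivl a b)"
    by (simp add: l2_sq power2_norm_eq_inner)
  also have "\<dots> = (b - a) * (\<Sum>l\<in>A. fourier_coeff a b (trig_sum a b A c) l \<bullet> c l)"
    by (rule inner_trig_sum[OF ab integrable_trig_sum])
  also have "\<dots> = (b - a) * (\<Sum>l\<in>A. (norm (c l))\<^sup>2)"
    by (simp add: fourier_coeff_trig_sum[OF ab A] power2_norm_eq_inner)
  finally have 2: "(l2 a b (trig_sum a b A c))\<^sup>2 = (b - a) * (\<Sum>l\<in>A. (norm (c l))\<^sup>2)" .
  have 3: "(\<Sum>l\<in>A. (norm (fourier_coeff a b f l - c l))\<^sup>2) =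
     (\<Sum>l\<in>A. (norm (fourier_coeff a b f l))\<^sup>2) - 2 * (\<Sum>l\<in>A. fourier_coeff a b f l \<bullet> c l) + (\<Sum>l\<in>A.
         (norm (c l))\<^sup>2)"
    by (simp add: power2_norm_eq_inner inner_simps inner_commute sum.distrib sum_subtractf
        sum_distrib_left algebra_simps)
  show ?thesis unfolding 1 2 3 inner_trig_sum[OF ab sqint_integrable[OF f]] by (simp add: algebra_simps)
qed

lemma Bessel:
  assumes ab: "a < b" and A: "finite A" and f: "sqint a b f"
  shows "(b - a) * (\<Sum>l\<in>A. (norm (fourier_coeff a b f l))\<^sup>2) \<le> (l2 a b f)\<^sup>2"
proof -
  have "0 \<le> (l2 a b (\<lambda>x. f x - trig_sum a b A (fourier_coeff a b f) x))\<^sup>2" by simp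
  also have "\<dots> = (l2 a b f)\<^sup>2 - (b - a) * (\<Sum>l\<in>A. (norm (fourier_coeff a b f l))\<^sup>2)"
    unfolding l2_sq_diff_trig_sum[OF ab A f] by simp
  finally show ?thesis by simp
qed

section \<open>Completeness of the trigonometric system\<close>

inductive_set trig :: "real \<Rightarrow> real \<Rightarrow> (real \<Rightarrow> complex) set" for a b where
  trig_fmode: "fmode a b l \<in> trig a b"
| trig_add: "f \<in> trig a b \<Longrightarrow> g \<in> trig a b \<Longrightarrow> (\<lambda>x. f x + g x) \<in> trig a b"
| trig_cmult: "f \<in> trig a b \<Longrightarrow> (\<lambda>x. c * f x) \<in> trig a b"

lemma trig_const: "(\<lambda>x. c) \<in> trig a b"
  using trig_cmult[OF trig_fmode[of a b 0], of c] by (simp add: fmode_simps)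

text \<open>A product of two modes is again a mode, so the span of the modes is an algebra.\<close>

lemma trig_mult: "f \<in> trig a b \<Longrightarrow> g \<in> trig a b \<Longrightarrow> (\<lambda>x. f x * g x) \<in> trig a b"
proof (induction arbitrary: g rule: trig.induct)
  case (trig_fmode k)
  from this show ?case
  proof (induction rule: trig.induct)
    case (trig_fmode l)
    have "(\<lambda>x. fmode a b k x * fmode a b l x) = fmode a b (k + l)" by (simp add: fun_eq_iff fmode_simps)
    thus ?case by (simp only: trig.trig_fmode)
  next
    case (trig_add f g)
    thus ?case using trig.trig_add[OF trig_add.IH] by (simp add: distrib_left)
  next
    case (trig_cmult f c)
    thus ?case using trig.trig_cmult[OF trig_cmult.IH, of c] by (simp add: mult.left_commute)
  qed
next
  case (trig_add f h)
  show ?case using trig.trig_add[OF trig_add.IH(1)[OF trig_add.prems] trig_add.IH(2)[OF trig_add.prems]]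
    by (simp add: distrib_right)
next
  case (trig_cmult f c)
  show ?case using trig.trig_cmult[OF trig_cmult.IH[OF trig_cmult.prems], of c] by (simp add: mult.assoc)
qed

text \<open>
  On the unit circle the coordinates \<open>Re z\<close> and \<open>Im z\<close> are combinations of \<open>z\<close> and its
  conjugate, that is, of the modes \<open>1\<close> and \<open>-1\<close>.
\<close>

lemma trig_real_polynomial:
  assumes "real_polynomial_function p"
  shows "(\<lambda>x. complex_of_real (p (fmode a b 1 x))) \<in> trig a b"
  using assms
proof (induction rule: real_polynomial_function.induct)
  case (linear f)
  have lin: "f z = Re z * f 1 + Im z * f \<i>" for z
  proof -
    have "f z = f (Re z *\<^sub>R 1 + Im z *\<^sub>R \<i>)" by (simp add: scaleR_conv_of_real complex_eq[symmetric]
        mult.commute)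
    also have "\<dots> = Re z * f 1 + Im z * f \<i>"
      using linear by (simp add: linear_simps)
    finally show ?thesis .
  qed
  have e: "complex_of_real (f (fmode a b 1 x)) =
      (f 1 / 2 - \<i> * f \<i> / 2) * fmode a b 1 x + (f 1 / 2 + \<i> * f \<i> / 2) * fmode a b (-1) x" for x
  proof -
    have c: "fmode a b (-1) x = cnj (fmode a b 1 x)" by (simp add: fmode_simps)
    show ?thesis unfolding lin[of "fmode a b 1 x"] c by (simp add: complex_eq_iff field_simps)
  qed
  show ?case unfolding e by (intro trig.intros)
next
  case (const c) show ?case by (rule trig_const)
next
  case (add f g) thus ?case using trig.trig_add[of _ a b] by simp
next
  case (mult f g) thus ?case using trig_mult[of _ a b] by simp
qed

definition trigv :: "real \<Rightarrow> real \<Rightarrow> (real \<Rightarrow> complex^2) set" where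
  "trigv a b = {f. \<exists>A c. finite A \<and> f = trig_sum a b A c}"

lemma trigv_add:
  assumes "f \<in> trigv a b" "g \<in> trigv a b" shows "(\<lambda>x. f x + g x) \<in> trigv a b"
proof -
  obtain A c B d where f: "finite A" "f = trig_sum a b A c" and g: "finite B" "g = trig_sum a b B d"
    using assms by (auto simp: trigv_def)
  have "trig_sum a b A c x = trig_sum a b (A \<union> B) (\<lambda>l. if l \<in> A then c l else 0) x" for x
    unfolding trig_sum_def using f(1) g(1) by (intro sum.mono_neutral_cong_left) auto
  moreover have "trig_sum a b B d x = trig_sum a b (A \<union> B) (\<lambda>l. if l \<in> B then d l else 0) x" for x
    unfolding trig_sum_def using f(1) g(1) by (intro sum.mono_neutral_cong_left) auto
  ultimately have "(\<lambda>x. f x + g x) = trig_sum a b (A \<union> B) (\<lambda>l. (if l \<in> A then c l else 0) + (if l \<in>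
      B then d l else 0))"
    by (simp add: f g trig_sum_def fun_eq_iff smult.add_right sum.distrib)
  thus ?thesis using f g by (auto simp: trigv_def intro!: exI[of _ "A \<union> B"])
qed

lemma trigv_trig: "f \<in> trig a b \<Longrightarrow> (\<lambda>x. f x *s v) \<in> trigv a b"
proof (induction arbitrary: v rule: trig.induct)
  case (trig_fmode l)
  have "(\<lambda>x. fmode a b l x *s v) = trig_sum a b {l} (\<lambda>_. v)" by (simp add: trig_sum_def fun_eq_iff)
  thus ?case by (auto simp: trigv_def intro!: exI[of _ "{l}"])
next
  case (trig_add f g)
  thus ?case using trigv_add[of "\<lambda>x. f x *s v" a b "\<lambda>x. g x *s v"] by (simp add: smult.add_left)
next
  case (trig_cmult f c)
  have e: "(\<lambda>x. (c * f x) *s v) = (\<lambda>x. f x *s (c *s v))" by (simp add: vec_eq_iff fun_eq_iff)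
  show ?case unfolding e by (rule trig_cmult.IH)
qed

lemma trigv_sum: "finite I \<Longrightarrow> (\<And>i. i \<in> I \<Longrightarrow> F i \<in> trigv a b) \<Longrightarrow> (\<lambda>x. \<Sum>i\<in>I. F i x) \<in> trigv a b"
proof (induction rule: finite_induct)
  case empty
  have "(\<lambda>x. 0) = trig_sum a b {} (\<lambda>_. 0)" by (simp add: trig_sum_def fun_eq_iff)
  thus ?case by (auto simp: trigv_def intro!: exI[of _ "{}"])
next
  case (insert i I)
  thus ?case using trigv_add[of "F i" a b "\<lambda>x. \<Sum>i\<in>I. F i x"] by simp
qed

text \<open>
  A continuous function with equal values at the ends is a continuous function on the unit
  circle, via \<open>x \<mapsto> e\<^sup>2\<^sup>\<pi>\<^sup>i\<^sup>(\<^sup>x\<^sup>-\<^sup>a\<^sup>)\<^sup>/\<^sup>(\<^sup>b\<^sup>-\<^sup>a\<^sup>)\<close>. The Stone-Weierstrass theorem approximates it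
  by polynomials in \<open>Re z\<close> and \<open>Im z\<close>, which are trigonometric sums in \<open>x\<close>.
\<close>

lemma trig_dense:
  fixes u :: "real \<Rightarrow> complex^2"
  assumes ab: "a < b" and u: "continuous_on {a..b} u" "u a = u b" and e: "e > 0"
  obtains A c where "finite A" "\<And>x. x \<in> {a..<b} \<Longrightarrow> norm (u x - trig_sum a b A c x) < e"
proof -
  define p where "p = (\<lambda>s. u (a + (b - a) * s))"
  have pc: "path p"
    unfolding path_def p_def
  proof (rule continuous_on_compose2[OF u(1)])
    show "(\<lambda>s. a + (b - a) * s) ` {0..1} \<subseteq> {a..b}"
    proof clarsimp
      fix s :: real assume "0 \<le> s" "s \<le> 1"
      hence "0 \<le> (b - a) * s" "(b - a) * s \<le> (b - a) * 1" using ab by (auto intro!: mult_left_mono)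
      thus "0 \<le> (b - a) * s \<and> a + (b - a) * s \<le> b" by simp
    qed
  qed (intro continuous_intros)
  \<comment> \<open>A loop is homotopic to itself; the induced map on the circle is continuous.\<close>
  have "homotopic_loops UNIV p p"
    using pc u(2) by (simp add: homotopic_loops_refl pathfinish_def pathstart_def p_def)
  hence "homotopic_with_canon (\<lambda>h. True) (sphere 0 1) UNIV (p \<circ> (\<lambda>z. Arg2pi z / (2 * pi))) (p \<circ> (\<lambda>z.
      Arg2pi z / (2 * pi)))"
    by (rule homotopic_loops_imp_homotopic_circlemaps)
  hence F: "continuous_on (sphere 0 1) (p \<circ> (\<lambda>z. Arg2pi z / (2 * pi)))"
    using homotopic_with_imp_continuous by blast
  obtain g where g: "polynomial_function g"
      "\<And>z. z \<in> sphere 0 1 \<Longrightarrow> norm ((p \<circ> (\<lambda>z. Arg2pi z / (2 * pi))) z - g z) < e"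
    using Stone_Weierstrass_polynomial_function[OF _ F e] by auto
  have val: "(p \<circ> (\<lambda>z. Arg2pi z / (2 * pi))) (fmode a b 1 x) = u x" if x: "x \<in> {a..<b}" for x
  proof -
    have "Arg2pi (fmode a b 1 x) = mu a b 1 * (x - a)"
    proof (rule Arg2pi_unique[of 1])
      show "0 \<le> mu a b 1 * (x - a)" using ab x by (auto simp: mu_def)
      have "(x - a) / (b - a) < 1" using ab x by auto
      hence "2 * pi * ((x - a) / (b - a)) < 2 * pi * 1" by (intro mult_strict_left_mono) auto
      thus "mu a b 1 * (x - a) < 2 * pi" by (simp add: mu_def)
    qed (auto simp: fmode_def)
    hence "Arg2pi (fmode a b 1 x) / (2 * pi) = (x - a) / (b - a)" by (simp add: mu_def)
    thus ?thesis using ab by (simp add: p_def)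
  qed
  have "(\<lambda>x. \<Sum>v\<in>Basis. of_real (g (fmode a b 1 x) \<bullet> v) *s v) \<in> trigv a b"
    by (intro trigv_sum trigv_trig trig_real_polynomial)
      (use g(1) in \<open>auto simp: polynomial_function_iff_Basis_inner\<close>)
  moreover have "(\<Sum>v\<in>Basis. of_real (g (fmode a b 1 x) \<bullet> v) *s v) = g (fmode a b 1 x)" for x
  proof -
    show ?thesis by (simp add: smult_of_real euclidean_representation)
  qed
  ultimately have "(\<lambda>x. g (fmode a b 1 x)) \<in> trigv a b" by simp
  then obtain A c where A: "finite A" "(\<lambda>x. g (fmode a b 1 x)) = trig_sum a b A c" by (auto simp:
      trigv_def)
  have "norm (u x - trig_sum a b A c x) < e" if x: "x \<in> {a..<b}" for x
    using g(2)[of "fmode a b 1 x"] val[OF x] fun_cong[OF A(2), of x] by (simp add: fmode_simps)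
  thus ?thesis using that A(1) by blast
qed

text \<open>The Fourier sum is at least as good in the mean square as a uniformly good trigonometric sum.\<close>

lemma Parseval_approx:
  fixes u :: "real \<Rightarrow> complex^2"
  assumes ab: "a < b" and u: "continuous_on {a..b} u" "u a = u b" and e: "e > 0"
  obtains A where "finite A" "(l2 a b u)\<^sup>2 - (b - a) * (\<Sum>l\<in>A. (norm (fourier_coeff a b u l))\<^sup>2) \<le> e"
proof -
  define d where "d = sqrt (e / (b - a))"
  have d: "d > 0" using ab e by (simp add: d_def)
  obtain A c where A: "finite A" "\<And>x. x \<in> {a..<b} \<Longrightarrow> norm (u x - trig_sum a b A c x) < d"
    using trig_dense[OF ab u d] by blast
  have s: "sqint a b (\<lambda>x. u x - trig_sum a b A c x)"
    by (intro sqint_diff sqint_trig_sum sqint_continuous u)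
  have "l2 a b (\<lambda>x. u x - trig_sum a b A c x) \<le> d * sqrt (b - a)"
    using A(2) s ab d by (intro l2_bounded) (auto simp: sqint_def less_imp_le)
  hence "(l2 a b (\<lambda>x. u x - trig_sum a b A c x))\<^sup>2 \<le> (d * sqrt (b - a))\<^sup>2"
    by (intro power_mono l2_nonneg)
  also have "\<dots> = e" using ab e by (simp add: d_def power_mult_distrib)
  finally have "(l2 a b u)\<^sup>2 - (b - a) * (\<Sum>l\<in>A. (norm (fourier_coeff a b u l))\<^sup>2)
     + (b - a) * (\<Sum>l\<in>A. (norm (fourier_coeff a b u l - c l))\<^sup>2) \<le> e"
    unfolding l2_sq_diff_trig_sum[OF ab A(1) sqint_continuous[OF u(1)]] .
  moreover have "0 \<le> (b - a) * (\<Sum>l\<in>A. (norm (fourier_coeff a b u l - c l))\<^sup>2)"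
    using ab by (intro mult_nonneg_nonneg sum_nonneg) auto
  ultimately show ?thesis using that[OF A(1)] by linarith
qed

section \<open>Fourier coefficients of weak derivatives\<close>

lemma fmode_lipschitz: "norm (fmode a b l x - fmode a b l y) \<le> \<bar>mu a b l\<bar> * \<bar>x - y\<bar>"
proof -
  have "norm (fmode a b l x - fmode a b l y) \<le> \<bar>mu a b l\<bar> * norm (x - y)"
    by (rule differentiable_bound[of UNIV _ "\<lambda>x h. h *\<^sub>R ((\<i> * of_real (mu a b l)) * fmode a b l x)"])
      (use fmode_deriv in \<open>auto simp: has_vector_derivative_def norm_mult fmode_simps intro!: onorm_le\<close>)
  thus ?thesis by simp
qed

text \<open>
  Integration by parts when the derivative \<open>v\<close> is only integrable, so that \<open>g\<close> need not be
  differentiable anywhere in particular. Let \<open>E\<close> be the conjugate mode and \<open>D(x) = E(x) g(x) - \<integral>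
  (E' g + E v)\<close> over \<open>[a,x]\<close>. The increment of \<open>D\<close> over \<open>[x,y]\<close> is at most a constant times \<open>(y
  - x) \<integral> \<bar>v\<bar>\<close> over \<open>[x,y]\<close>, since \<open>E\<close> is Lipschitz and \<open>g\<close> oscillates by at most \<open>\<integral> \<bar>v\<bar>\<close>. Hence
  \<open>D\<close> has derivative zero and is constant. The boundary terms cancel by periodicity.
\<close>

lemma by_parts_fmode:
  fixes g v :: "real \<Rightarrow> complex^2"
  assumes ab: "a < b" and g: "continuous_on {a..b} g" and v: "integrable (ivl a b) v"
    and gv: "\<And>s t. a \<le> s \<Longrightarrow> s \<le> t \<Longrightarrow> t \<le> b \<Longrightarrow> g t - g s = integral {s..t} v"
    and per: "g a = g b"
  shows "fourier_coeff a b v l = (\<i> * of_real (mu a b l)) *s fourier_coeff a b g l"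
proof -
  define m where "m = mu a b (- l)"
  define E where "E = fmode a b (- l)"
  have E: "norm (E x) = 1" "norm (E x - E y) \<le> \<bar>m\<bar> * \<bar>x - y\<bar>" for x y
    unfolding E_def m_def by (simp_all add: fmode_simps fmode_lipschitz)
  have Ec: "continuous_on S E" for S unfolding E_def by (rule continuous_fmode)
  define W where "W = (\<lambda>r. (\<i> * of_real m * E r) *s g r + E r *s v r)"
  have Ei: "integrable (ivl a b) (\<lambda>r. E r *s v r)"
    unfolding E_def by (rule integrable_fmode_smult[OF v])
  have gi: "integrable (ivl a b) (\<lambda>r. (\<i> * of_real m * E r) *s g r)"
    by (intro integrable_ivl_continuous continuous_intros smult.continuous_on Ec g)
  have Wi: "W integrable_on {a..b}"
    using Bochner_Integration.integrable_add[OF gi Ei]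
    by (simp add: integrable_ivl_iff absolutely_integrable_on_def W_def[abs_def])
  have vn: "(\<lambda>r. norm (v r)) integrable_on {a..b}"
    using v by (simp add: integrable_ivl_iff absolutely_integrable_on_def)
  have vi: "v integrable_on {a..b}"
    using v by (simp add: integrable_ivl_iff absolutely_integrable_on_def)
  define n where "n = (\<lambda>x. integral {a..x} (\<lambda>r. norm (v r)))"
  have nc: "continuous_on {a..b} n" unfolding n_def by (rule indefinite_integral_continuous_1[OF vn])
  define D where "D = (\<lambda>x. E x *s g x - integral {a..x} W)"
  have sub: "f integrable_on {x..y}" if "f integrable_on {a..b}" "a \<le> x" "y \<le> b" for f :: "real \<Rightarrow>
      'z::euclidean_space" and x y
    using integrable_on_subinterval[OF that(1), of x y] that by auto
  have comb: "integral {a..y} f - integral {a..x} f = integral {x..y} f"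
    if "f integrable_on {a..b}" "a \<le> x" "x \<le> y" "y \<le> b" for f :: "real \<Rightarrow> 'z::euclidean_space" and x y
    using Henstock_Kurzweil_Integration.integral_combine[of a x y f] sub[OF that(1), of a y] that
    by (metis add_diff_cancel_left' order_refl order_trans)
  have key: "norm (D y - D x) \<le> 2 * \<bar>m\<bar> * (y - x) * (n y - n x)" if xy: "a \<le> x" "x \<le> y" "y \<le> b" for x y
  proof -
    have N: "n y - n x = integral {x..y} (\<lambda>r. norm (v r))" unfolding n_def by (rule comb[OF vn xy])
    have osc: "norm (g y - g r) \<le> n y - n x" if "r \<in> {x..y}" for r
    proof -
      have r: "a \<le> r" "r \<le> y" using that xy by auto
      have "norm (g y - g r) \<le> integral {r..y} (\<lambda>r. norm (v r))"
        unfolding gv[OF r xy(3)]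
        by (rule integral_norm_bound_integral) (use sub[OF vi r(1) xy(3)] sub[OF vn r(1) xy(3)] in auto)
      also have "\<dots> \<le> integral {x..y} (\<lambda>r. norm (v r))"
        by (rule integral_subset_le) (use that r xy sub[OF vn] in auto)
      finally show ?thesis using N by simp
    qed
    have i1: "(\<lambda>r. (\<i> * of_real m * E r) *s g y) integrable_on {x..y}"
      by (intro integrable_continuous_real continuous_intros smult.continuous_on Ec)
    have i2: "(\<lambda>r. E x *s v r) integrable_on {x..y}"
      using integrable_linear[OF sub[OF vi xy(1,3)] smult.bounded_linear_right, of "E x"] by (simp
          add: o_def)
    have FT: "integral {x..y} (\<lambda>r. (\<i> * of_real m * E r) *s g y) = (E y - E x) *s g y"
    proof -
      have "((\<lambda>r. (\<i> * of_real m * E r) *s g y) has_integral (E y *s g y - E x *s g y)) {x..y}"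
      proof (rule fundamental_theorem_of_calculus[OF xy(2)])
        fix r
        show "((\<lambda>r. E r *s g y) has_vector_derivative (\<i> * of_real m * E r) *s g y) (at r within {x..y})"
          unfolding E_def m_def
          by (rule bounded_linear.has_vector_derivative[OF smult.bounded_linear_left fmode_deriv])
      qed
      thus ?thesis by (simp add: integral_unique smult.diff_left)
    qed
    have ex: "integral {x..y} (\<lambda>r. E x *s v r) = E x *s (g y - g x)"
      using integral_linear[OF sub[OF vi xy(1,3)] smult.bounded_linear_right, of "E x"] gv[OF xy] by
          (simp add: o_def)
    have "D y - D x = E y *s g y - E x *s g x - integral {x..y} W"
      unfolding D_def using comb[OF Wi xy] by (simp add: algebra_simps)
    also have "E y *s g y - E x *s g x = integral {x..y} (\<lambda>r. (\<i> * of_real m * E r) *s g y) +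
        integral {x..y} (\<lambda>r. E x *s v r)"
      unfolding FT ex by (simp add: smult.diff_left smult.diff_right)
    also have "\<dots> - integral {x..y} W = integral {x..y} (\<lambda>r. (\<i> * of_real m * E r) *s g y + E x *s v
        r - W r)"
      using i1 i2 sub[OF Wi xy(1,3)]
      by (simp add: Henstock_Kurzweil_Integration.integral_add
          Henstock_Kurzweil_Integration.integral_diff integrable_add)
    also have "(\<lambda>r. (\<i> * of_real m * E r) *s g y + E x *s v r - W r) =
        (\<lambda>r. (\<i> * of_real m * E r) *s (g y - g r) + (E x - E r) *s v r)"
      by (simp add: W_def smult.diff_left smult.diff_right fun_eq_iff)
    finally have "norm (D y - D x) = norm (integral {x..y} (\<lambda>r. (\<i> * of_real m * E r) *s (g y - g r)
        + (E x - E r) *s v r))" 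
      by simp
    also have "\<dots> \<le> integral {x..y} (\<lambda>r. \<bar>m\<bar> * (n y - n x) + \<bar>m\<bar> * (y - x) * norm (v r))"
    proof (rule integral_norm_bound_integral)
      have e: "(\<lambda>r. (\<i> * of_real m * E r) *s (g y - g r) + (E x - E r) *s v r) =
        (\<lambda>r. (\<i> * of_real m * E r) *s g y + E x *s v r - W r)"
        by (simp add: W_def smult.diff_left smult.diff_right fun_eq_iff)
      show "(\<lambda>r. (\<i> * of_real m * E r) *s (g y - g r) + (E x - E r) *s v r) integrable_on {x..y}"
        unfolding e by (intro integrable_add integrable_diff i1 i2 sub[OF Wi xy(1,3)])
      show "(\<lambda>r. \<bar>m\<bar> * (n y - n x) + \<bar>m\<bar> * (y - x) * norm (v r)) integrable_on {x..y}"
        using sub[OF vn xy(1,3)] by (intro integrable_add integrable_on_mult_right) auto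
      fix r assume r: "r \<in> {x..y}"
      have "norm ((\<i> * of_real m * E r) *s (g y - g r) + (E x - E r) *s v r)
          \<le> \<bar>m\<bar> * norm (g y - g r) + norm (E x - E r) * norm (v r)"
        by (rule order_trans[OF norm_triangle_ineq]) (simp only: norm_vec_smult norm_mult E norm_ii
            norm_of_real mult_1 mult_1_right order_refl)
      also have "\<dots> \<le> \<bar>m\<bar> * (n y - n x) + (\<bar>m\<bar> * (y - x)) * norm (v r)"
      proof (intro add_mono mult_left_mono mult_right_mono osc r)
        have "norm (E x - E r) \<le> \<bar>m\<bar> * \<bar>x - r\<bar>" by (rule E)
        also have "\<dots> \<le> \<bar>m\<bar> * (y - x)" using r by (intro mult_left_mono) auto
        finally show "norm (E x - E r) \<le> \<bar>m\<bar> * (y - x)" .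
      qed auto
      finally show "norm ((\<i> * of_real m * E r) *s (g y - g r) + (E x - E r) *s v r)
          \<le> \<bar>m\<bar> * (n y - n x) + \<bar>m\<bar> * (y - x) * norm (v r)" .
    qed
    also have "\<dots> = 2 * \<bar>m\<bar> * (y - x) * (n y - n x)"
      using sub[OF vn xy(1,3)] xy unfolding N
      by (subst Henstock_Kurzweil_Integration.integral_add) (auto simp: integrable_on_mult_right)
    finally show ?thesis .
  qed
  have "D b = D a"
  proof -
    have "\<exists>c. \<forall>x\<in>{a..b}. D x = c"
    proof (rule has_vector_derivative_zero_constant)
      show "convex {a..b}" by simp
      fix x assume x: "x \<in> {a..b}"
      have nl: "((\<lambda>y. 2 * \<bar>m\<bar> * \<bar>n y - n x\<bar>) \<longlongrightarrow> 2 * \<bar>m\<bar> * \<bar>n x - n x\<bar>) (at x within {a..b})"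
        using nc x by (intro tendsto_intros) (auto simp: continuous_on_def)
      show "(D has_vector_derivative 0) (at x within {a..b})"
        unfolding has_vector_derivative_def has_derivative_within
      proof (intro conjI bounded_linear_intros)
        show "((\<lambda>y. (1 / norm (y - x)) *\<^sub>R (D y - (D x + (y - x) *\<^sub>R 0))) \<longlongrightarrow> 0) (at x within {a..b})"
        proof (rule Lim_null_comparison)
          show "((\<lambda>y. 2 * \<bar>m\<bar> * \<bar>n y - n x\<bar>) \<longlongrightarrow> 0) (at x within {a..b})" using nl by simp
          show "\<forall>\<^sub>F y in at x within {a..b}. norm ((1 / norm (y - x)) *\<^sub>R (D y - (D x + (y - x) *\<^sub>R
              0))) \<le> 2 * \<bar>m\<bar> * \<bar>n y - n x\<bar>"
            unfolding eventually_at_filter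
          proof (intro always_eventually allI impI)
            fix y assume y: "y \<noteq> x" "y \<in> {a..b}"
            have "norm (D y - D x) \<le> 2 * \<bar>m\<bar> * \<bar>n y - n x\<bar> * \<bar>y - x\<bar>"
            proof (cases "x \<le> y")
              case True
              have "2 * \<bar>m\<bar> * (y - x) * (n y - n x) \<le> 2 * \<bar>m\<bar> * (y - x) * \<bar>n y - n x\<bar>"
                using True by (intro mult_left_mono) auto
              thus ?thesis using key[of x y] x y True by (simp add: algebra_simps)
            next
              case False
              have "2 * \<bar>m\<bar> * (x - y) * (n x - n y) \<le> 2 * \<bar>m\<bar> * (x - y) * \<bar>n x - n y\<bar>"
                using False by (intro mult_left_mono) auto
              thus ?thesis using key[of y x] x y False
                by (simp add: norm_minus_commute abs_minus_commute algebra_simps)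
            qed
            thus "norm ((1 / norm (y - x)) *\<^sub>R (D y - (D x + (y - x) *\<^sub>R 0))) \<le> 2 * \<bar>m\<bar> * \<bar>n y - n x\<bar>"
              using y by (simp add: divide_simps)
          qed
        qed
      qed
    qed blast
    thus ?thesis using ab by (metis atLeastAtMost_iff less_imp_le order_refl)
  qed
  moreover have "E b = 1" "E a = 1" using ab by (simp_all add: E_def fmode_a fmode_b)
  ultimately have "integral {a..b} W = 0" using per by (simp add: D_def)
  hence "integral\<^sup>L (ivl a b) W = 0"
    using integral_ivl_eq[of a b W] Bochner_Integration.integrable_add[OF gi Ei] by (simp add:
        W_def[abs_def])
  hence "(\<integral>r. (\<i> * of_real m * E r) *s g r \<partial>ivl a b) + (\<integral>r. E r *s v r \<partial>ivl a b) = 0"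
    using Bochner_Integration.integral_add[OF gi Ei] by (simp add: W_def[abs_def])
  moreover have "(\<integral>r. (\<i> * of_real m * E r) *s g r \<partial>ivl a b) = (\<i> * of_real m) *s (\<integral>r. E r *s g r
      \<partial>ivl a b)"
  proof -
    have "(\<integral>r. (\<i> * of_real m) *s (E r *s g r) \<partial>ivl a b) = (\<i> * of_real m) *s (\<integral>r. E r *s g r \<partial>ivl a b)"
      by (rule integral_bounded_linear[OF smult.bounded_linear_right])
        (intro integrable_ivl_continuous smult.continuous_on Ec g)
    thus ?thesis by (simp add: vector_smult_assoc)
  qed
  moreover have "m = - mu a b l" by (simp add: m_def mu_def)
  ultimately have "(\<integral>r. E r *s v r \<partial>ivl a b) = (\<i> * of_real (mu a b l)) *s (\<integral>r. E r *s g r \<partial>ivl a b)"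
    by (simp add: smult.minus_left add_eq_0_iff)
  thus ?thesis by (simp add: fourier_coeff_fmode E_def smult.scaleR_right)
qed

section \<open>Spectral approximation in periodic Sobolev spaces\<close>

lemma locally_integrable_measurable:
  fixes w :: "real \<Rightarrow> 'v::euclidean_space"
  assumes "locally_integrable a b w"
  shows "w \<in> borel_measurable (ivl a b)"
proof -
  let ?I = "\<lambda>n::nat. {a + 1 / real (Suc n)..b - 1 / real (Suc n)}"
  have sub: "?I n \<subseteq> {a<..<b}" for n
  proof
    fix x assume x: "x \<in> ?I n"
    define e where "e = 1 / real (Suc n)"
    have "e > 0" by (simp add: e_def)
    thus "x \<in> {a<..<b}" using x unfolding e_def[symmetric] by auto
  qed
  have "(\<lambda>x. indicator {a<..<b} x *\<^sub>R w x) \<in> borel_measurable lebesgue"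
  proof (rule borel_measurable_LIMSEQ_metric)
    fix n
    have "integrable (lebesgue_on (?I n)) w"
      using assms by (auto simp: locally_integrable_def)
    hence "integrable lebesgue (\<lambda>x. indicator (?I n) x *\<^sub>R w x)"
      by (simp add: integrable_restrict_space)
    thus "(\<lambda>x. indicator (?I n) x *\<^sub>R w x) \<in> borel_measurable lebesgue"
      by (rule borel_measurable_integrable)
  next
    fix x
    show "(\<lambda>n. indicator (?I n) x *\<^sub>R w x) \<longlonglongrightarrow> indicator {a<..<b} x *\<^sub>R w x"
    proof (cases "x \<in> {a<..<b}")
      case False
      hence "x \<notin> ?I n" for n using sub[of n] by blast
      thus ?thesis using False by simp
    next
      case True
      obtain n0 :: nat where n0: "inverse (real (Suc n0)) < min (x - a) (b - x)"
        using reals_Archimedean[of "min (x - a) (b - x)"] True by auto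
      have "x \<in> ?I n" if "n \<ge> n0" for n
      proof -
        have "1 / real (Suc n) \<le> 1 / real (Suc n0)" using that by (intro divide_left_mono) auto
        thus ?thesis using n0 by (simp add: inverse_eq_divide)
      qed
      hence "eventually (\<lambda>n. indicator (?I n) x *\<^sub>R w x = indicator {a<..<b} x *\<^sub>R w x) sequentially"
        using True by (intro eventually_sequentiallyI[of n0]) simp
      thus ?thesis by (rule tendsto_eventually)
    qed
  qed
  thus ?thesis by (simp add: borel_measurable_restrict_space_iff)
qed

lemma deriv_test: "\<phi> \<in> test_functions a b \<Longrightarrow> deriv \<phi> \<in> test_functions a b"
proof -
  assume \<phi>: "\<phi> \<in> test_functions a b"
  then obtain c d where cd: "a < c" "d < b" "\<forall>x. x \<notin> {c..d} \<longrightarrow> \<phi> x = 0"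
    unfolding test_functions_def by blast
  have "deriv \<phi> x = 0" if x: "x \<notin> {c..d}" for x
  proof -
    have "((\<lambda>_. 0) has_real_derivative deriv \<phi> x) (at x)"
      by (rule has_field_derivative_transform_within_open[OF smooth_DERIV[OF test_smooth[OF \<phi>]],
          where S="- {c..d}"])
        (use x cd in auto)
    thus ?thesis using DERIV_unique[OF _ DERIV_const] by blast
  qed
  moreover have "smooth (deriv \<phi>)" by (rule smooth_deriv[OF test_smooth[OF \<phi>]])
  ultimately show ?thesis using cd unfolding test_functions_def smooth_def by blast
qed

text \<open>Apply the definition of the derivative of order \<open>l\<close> to the test function \<open>deriv \<phi>\<close>.\<close>

lemma weak_deriv_Suc:
  assumes "weak_deriv a b l u g" "weak_deriv a b (Suc l) u v"
  shows "weak_deriv a b 1 g v"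
  unfolding weak_deriv_def
proof (intro conjI ballI)
  show "locally_integrable a b g" "locally_integrable a b v" using assms by (auto simp: weak_deriv_def)
  fix \<phi> assume \<phi>: "\<phi> \<in> test_functions a b"
  have "(\<integral>x. (deriv ^^ l) (deriv \<phi>) x *\<^sub>R u x \<partial>ivl a b) = (-1) ^ l *\<^sub>R (\<integral>x. deriv \<phi> x *\<^sub>R g x \<partial>ivl a b)"
    using assms(1) deriv_test[OF \<phi>] unfolding weak_deriv_def by blast
  moreover have "(\<integral>x. (deriv ^^ Suc l) \<phi> x *\<^sub>R u x \<partial>ivl a b) = (-1) ^ Suc l *\<^sub>R (\<integral>x. \<phi> x *\<^sub>R v x
      \<partial>ivl a b)"
    using assms(2) \<phi> unfolding weak_deriv_def by blast
  ultimately have "(-1) ^ l *\<^sub>R (\<integral>x. deriv \<phi> x *\<^sub>R g x \<partial>ivl a b) = (-1) ^ Suc l *\<^sub>R (\<integral>x. \<phi> x *\<^sub>R v x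
      \<partial>ivl a b)"
    by (simp only: funpow_Suc_right o_def)
  also have "\<dots> = (-1) ^ l *\<^sub>R (- (\<integral>x. \<phi> x *\<^sub>R v x \<partial>ivl a b))" by simp
  finally have "(\<integral>x. deriv \<phi> x *\<^sub>R g x \<partial>ivl a b) = - (\<integral>x. \<phi> x *\<^sub>R v x \<partial>ivl a b)"
    by (rule scaleR_left_imp_eq[rotated]) simp
  thus "(\<integral>x. (deriv ^^ 1) \<phi> x *\<^sub>R g x \<partial>ivl a b) = (-1) ^ 1 *\<^sub>R (\<integral>x. \<phi> x *\<^sub>R v x \<partial>ivl a b)"
    by simp
qed

lemma sqint_locally_integrable: "sqint a b u \<Longrightarrow> locally_integrable a b u"
  unfolding locally_integrable_def
  by (intro allI impI integrable_ivl_subset[OF sqint_integrable]) auto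

lemma weak_deriv_0: "locally_integrable a b u \<Longrightarrow> weak_deriv a b 0 u u"
  by (simp add: weak_deriv_def)

text \<open>
  Integrate by parts \<open>l\<close> times. Each step uses the continuous representative of the previous
  derivative, whose boundary values agree by the periodic boundary conditions of order less than
  \<open>k\<close>.
\<close>

lemma fourier_weak_deriv:
  assumes ab: "a < b" and u: "u \<in> Hp_space a b k" and l: "l \<le> k"
    and v: "weak_deriv a b l u v" "integrable (ivl a b) v"
  shows "fourier_coeff a b v j = (\<i> * of_real (mu a b j)) ^ l *s fourier_coeff a b u j"
  using l v
proof (induction l arbitrary: v)
  case 0
  have s: "sqint a b u" using u by (simp add: Hp_space_def H_space_def L2_norm_less_top)
  have "AE x in ivl a b. v x = u x"
    by (rule weak_deriv_unique[OF "0.prems"(2) weak_deriv_0[OF sqint_locally_integrable[OF s]]])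
  hence "fourier_coeff a b v j = fourier_coeff a b u j"
    by (rule fourier_coeff_cong) (use 0 s in \<open>auto simp: sqint_def\<close>)
  thus ?case by simp
next
  case (Suc l)
  have "periodic_bc a b l u" using u Suc.prems(1) by (simp add: Hp_space_def)
  then obtain g where g: "continuous_on {a..b} g" "weak_deriv a b l u g" "g a = g b"
    by (auto simp: periodic_bc_def)
  have gv: "weak_deriv a b 1 g v" by (rule weak_deriv_Suc[OF g(2) Suc.prems(2)])
  have "fourier_coeff a b v j = (\<i> * of_real (mu a b j)) *s fourier_coeff a b g j"
    by (rule by_parts_fmode[OF ab g(1) Suc.prems(3) weak_deriv_1_continuous[OF gv g(1) Suc.prems(3)]
        g(3)])
  also have "fourier_coeff a b g j = (\<i> * of_real (mu a b j)) ^ l *s fourier_coeff a b u j"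
    using Suc.prems(1) by (intro Suc.IH g integrable_ivl_continuous) auto
  finally show ?case by (simp add: vector_smult_assoc)
qed

text \<open>
  The function chosen by \<^const>\<open>weak_dx\<close> agrees almost everywhere with a square-integrable one, by
  uniqueness of weak derivatives.
\<close>

lemma weak_dx_Hp:
  fixes u :: "real \<Rightarrow> 'v::euclidean_space"
  assumes u: "u \<in> Hp_space a b k" and l: "l \<le> k"
  shows "weak_deriv a b l u (weak_dx a b l u)" "sqint a b (weak_dx a b l u)"
proof -
  obtain v where v: "weak_deriv a b l u v" "sqint a b v"
    using u l by (auto simp: Hp_space_def H_space_def L2_norm_less_top)
  show w: "weak_deriv a b l u (weak_dx a b l u)"
    unfolding weak_dx_def by (rule someI[where P="weak_deriv a b l u", OF v(1)])
  show "sqint a b (weak_dx a b l u)"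
  proof (rule l2_cong_AE(1)[OF v(2) _ weak_deriv_unique[OF v(1) w]])
    show "weak_dx a b l u \<in> borel_measurable (ivl a b)"
      using w by (intro locally_integrable_measurable) (simp add: weak_deriv_def)
  qed
qed

lemma Hp_norm_bound:
  fixes u :: "real \<Rightarrow> 'v::euclidean_space"
  assumes n: "Hp_norm a b k u \<le> ennreal M" "M \<ge> 0" and l: "l \<le> k"
  shows "u \<in> Hp_space a b k" "l2 a b (weak_dx a b l u) \<le> M"
proof -
  show u: "u \<in> Hp_space a b k" using n by (auto simp: Hp_norm_def top_unique split: if_splits)
  let ?f = "\<lambda>l. (enn2real (L2_norm a b (weak_dx a b l u)))\<^sup>2"
  have "sqrt (\<Sum>l\<le>k. ?f l) \<le> M"
    using n u by (simp add: Hp_norm_def)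
  moreover have "?f l \<le> (\<Sum>l\<le>k. ?f l)"
    using l by (intro member_le_sum) auto
  ultimately have "sqrt (?f l) \<le> M" by (meson order_trans real_sqrt_le_mono)
  thus "l2 a b (weak_dx a b l u) \<le> M"
    using weak_dx_Hp[OF u l] by (simp add: L2_norm_eq l2_nonneg)
qed

text \<open>A discarded frequency has \<open>\<bar>j\<bar> \<ge> N / 2\<close>, so that \<open>h \<bar>\<mu>\<^sub>j\<bar> \<ge> \<pi>\<close> with \<open>h = (b - a) / N\<close>.\<close>

lemma mu_lower_bound:
  assumes "a < b" "even N" "0 < N" "j \<notin> modes N"
  shows "1 \<le> (b - a) / real N * \<bar>mu a b j\<bar>"
proof -
  have "int N \<le> 2 * \<bar>j\<bar>" using assms(2,4) by (auto simp: modes_def elim!: evenE)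
  hence "real N \<le> 2 * \<bar>real_of_int j\<bar>" by linarith
  also have "\<dots> = 1 * (2 * \<bar>real_of_int j\<bar>)" by simp
  also have "\<dots> \<le> pi * (2 * \<bar>real_of_int j\<bar>)" using pi_ge_two by (intro mult_right_mono) auto
  finally have "real N \<le> 2 * pi * \<bar>real_of_int j\<bar>" by (simp add: mult_ac)
  moreover have "(b - a) / real N * \<bar>mu a b j\<bar> = 2 * pi * \<bar>real_of_int j\<bar> / real N"
    using assms(1) by (simp add: mu_def abs_mult)
  ultimately show ?thesis using assms(3) by simp
qed

lemma finite_modes: "finite (modes N)" by (simp add: modes_def)

text \<open>
  By completeness the squared error is the sum of the squared coefficients over the discarded
  frequencies. Each of them gains a factor \<open>h\<^sup>k\<close> against the corresponding coefficient of the
  \<open>k\<close>-th derivative, to which Bessel's inequality applies.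
\<close>

lemma projection_error:
  fixes u :: "real \<Rightarrow> complex^2"
  assumes ab: "a < b" and u: "u \<in> Hp_space a b k" "k > 0"
    and v: "weak_deriv a b k u v" "sqint a b v" and N: "even N" "0 < N"
  shows "l2 a b (\<lambda>x. u x - P_N a b N u x) \<le> ((b - a) / real N) ^ k * l2 a b v"
proof -
  let ?h = "(b - a) / real N" and ?c = "fourier_coeff a b u" and ?d = "fourier_coeff a b v"
  have h: "?h > 0" using ab N by simp
  have s: "sqint a b u" using u by (simp add: Hp_space_def H_space_def L2_norm_less_top)
  obtain g where g: "continuous_on {a..b} g" "weak_deriv a b 0 u g" "g a = g b"
    using u by (auto simp: Hp_space_def periodic_bc_def)
  have ae: "AE x in ivl a b. u x = g x"
    by (rule weak_deriv_unique[OF weak_deriv_0[OF sqint_locally_integrable[OF s]] g(2)])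
  have gm: "g \<in> borel_measurable (ivl a b)" using sqint_continuous[OF g(1)] by (simp add: sqint_def)
  have lg: "l2 a b g = l2 a b u" by (rule l2_cong_AE(2)[OF s gm ae])
  have cg: "fourier_coeff a b g = ?c"
    by (rule ext, rule fourier_coeff_cong[OF ae sqint_integrable[OF s] gm, symmetric])
  have dc: "norm (?c j) \<le> ?h ^ k * norm (?d j)" if "j \<notin> modes N" for j
  proof -
    have "?d j = (\<i> * of_real (mu a b j)) ^ k *s ?c j"
      by (rule fourier_weak_deriv[OF ab u(1) order_refl v(1) sqint_integrable[OF v(2)]])
    hence "norm (?d j) = \<bar>mu a b j\<bar> ^ k * norm (?c j)"
      by (simp add: norm_vec_smult norm_power norm_mult)
    hence "?h ^ k * norm (?d j) = (?h * \<bar>mu a b j\<bar>) ^ k * norm (?c j)"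
      by (simp only: power_mult_distrib mult.assoc)
    moreover have "1 ^ k \<le> (?h * \<bar>mu a b j\<bar>) ^ k"
      using mu_lower_bound[OF ab N that] by (intro power_mono) auto
    hence "1 * norm (?c j) \<le> (?h * \<bar>mu a b j\<bar>) ^ k * norm (?c j)" by (intro mult_right_mono) auto
    ultimately show ?thesis by simp
  qed
  have "(l2 a b (\<lambda>x. u x - P_N a b N u x))\<^sup>2 \<le> (?h ^ k * l2 a b v)\<^sup>2 + e" if e: "e > 0" for e
  proof -
    obtain A where A: "finite A" "(l2 a b g)\<^sup>2 - (b - a) * (\<Sum>l\<in>A. (norm (fourier_coeff a b g l))\<^sup>2) \<le> e"
      using Parseval_approx[OF ab g(1,3) e] by blast
    have 1: "(l2 a b (\<lambda>x. u x - P_N a b N u x))\<^sup>2 = (l2 a b u)\<^sup>2 - (b - a) * (\<Sum>l\<in>modes N. (norm (?c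
        l))\<^sup>2)"
      unfolding P_N_def trig_poly_trig_sum l2_sq_diff_trig_sum[OF ab finite_modes s] by simp
    have "(\<Sum>l\<in>A. (norm (?c l))\<^sup>2) \<le> (\<Sum>l\<in>modes N \<union> (A - modes N). (norm (?c l))\<^sup>2)"
      using A(1) finite_modes by (intro sum_mono2) auto
    also have "\<dots> = (\<Sum>l\<in>modes N. (norm (?c l))\<^sup>2) + (\<Sum>l\<in>A - modes N. (norm (?c l))\<^sup>2)"
      using A(1) finite_modes by (intro sum.union_disjoint) auto
    also have "(\<Sum>l\<in>A - modes N. (norm (?c l))\<^sup>2) \<le> (\<Sum>l\<in>A - modes N. (?h ^ k)\<^sup>2 * (norm (?d l))\<^sup>2)"
      unfolding power_mult_distrib[symmetric] by (intro sum_mono power_mono dc) auto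
    also have "\<dots> = (?h ^ k)\<^sup>2 * (\<Sum>l\<in>A - modes N. (norm (?d l))\<^sup>2)" by (simp add: sum_distrib_left)
    finally have "(b - a) * (\<Sum>l\<in>A. (norm (?c l))\<^sup>2) \<le>
       (b - a) * ((\<Sum>l\<in>modes N. (norm (?c l))\<^sup>2) + (?h ^ k)\<^sup>2 * (\<Sum>l\<in>A - modes N. (norm (?d l))\<^sup>2))"
      using ab by (intro mult_left_mono) auto
    also have "\<dots> = (b - a) * (\<Sum>l\<in>modes N. (norm (?c l))\<^sup>2) + (?h ^ k)\<^sup>2 * ((b - a) * (\<Sum>l\<in>A - modes
        N. (norm (?d l))\<^sup>2))"
      by (simp add: algebra_simps)
    also have "\<dots> \<le> (b - a) * (\<Sum>l\<in>modes N. (norm (?c l))\<^sup>2) + (?h ^ k)\<^sup>2 * (l2 a b v)\<^sup>2"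
      using A(1) v by (intro add_left_mono mult_left_mono Bessel ab) auto
    finally show ?thesis using A(2) unfolding 1 lg cg by (simp add: power_mult_distrib)
  qed
  hence "(l2 a b (\<lambda>x. u x - P_N a b N u x))\<^sup>2 \<le> (?h ^ k * l2 a b v)\<^sup>2"
    by (rule field_le_epsilon)
  thus ?thesis
    by (rule power2_le_imp_le) (intro mult_nonneg_nonneg zero_le_power l2_nonneg less_imp_le[OF h])
qed

section \<open>Pairing a space-time function with a function of space\<close>

text \<open>
  Joint measurability refers to Lebesgue measure in the plane, which is the completion of the
  product measure. A Borel version makes Fubini's theorem available, at the price of exceptional
  null sets.
\<close>

lemma joint_borel_version:
  fixes u :: "real \<Rightarrow> real \<Rightarrow> 'v::euclidean_space"
  assumes "jointly_measurable T a b u"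
  obtains u' where "u' \<in> borel_measurable (lborel \<Otimes>\<^sub>M lborel)"
    "AE t in ivl 0 T. AE x in ivl a b. u t x = u' (t, x)"
    "AE x in ivl a b. AE t in ivl 0 T. u t x = u' (t, x)"
proof -
  let ?R = "{0<..<T} \<times> {a<..<b}"
  have "open ?R" by (intro open_Times) auto
  hence R: "?R \<in> sets lebesgue" by (intro sets_completionI_sets) (simp add: borel_open)
  have "(\<lambda>p. indicator ?R p *\<^sub>R (case p of (t, x) \<Rightarrow> u t x)) \<in> borel_measurable (completion lborel)"
    using assms R by (simp add: jointly_measurable_def borel_measurable_restrict_space_iff
        case_prod_unfold)
  from completion_ex_borel_measurable_euclidean[OF this]
  obtain u' where u': "u' \<in> borel_measurable lborel"
     "AE p in lborel. indicator ?R p *\<^sub>R (case p of (t, x) \<Rightarrow> u t x) = u' p" by blast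
  then obtain Z where Z: "Z \<in> null_sets lborel"
      "{p. indicator ?R p *\<^sub>R (case p of (t, x) \<Rightarrow> u t x) \<noteq> u' p} \<subseteq> Z"
    by (auto simp: eventually_ae_filter)
  have Zs: "Z \<in> sets (lborel \<Otimes>\<^sub>M lborel)" unfolding lborel_prod by (rule null_setsD2[OF Z(1)])
  have "AE p in lborel \<Otimes>\<^sub>M lborel. p \<notin> Z" unfolding lborel_prod by (rule AE_not_in[OF Z(1)])
  hence a1: "AE t in lborel. AE x in lborel. (t, x) \<notin> Z" by (rule lborel_pair.AE_pair)
  have "{p \<in> space (lborel \<Otimes>\<^sub>M lborel). (fst p, snd p) \<notin> Z} = space (lborel \<Otimes>\<^sub>M lborel) - Z" by auto
  hence "{p \<in> space (lborel \<Otimes>\<^sub>M lborel). (fst p, snd p) \<notin> Z} \<in> sets (lborel \<Otimes>\<^sub>M lborel)"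
    using sets.compl_sets[OF Zs] by (simp only:)
  hence a2: "AE x in lborel. AE t in lborel. (t, x) \<notin> Z"
    using a1 lborel_pair.AE_commute[of "\<lambda>t x. (t, x) \<notin> Z"] by simp
  have AEI: "AE x in ivl c d. Q x" if "AE x in lborel. x \<in> {c<..<d} \<longrightarrow> Q x" for c d and Q :: "real \<Rightarrow> bool"
    by (subst AE_restrict_space_iff) (use AE_completion[OF that] in auto)
  have e: "u t x = u' (t, x)" if "(t, x) \<notin> Z" "t \<in> {0<..<T}" "x \<in> {a<..<b}" for t x
  proof -
    have "(t, x) \<notin> {p. indicator ?R p *\<^sub>R (case p of (t, x) \<Rightarrow> u t x) \<noteq> u' p}"
      using Z(2) that(1) by (rule contra_subsetD)
    thus ?thesis using that(2,3) by simp
  qed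
  have "AE t in ivl 0 T. AE x in ivl a b. u t x = u' (t, x)"
  proof (rule AEI, use a1 in eventually_elim, rule impI)
    fix t assume "AE x in lborel. (t, x) \<notin> Z" "t \<in> {0<..<T}"
    thus "AE x in ivl a b. u t x = u' (t, x)"
      by (intro AEI) (auto elim!: eventually_mono intro: e)
  qed
  moreover have "AE x in ivl a b. AE t in ivl 0 T. u t x = u' (t, x)"
  proof (rule AEI, use a2 in eventually_elim, rule impI)
    fix x assume "AE t in lborel. (t, x) \<notin> Z" "x \<in> {a<..<b}"
    thus "AE t in ivl 0 T. u t x = u' (t, x)"
      by (intro AEI) (auto elim!: eventually_mono intro: e)
  qed
  ultimately show ?thesis using that u'(1) by (simp add: lborel_prod)
qed

lemma measurable_ivl_AE:
  fixes f g :: "real \<Rightarrow> 'v::euclidean_space"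
  assumes f: "f \<in> borel_measurable (ivl a b)" and ae: "AE x in ivl a b. f x = g x"
  shows "g \<in> borel_measurable (ivl a b)"
proof -
  have ae': "AE x in lebesgue. (if x \<in> {a<..<b} then f x else 0) = (if x \<in> {a<..<b} then g x else 0)"
    using ae by (subst (asm) AE_restrict_space_iff) (auto elim!: eventually_mono)
  have "(\<lambda>x. if x \<in> {a<..<b} then f x else 0) \<in> borel_measurable lebesgue"
    by (rule borel_measurable_if_I[OF f]) simp
  hence "(\<lambda>x. if x \<in> {a<..<b} then g x else 0) \<in> borel_measurable lebesgue"
    by (rule borel_measurable_AE[OF _ ae'])
  thus ?thesis by (rule borel_measurable_if_D)
qed

lemma ivl_borel_version:
  fixes g g' :: "real \<Rightarrow> 'v::euclidean_space"
  assumes g': "g' \<in> borel_measurable lborel" and ae: "AE x in ivl a b. g x = g' x"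
  shows "g \<in> borel_measurable (ivl a b)"
    "integral\<^sup>L (ivl a b) g = (\<integral>x. indicator {a<..<b} x *\<^sub>R g' x \<partial>lborel)"
    "integrable (ivl a b) g \<longleftrightarrow> integrable lborel (\<lambda>x. indicator {a<..<b} x *\<^sub>R g' x)"
proof -
  have m': "g' \<in> borel_measurable (ivl a b)"
    using measurable_completion[OF g'] by (intro measurable_restrict_space1) 
  have m'': "(\<lambda>x. indicator {a<..<b} x *\<^sub>R g' x) \<in> borel_measurable lborel"
    using g' by simp
  have "AE x in ivl a b. g' x = g x" using ae by eventually_elim simp
  thus m: "g \<in> borel_measurable (ivl a b)" by (rule measurable_ivl_AE[OF m'])
  show "integral\<^sup>L (ivl a b) g = (\<integral>x. indicator {a<..<b} x *\<^sub>R g' x \<partial>lborel)"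
  proof -
    have "integral\<^sup>L (ivl a b) g = integral\<^sup>L (ivl a b) g'" by (rule integral_cong_AE[OF m m' ae])
    also have "\<dots> = (\<integral>x. indicator {a<..<b} x *\<^sub>R g' x \<partial>lebesgue)" by (simp add: integral_restrict_space)
    also have "\<dots> = (\<integral>x. indicator {a<..<b} x *\<^sub>R g' x \<partial>lborel)" by (rule integral_completion[OF m''])
    finally show ?thesis .
  qed
  have "integrable (ivl a b) g \<longleftrightarrow> integrable (ivl a b) g'" by (rule integrable_cong_AE[OF m m' ae])
  also have "\<dots> \<longleftrightarrow> integrable lebesgue (\<lambda>x. indicator {a<..<b} x *\<^sub>R g' x)" by (simp add:
      integrable_restrict_space)
  also have "\<dots> \<longleftrightarrow> integrable lborel (\<lambda>x. indicator {a<..<b} x *\<^sub>R g' x)" by (rule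
      integrable_completion[OF m''])
  finally show "integrable (ivl a b) g \<longleftrightarrow> integrable lborel (\<lambda>x. indicator {a<..<b} x *\<^sub>R g' x)" .
qed

text \<open>
  The pairing in space is bounded for almost every time, so the product with \<open>\<phi>\<close> is integrable
  over the rectangle and the two integrations may be exchanged. Integrability of \<open>\<phi> u\<close> in time
  is needed to move \<open>f\<close> out of the vector-valued inner integral.
\<close>

lemma pairing_Fubini:
  fixes u :: "real \<Rightarrow> real \<Rightarrow> 'v::euclidean_space"
  assumes u: "jointly_measurable T a b u" and f: "f \<in> borel_measurable (ivl a b)"
    and K: "AE t in ivl 0 T. (\<integral>\<^sup>+x. ennreal (norm (u t x) * norm (f x)) \<partial>ivl a b) \<le> ennreal K"
    and \<phi>: "smooth \<phi>" and li: "AE x in ivl a b. integrable (ivl 0 T) (\<lambda>t. \<phi> t *\<^sub>R u t x)"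
  shows "integrable (ivl 0 T) (\<lambda>t. \<integral>x. u t x \<bullet> f x \<partial>ivl a b)"
    "AE t in ivl 0 T. \<bar>\<integral>x. u t x \<bullet> f x \<partial>ivl a b\<bar> \<le> max K 0"
    "(\<integral>t. \<phi> t *\<^sub>R (\<integral>x. u t x \<bullet> f x \<partial>ivl a b) \<partial>ivl 0 T) =
       (\<integral>x. (\<integral>t. \<phi> t *\<^sub>R u t x \<partial>ivl 0 T) \<bullet> f x \<partial>ivl a b)"
    "(\<lambda>x. (\<integral>t. \<phi> t *\<^sub>R u t x \<partial>ivl 0 T) \<bullet> f x) \<in> borel_measurable (ivl a b)"
proof -
  obtain u' where u': "u' \<in> borel_measurable (lborel \<Otimes>\<^sub>M lborel)"
    "AE t in ivl 0 T. AE x in ivl a b. u t x = u' (t, x)"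
    "AE x in ivl a b. AE t in ivl 0 T. u t x = u' (t, x)"
    by (rule joint_borel_version[OF u])
  have "(\<lambda>x. indicator {a<..<b} x *\<^sub>R f x) \<in> borel_measurable (completion lborel)"
    using f by (simp add: borel_measurable_restrict_space_iff)
  from completion_ex_borel_measurable_euclidean[OF this]
  obtain f' where f': "f' \<in> borel_measurable lborel" "AE x in lborel. indicator {a<..<b} x *\<^sub>R f x =
      f' x" by blast
  have f'ae: "AE x in ivl a b. f x = f' x"
    using AE_completion[OF f'(2)] by (subst AE_restrict_space_iff) (auto elim!: eventually_mono)
  define I J where "I = (indicator {0<..<T} :: real \<Rightarrow> real)" and "J = (indicator {a<..<b} :: real \<Rightarrow>
      real)"
  have \<phi>m: "\<phi> \<in> borel_measurable lborel"
    using smooth_continuous[OF \<phi>, of UNIV] by (simp add: borel_measurable_continuous_onI)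
  note [measurable] = u'(1) f'(1) \<phi>m
  have IJm [measurable]: "I \<in> borel_measurable lborel" "J \<in> borel_measurable lborel"
    unfolding I_def J_def by measurable
  have um: "(\<lambda>x. u' (t, x)) \<in> borel_measurable lborel" for t by measurable
  have um2: "(\<lambda>t. u' (t, x)) \<in> borel_measurable lborel" for x by measurable
  have inner_eq: "AE t in ivl 0 T. (\<integral>x. u t x \<bullet> f x \<partial>ivl a b) = (\<integral>x. J x * (u' (t, x) \<bullet> f' x) \<partial>lborel)"
    using u'(2)
  proof eventually_elim
    case (elim t)
    have "AE x in ivl a b. u t x \<bullet> f x = u' (t, x) \<bullet> f' x" using elim f'ae by eventually_elim simp
    from ivl_borel_version(2)[OF _ this] show ?case by (simp add: J_def)
  qed
  have bnd: "AE t in ivl 0 T. (\<integral>\<^sup>+x. ennreal (norm (J x * (u' (t, x) \<bullet> f' x))) \<partial>lborel) \<le> ennreal K"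
    using u'(2) K
  proof eventually_elim
    case (elim t)
    have "(\<integral>\<^sup>+x. ennreal (norm (J x * (u' (t, x) \<bullet> f' x))) \<partial>lborel)
       = (\<integral>\<^sup>+x. ennreal (norm (J x * (u' (t, x) \<bullet> f' x))) \<partial>lebesgue)"
      by (rule nn_integral_completion[symmetric])
    also have "\<dots> = (\<integral>\<^sup>+x. ennreal (norm (u' (t, x) \<bullet> f' x)) * indicator {a<..<b} x \<partial>lebesgue)"
      by (rule nn_integral_cong) (auto simp: J_def indicator_def)
    also have "\<dots> = (\<integral>\<^sup>+x. ennreal (norm (u' (t, x) \<bullet> f' x)) \<partial>ivl a b)"
      by (rule nn_integral_restrict_space[symmetric]) auto
    also have "\<dots> \<le> (\<integral>\<^sup>+x. ennreal (norm (u t x) * norm (f x)) \<partial>ivl a b)"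
    proof (rule nn_integral_mono_AE)
      show "AE x in ivl a b. ennreal (norm (u' (t, x) \<bullet> f' x)) \<le> ennreal (norm (u t x) * norm (f x))"
        using elim(1) f'ae by eventually_elim (auto intro!: ennreal_leI Cauchy_Schwarz_ineq2)
    qed
    also have "\<dots> \<le> ennreal K" by (rule elim(2))
    finally show ?case .
  qed
  have AEl: "AE t in lborel. t \<in> {0<..<T} \<longrightarrow> Q t" if "AE t in ivl 0 T. Q t" for Q
    using that by (subst (asm) AE_restrict_space_iff) (auto simp: AE_completion_iff)
  have prod_int: "integrable (lborel \<Otimes>\<^sub>M lborel) (\<lambda>(t, x). I t * \<psi> t * (J x * (u' (t, x) \<bullet> f' x)))"
    if \<psi>: "\<psi> \<in> borel_measurable lborel" "\<And>t. t \<in> {0<..<T} \<Longrightarrow> \<bar>\<psi> t\<bar> \<le> B" for \<psi> B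
  proof (rule integrableI_bounded)
    note [measurable] = \<psi>(1)
    show "(\<lambda>(t, x). I t * \<psi> t * (J x * (u' (t, x) \<bullet> f' x))) \<in> borel_measurable (lborel \<Otimes>\<^sub>M lborel)"
      by measurable
    have "(\<integral>\<^sup>+p. ennreal (norm (case p of (t, x) \<Rightarrow> I t * \<psi> t * (J x * (u' (t, x) \<bullet> f' x)))) \<partial>(lborel
        \<Otimes>\<^sub>M lborel))
       = (\<integral>\<^sup>+t. \<integral>\<^sup>+x. ennreal (norm (I t * \<psi> t * (J x * (u' (t, x) \<bullet> f' x)))) \<partial>lborel \<partial>lborel)"
      by (subst lborel.nn_integral_fst[symmetric]) (auto intro!: measurable_compose[OF _
          measurable_ennreal] simp: case_prod_unfold)
    also have "\<dots> \<le> (\<integral>\<^sup>+t. ennreal (\<bar>B\<bar> * \<bar>K\<bar>) * indicator {0<..<T} t \<partial>lborel)"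
    proof (rule nn_integral_mono_AE)
      show "AE t in lborel. (\<integral>\<^sup>+x. ennreal (norm (I t * \<psi> t * (J x * (u' (t, x) \<bullet> f' x)))) \<partial>lborel)
          \<le> ennreal (\<bar>B\<bar> * \<bar>K\<bar>) * indicator {0<..<T} t"
        using AEl[OF bnd]
      proof eventually_elim
        case (elim t)
        show ?case
        proof (cases "t \<in> {0<..<T}")
          case False thus ?thesis by (simp add: I_def)
        next
          case True
          have "(\<integral>\<^sup>+x. ennreal (norm (I t * \<psi> t * (J x * (u' (t, x) \<bullet> f' x)))) \<partial>lborel)
              = (\<integral>\<^sup>+x. ennreal \<bar>\<psi> t\<bar> * ennreal (norm (J x * (u' (t, x) \<bullet> f' x))) \<partial>lborel)"
            using True by (intro nn_integral_cong) (auto simp: I_def abs_mult ennreal_mult[symmetric])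
          also have "\<dots> = ennreal \<bar>\<psi> t\<bar> * (\<integral>\<^sup>+x. ennreal (norm (J x * (u' (t, x) \<bullet> f' x))) \<partial>lborel)"
            by (rule nn_integral_cmult) measurable
          also have "\<dots> \<le> ennreal \<bar>B\<bar> * ennreal \<bar>K\<bar>"
          proof (rule mult_mono)
            show "ennreal \<bar>\<psi> t\<bar> \<le> ennreal \<bar>B\<bar>" using \<psi>(2)[OF True] by (intro ennreal_leI) auto
            have "(\<integral>\<^sup>+x. ennreal (norm (J x * (u' (t, x) \<bullet> f' x))) \<partial>lborel) \<le> ennreal K" using elim
                True by blast
            also have "\<dots> \<le> ennreal \<bar>K\<bar>" by (intro ennreal_leI) auto
            finally show "(\<integral>\<^sup>+x. ennreal (norm (J x * (u' (t, x) \<bullet> f' x))) \<partial>lborel) \<le> ennreal \<bar>K\<bar>" .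
          qed auto
          finally show ?thesis using True by (simp add: ennreal_mult)
        qed
      qed
    qed
    also have "\<dots> = ennreal (\<bar>B\<bar> * \<bar>K\<bar>) * emeasure lborel {0<..<T}"
      by (rule nn_integral_cmult_indicator) auto
    also have "\<dots> < \<infinity>"
      by (cases "0 \<le> T") (auto simp: ennreal_mult_less_top emeasure_lborel_Ioo)
    finally show "(\<integral>\<^sup>+p. ennreal (norm (case p of (t, x) \<Rightarrow> I t * \<psi> t * (J x * (u' (t, x) \<bullet> f' x))))
        \<partial>(lborel \<Otimes>\<^sub>M lborel)) < \<infinity>" .
  qed
  define P' where "P' = (\<lambda>t. \<integral>x. J x * (u' (t, x) \<bullet> f' x) \<partial>lborel)"
  have P'm: "P' \<in> borel_measurable lborel" unfolding P'_def by measurable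
  show "integrable (ivl 0 T) (\<lambda>t. \<integral>x. u t x \<bullet> f x \<partial>ivl a b)"
  proof (subst ivl_borel_version(3)[OF P'm])
    show "AE t in ivl 0 T. (\<integral>x. u t x \<bullet> f x \<partial>ivl a b) = P' t" using inner_eq by (simp add: P'_def)
    from lborel_pair.integrable_fst'[OF prod_int[of "\<lambda>_. 1" 1]]
    show "integrable lborel (\<lambda>t. indicator {0<..<T} t *\<^sub>R P' t)" by (simp add: I_def P'_def)
  qed
  show "AE t in ivl 0 T. \<bar>\<integral>x. u t x \<bullet> f x \<partial>ivl a b\<bar> \<le> max K 0"
    using inner_eq bnd
  proof eventually_elim
    case (elim t)
    have "ennreal (norm (\<integral>x. J x * (u' (t, x) \<bullet> f' x) \<partial>lborel)) \<le> (\<integral>\<^sup>+x. ennreal (norm (J x * (u'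
        (t, x) \<bullet> f' x))) \<partial>lborel)"
      by (rule integral_norm_bound_ennreal) 
       (intro integrableI_bounded, measurable, rule le_less_trans[OF elim(2)], simp)
    also have "\<dots> \<le> ennreal K" by (rule elim(2))
    finally have "norm (\<integral>x. J x * (u' (t, x) \<bullet> f' x) \<partial>lborel) \<le> max K 0"
      by (cases "K \<ge> 0") (auto simp: ennreal_neg max_def)
    thus ?case using elim(1) by simp
  qed
  have "continuous_on {0..T} \<phi>" using \<phi> by (rule smooth_continuous)
  hence "bounded (\<phi> ` {0..T})" using compact_continuous_image compact_imp_bounded by blast
  then obtain B where B: "\<And>t. t \<in> {0..T} \<Longrightarrow> \<bar>\<phi> t\<bar> \<le> B" unfolding bounded_iff by fastforce
  have int\<phi>: "integrable (lborel \<Otimes>\<^sub>M lborel) (\<lambda>(t, x). I t * \<phi> t * (J x * (u' (t, x) \<bullet> f' x)))"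
    by (rule prod_int[OF \<phi>m, of B]) (use B in auto)
  have m3: "(\<lambda>x. (\<integral>t. I t *\<^sub>R (\<phi> t *\<^sub>R u' (t, x)) \<partial>lborel) \<bullet> f' x) \<in> borel_measurable lborel"
    by measurable
  have ae3: "AE x in ivl a b. (\<integral>t. \<phi> t *\<^sub>R u t x \<partial>ivl 0 T) \<bullet> f x = (\<integral>t. I t *\<^sub>R (\<phi> t *\<^sub>R u' (t, x))
      \<partial>lborel) \<bullet> f' x"
    using u'(3) f'ae
  proof eventually_elim
    case (elim x)
    have "(\<integral>t. \<phi> t *\<^sub>R u t x \<partial>ivl 0 T) = (\<integral>t. I t *\<^sub>R (\<phi> t *\<^sub>R u' (t, x)) \<partial>lborel)"
      unfolding I_def
      by (rule ivl_borel_version(2)) (use elim(1) in \<open>auto elim!: eventually_mono\<close>)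
    thus ?case using elim(2) by simp
  qed
  show "(\<lambda>x. (\<integral>t. \<phi> t *\<^sub>R u t x \<partial>ivl 0 T) \<bullet> f x) \<in> borel_measurable (ivl a b)"
    by (rule ivl_borel_version(1)[OF m3 ae3])
  have "(\<integral>t. \<phi> t *\<^sub>R (\<integral>x. u t x \<bullet> f x \<partial>ivl a b) \<partial>ivl 0 T) = (\<integral>t. I t *\<^sub>R (\<phi> t *\<^sub>R P' t) \<partial>lborel)"
    unfolding I_def
    by (rule ivl_borel_version(2)) (use P'm inner_eq in \<open>auto simp: P'_def elim!: eventually_mono\<close>)
  also have "\<dots> = (\<integral>t. \<integral>x. I t * \<phi> t * (J x * (u' (t, x) \<bullet> f' x)) \<partial>lborel \<partial>lborel)"
    by (simp add: P'_def mult.assoc)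
  also have "\<dots> = (\<integral>x. \<integral>t. I t * \<phi> t * (J x * (u' (t, x) \<bullet> f' x)) \<partial>lborel \<partial>lborel)"
    by (rule lborel_pair.Fubini_integral[symmetric, OF int\<phi>])
  also have "\<dots> = (\<integral>x. J x *\<^sub>R ((\<integral>t. I t *\<^sub>R (\<phi> t *\<^sub>R u' (t, x)) \<partial>lborel) \<bullet> f' x) \<partial>lborel)"
  proof (rule integral_cong_AE)
    show "(\<lambda>x. \<integral>t. I t * \<phi> t * (J x * (u' (t, x) \<bullet> f' x)) \<partial>lborel) \<in> borel_measurable lborel"
      by measurable
    show "(\<lambda>x. J x *\<^sub>R ((\<integral>t. I t *\<^sub>R (\<phi> t *\<^sub>R u' (t, x)) \<partial>lborel) \<bullet> f' x)) \<in> borel_measurable lborel"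
      by measurable
    have "AE x in ivl a b. integrable lborel (\<lambda>t. I t *\<^sub>R (\<phi> t *\<^sub>R u' (t, x)))"
      using u'(3) li
    proof eventually_elim
      case (elim x)
      have m: "(\<lambda>t. \<phi> t *\<^sub>R u' (t, x)) \<in> borel_measurable lborel" by measurable
      have "AE t in ivl 0 T. \<phi> t *\<^sub>R u t x = \<phi> t *\<^sub>R u' (t, x)"
        using elim(1) by eventually_elim simp
      from ivl_borel_version(3)[OF m this] show ?case using elim(2) by (simp add: I_def)
    qed
    hence "AE x in lborel. x \<in> {a<..<b} \<longrightarrow> integrable lborel (\<lambda>t. I t *\<^sub>R (\<phi> t *\<^sub>R u' (t, x)))"
      by (subst (asm) AE_restrict_space_iff) (auto simp: AE_completion_iff)
    thus "AE x in lborel. (\<integral>t. I t * \<phi> t * (J x * (u' (t, x) \<bullet> f' x)) \<partial>lborel) =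
        J x *\<^sub>R ((\<integral>t. I t *\<^sub>R (\<phi> t *\<^sub>R u' (t, x)) \<partial>lborel) \<bullet> f' x)"
    proof eventually_elim
      case (elim x)
      show ?case
      proof (cases "x \<in> {a<..<b}")
        case False thus ?thesis by (simp add: J_def)
      next
        case True
        have "(\<integral>t. I t * \<phi> t * (J x * (u' (t, x) \<bullet> f' x)) \<partial>lborel)
            = (\<integral>t. (I t *\<^sub>R (\<phi> t *\<^sub>R u' (t, x))) \<bullet> f' x \<partial>lborel)"
          using True by (intro Bochner_Integration.integral_cong) (auto simp: J_def)
        also have "\<dots> = (\<integral>t. I t *\<^sub>R (\<phi> t *\<^sub>R u' (t, x)) \<partial>lborel) \<bullet> f' x"
          using elim True by (intro integral_inner_left) blast
        finally show ?thesis using True by (simp add: J_def)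
      qed
    qed
  qed
  also have "\<dots> = (\<integral>x. (\<integral>t. \<phi> t *\<^sub>R u t x \<partial>ivl 0 T) \<bullet> f x \<partial>ivl a b)"
    unfolding J_def by (rule ivl_borel_version(2)[symmetric, OF m3 ae3])
  finally show "(\<integral>t. \<phi> t *\<^sub>R (\<integral>x. u t x \<bullet> f x \<partial>ivl a b) \<partial>ivl 0 T) =
       (\<integral>x. (\<integral>t. \<phi> t *\<^sub>R u t x \<partial>ivl 0 T) \<bullet> f x \<partial>ivl a b)" .
qed

lemma integrable_ivl_locally: "integrable (ivl a b) (q :: real \<Rightarrow> 'v::euclidean_space) \<Longrightarrow>
    locally_integrable a b q"
  unfolding locally_integrable_def by (intro allI impI, rule integrable_ivl_subset) auto

lemma weak_dt_test_integrable:
  fixes u v :: "real \<Rightarrow> real \<Rightarrow> 'v::euclidean_space"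
  assumes "weak_dt T a b u v" "\<phi> \<in> test_functions 0 T"
  shows "AE x in ivl a b. integrable (ivl 0 T) (\<lambda>t. \<phi> t *\<^sub>R u t x)"
    "AE x in ivl a b. integrable (ivl 0 T) (\<lambda>t. \<phi> t *\<^sub>R v t x)"
proof -
  have "AE x in ivl a b. locally_integrable 0 T (\<lambda>t. u t x) \<and> locally_integrable 0 T (\<lambda>t. v t x)"
    using assms(1) unfolding weak_dt_def by blast
  hence "AE x in ivl a b. integrable (ivl 0 T) (\<lambda>t. \<phi> t *\<^sub>R u t x) \<and> integrable (ivl 0 T) (\<lambda>t. \<phi> t
      *\<^sub>R v t x)"
  proof eventually_elim
    case (elim x)
    show ?case using test_integrable(3)[OF conjunct1[OF elim] assms(2)] test_integrable(3)[OF
        conjunct2[OF elim] assms(2)] by blast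
  qed
  thus "AE x in ivl a b. integrable (ivl 0 T) (\<lambda>t. \<phi> t *\<^sub>R u t x)"
    "AE x in ivl a b. integrable (ivl 0 T) (\<lambda>t. \<phi> t *\<^sub>R v t x)"
    by (auto elim: eventually_mono)
qed

lemma test_function_zero_exists: "0 < T \<Longrightarrow> (\<lambda>t. 0) \<in> test_functions 0 T"
proof -
  assume T: "0 < T"
  have "(deriv ^^ n) (\<lambda>t. 0::real) = (\<lambda>t. 0)" for n by (induction n) auto
  moreover have "0 < T / 2" "T / 2 < T" using T by auto
  ultimately show ?thesis unfolding test_functions_def mem_Collect_eq
    by (intro conjI exI[of _ "T / 2"]) (simp_all only:, simp_all)
qed

text \<open>
  The weak time derivative is an identity between functions of \<open>x\<close>, one for each test function.
  Pairing it with a fixed \<open>f\<close> gives a weak derivative of a scalar function of time.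
\<close>

lemma weak_dt_pairing:
  fixes u v :: "real \<Rightarrow> real \<Rightarrow> 'v::euclidean_space"
  assumes wd: "weak_dt T a b u v" and f: "f \<in> borel_measurable (ivl a b)" and T: "0 < T"
    and Ku: "AE t in ivl 0 T. (\<integral>\<^sup>+x. ennreal (norm (u t x) * norm (f x)) \<partial>ivl a b) \<le> ennreal Ku"
    and Kv: "AE t in ivl 0 T. (\<integral>\<^sup>+x. ennreal (norm (v t x) * norm (f x)) \<partial>ivl a b) \<le> ennreal Kv"
  shows "weak_deriv 0 T 1 (\<lambda>t. \<integral>x. u t x \<bullet> f x \<partial>ivl a b) (\<lambda>t. \<integral>x. v t x \<bullet> f x \<partial>ivl a b)"
    "integrable (ivl 0 T) (\<lambda>t. \<integral>x. v t x \<bullet> f x \<partial>ivl a b)"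
    "AE t in ivl 0 T. \<bar>\<integral>x. v t x \<bullet> f x \<partial>ivl a b\<bar> \<le> max Kv 0"
proof -
  have ju: "jointly_measurable T a b u" and jv: "jointly_measurable T a b v"
    using wd by (auto simp: weak_dt_def)
  note z = test_function_zero_exists[OF T]
  note zu = pairing_Fubini[OF ju f Ku test_smooth[OF z] weak_dt_test_integrable(1)[OF wd z]]
  note zv = pairing_Fubini[OF jv f Kv test_smooth[OF z] weak_dt_test_integrable(2)[OF wd z]]
  show iv: "integrable (ivl 0 T) (\<lambda>t. \<integral>x. v t x \<bullet> f x \<partial>ivl a b)" by (rule zv(1))
  show "AE t in ivl 0 T. \<bar>\<integral>x. v t x \<bullet> f x \<partial>ivl a b\<bar> \<le> max Kv 0" by (rule zv(2))
  show "weak_deriv 0 T 1 (\<lambda>t. \<integral>x. u t x \<bullet> f x \<partial>ivl a b) (\<lambda>t. \<integral>x. v t x \<bullet> f x \<partial>ivl a b)"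
    unfolding weak_deriv_def
  proof (intro conjI ballI)
    show "locally_integrable 0 T (\<lambda>t. \<integral>x. u t x \<bullet> f x \<partial>ivl a b)" by (rule integrable_ivl_locally[OF
        zu(1)])
    show "locally_integrable 0 T (\<lambda>t. \<integral>x. v t x \<bullet> f x \<partial>ivl a b)" by (rule integrable_ivl_locally[OF iv])
    fix \<phi> assume \<phi>: "\<phi> \<in> test_functions 0 T"
    note d\<phi> = deriv_test[OF \<phi>]
    note Fu = pairing_Fubini(3,4)[OF ju f Ku test_smooth[OF d\<phi>] weak_dt_test_integrable(1)[OF wd d\<phi>]]
    note Fv = pairing_Fubini(3,4)[OF jv f Kv test_smooth[OF \<phi>] weak_dt_test_integrable(2)[OF wd \<phi>]]
    have ae: "AE x in ivl a b. (\<integral>t. deriv \<phi> t *\<^sub>R u t x \<partial>ivl 0 T) = - (\<integral>t. \<phi> t *\<^sub>R v t x \<partial>ivl 0 T)"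
      using wd \<phi> unfolding weak_dt_def by blast
    have "(\<integral>t. deriv \<phi> t *\<^sub>R (\<integral>x. u t x \<bullet> f x \<partial>ivl a b) \<partial>ivl 0 T) = (\<integral>x. (\<integral>t. deriv \<phi> t *\<^sub>R u t x
        \<partial>ivl 0 T) \<bullet> f x \<partial>ivl a b)"
      by (rule Fu(1))
    also have "\<dots> = (\<integral>x. - ((\<integral>t. \<phi> t *\<^sub>R v t x \<partial>ivl 0 T) \<bullet> f x) \<partial>ivl a b)"
    proof (rule integral_cong_AE[OF Fu(2) borel_measurable_uminus[OF Fv(2)]])
      show "AE x in ivl a b. (\<integral>t. deriv \<phi> t *\<^sub>R u t x \<partial>ivl 0 T) \<bullet> f x = - ((\<integral>t. \<phi> t *\<^sub>R v t x \<partial>ivl 0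
          T) \<bullet> f x)"
        using ae by eventually_elim simp
    qed
    also have "\<dots> = - (\<integral>t. \<phi> t *\<^sub>R (\<integral>x. v t x \<bullet> f x \<partial>ivl a b) \<partial>ivl 0 T)"
      unfolding Fv(1) by simp
    finally show "(\<integral>t. (deriv ^^ 1) \<phi> t *\<^sub>R (\<integral>x. u t x \<bullet> f x \<partial>ivl a b) \<partial>ivl 0 T) =
       (-1) ^ 1 *\<^sub>R (\<integral>t. \<phi> t *\<^sub>R (\<integral>x. v t x \<bullet> f x \<partial>ivl a b) \<partial>ivl 0 T)" by simp
  qed
qed

lemma weak_deriv_compose:
  assumes "weak_deriv a b 1 p q" "weak_deriv a b 1 q r"
  shows "weak_deriv a b 2 p r"
  unfolding weak_deriv_def
proof (intro conjI ballI)
  show "locally_integrable a b p" "locally_integrable a b r" using assms by (auto simp: weak_deriv_def)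
  fix \<phi> assume \<phi>: "\<phi> \<in> test_functions a b"
  have "(\<integral>x. (deriv ^^ 1) (deriv \<phi>) x *\<^sub>R p x \<partial>ivl a b) = (-1) ^ 1 *\<^sub>R (\<integral>x. deriv \<phi> x *\<^sub>R q x \<partial>ivl a b)"
    using assms(1) deriv_test[OF \<phi>] unfolding weak_deriv_def by blast
  moreover have "(\<integral>x. (deriv ^^ 1) \<phi> x *\<^sub>R q x \<partial>ivl a b) = (-1) ^ 1 *\<^sub>R (\<integral>x. \<phi> x *\<^sub>R r x \<partial>ivl a b)"
    using assms(2) \<phi> unfolding weak_deriv_def by blast
  ultimately show "(\<integral>x. (deriv ^^ 2) \<phi> x *\<^sub>R p x \<partial>ivl a b) = (-1) ^ 2 *\<^sub>R (\<integral>x. \<phi> x *\<^sub>R r x \<partial>ivl a b)"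
    by (simp add: numeral_2_eq_2)
qed

lemma weak_deriv_1_Lipschitz:
  fixes p q :: "real \<Rightarrow> real"
  assumes wd: "weak_deriv a b 1 p q" and p: "continuous_on {a..b} p" and q: "integrable (ivl a b) q"
    and K: "AE x in ivl a b. \<bar>q x\<bar> \<le> K"
    and st: "a \<le> s" "s \<le> t" "t \<le> b"
  shows "\<bar>p t - p s\<bar> \<le> K * (t - s)"
proof -
  have sub: "{s<..<t} \<subseteq> {a<..<b}" using st by auto
  have qi: "integrable (ivl s t) q" by (rule integrable_ivl_subset[OF q sub]) auto
  have "p t - p s = integral {s..t} q" by (rule weak_deriv_1_continuous[OF wd p q st])
  also have "\<dots> = integral\<^sup>L (ivl s t) q" by (rule integral_ivl_eq[OF qi, symmetric])
  finally have "\<bar>p t - p s\<bar> = \<bar>integral\<^sup>L (ivl s t) q\<bar>" by simp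
  also have "\<dots> \<le> (\<integral>x. \<bar>q x\<bar> \<partial>ivl s t)" by (rule integral_abs_bound)
  also have "\<dots> \<le> (\<integral>x. K \<partial>ivl s t)"
  proof (rule integral_mono_AE)
    show "integrable (ivl s t) (\<lambda>x. K)" by (rule finite_measure.integrable_const[OF finite_measure_ivl])
    have "AE x in lebesgue. x \<in> {a<..<b} \<longrightarrow> \<bar>q x\<bar> \<le> K"
      using K by (subst (asm) AE_restrict_space_iff) auto
    thus "AE x in ivl s t. \<bar>q x\<bar> \<le> K"
      using sub by (subst AE_restrict_space_iff) (auto elim!: eventually_mono)
  qed (use qi in auto)
  also have "\<dots> = K * (t - s)"
    using st by (simp add: measure_restrict_space space_restrict_space)
  finally show ?thesis .
qed

section \<open>Time regularity in norm from weak time derivatives\<close>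

lemma Linf_norm_AE:
  assumes "Linf_norm a b u \<le> ennreal K" "K \<ge> 0"
  shows "u \<in> borel_measurable (ivl a b)" "AE x in ivl a b. norm (u x) \<le> K"
proof -
  show m: "u \<in> borel_measurable (ivl a b)" using assms by (auto simp: Linf_norm_def top_unique
      split: if_splits)
  have "AE x in ivl a b. ennreal (norm (u x)) \<le> Linf_norm a b u"
    using m esssup_AE[of "\<lambda>x. ennreal (norm (u x))" "ivl a b"] by (simp add: Linf_norm_def)
  thus "AE x in ivl a b. norm (u x) \<le> K"
  proof eventually_elim
    case (elim x)
    have "ennreal (norm (u x)) \<le> ennreal K" using elim assms(1) by (rule order_trans)
    thus ?case using assms(2) by simp
  qed
qed

lemma Linf_time_AE:
  assumes "Linf_time T a b N u \<le> ennreal K"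
  shows "jointly_measurable T a b u" "AE t in ivl 0 T. N (u t) \<le> ennreal K"
proof -
  show j: "jointly_measurable T a b u" using assms by (auto simp: Linf_time_def top_unique split:
      if_splits)
  have "AE t in ivl 0 T. N (u t) \<le> esssup (ivl 0 T) (\<lambda>t. N (u t))" by (rule esssup_AE)
  thus "AE t in ivl 0 T. N (u t) \<le> ennreal K"
  proof (rule eventually_mono)
    fix t assume "N (u t) \<le> esssup (ivl 0 T) (\<lambda>t. N (u t))"
    thus "N (u t) \<le> ennreal K" using assms j by (simp add: Linf_time_def)
  qed
qed

lemma AE_ivl_near:
  assumes "AE s in ivl 0 T. P s" "0 < T" "t \<in> {0..T}" "0 < d"
  obtains s where "s \<in> {0<..<T}" "\<bar>s - t\<bar> < d" "P s"
proof -
  define l r where "l = max 0 (t - d)" and "r = min T (t + d)"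
  have lr: "l < r" using assms by (auto simp: l_def r_def)
  have "\<exists>s\<in>{l<..<r}. P s"
  proof (rule ccontr)
    assume no: "\<not> (\<exists>s\<in>{l<..<r}. P s)"
    have "AE s in lebesgue. s \<in> {0<..<T} \<longrightarrow> P s"
      using assms(1) by (subst (asm) AE_restrict_space_iff) auto
    hence "AE s in lebesgue. s \<notin> {l<..<r}"
      by eventually_elim (use no in \<open>auto simp: l_def r_def\<close>)
    hence "{l<..<r} \<in> null_sets lebesgue"
      by (subst (asm) AE_iff_null_sets[symmetric]) auto
    hence "emeasure lebesgue {l<..<r} = 0" by auto
    thus False using lr by simp
  qed
  thus ?thesis using that by (auto simp: l_def r_def abs_less_iff)
qed

text \<open>
  Bounds on first and second weak derivatives of the scalar pairing control its increments and
  its linear extrapolation error. Both are linear in \<open>K\<close>, which will be proportional to a dual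
  norm of \<open>f\<close>.
\<close>

lemma pairing_increments:
  fixes u v w :: "real \<Rightarrow> real \<Rightarrow> 'v::euclidean_space"
  assumes wd: "weak_dt T a b u v" "weak_dt T a b v w" and f: "f \<in> borel_measurable (ivl a b)" and T:
      "0 < T"
    and K: "K \<ge> 0"
      "AE t in ivl 0 T. (\<integral>\<^sup>+x. ennreal (norm (u t x) * norm (f x)) \<partial>ivl a b) \<le> ennreal K"
      "AE t in ivl 0 T. (\<integral>\<^sup>+x. ennreal (norm (v t x) * norm (f x)) \<partial>ivl a b) \<le> ennreal K"
      "AE t in ivl 0 T. (\<integral>\<^sup>+x. ennreal (norm (w t x) * norm (f x)) \<partial>ivl a b) \<le> ennreal K"
    and P: "continuous_on {0..T} P" "P = (\<lambda>t. \<integral>x. u t x \<bullet> f x \<partial>ivl a b)"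
  shows "0 \<le> s \<Longrightarrow> s \<le> t \<Longrightarrow> t \<le> T \<Longrightarrow> \<bar>P t - P s\<bar> \<le> K * (t - s)"
    "0 \<le> t - \<tau> \<Longrightarrow> 0 \<le> s \<Longrightarrow> s \<le> \<tau> \<Longrightarrow> 0 < \<tau> \<Longrightarrow> t + s \<le> T \<Longrightarrow>
      \<bar>P (t + s) - P t - (s / \<tau>) * (P t - P (t - \<tau>))\<bar> \<le> 4 * K * \<tau>\<^sup>2"
proof -
  note p1 = weak_dt_pairing[OF wd(1) f T K(2,3)]
  note p2 = weak_dt_pairing[OF wd(2) f T K(3,4)]
  have m: "max K 0 = K" using K by simp
  show "0 \<le> s \<Longrightarrow> s \<le> t \<Longrightarrow> t \<le> T \<Longrightarrow> \<bar>P t - P s\<bar> \<le> K * (t - s)"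
    by (rule weak_deriv_1_Lipschitz[of 0 T]) (use p1 P m in auto)
  have "weak_deriv 0 T 2 P (\<lambda>t. \<integral>x. w t x \<bullet> f x \<partial>ivl a b)"
    unfolding P(2) by (rule weak_deriv_compose[OF p1(1) p2(1)])
  thus "0 \<le> t - \<tau> \<Longrightarrow> 0 \<le> s \<Longrightarrow> s \<le> \<tau> \<Longrightarrow> 0 < \<tau> \<Longrightarrow> t + s \<le> T \<Longrightarrow>
      \<bar>P (t + s) - P t - (s / \<tau>) * (P t - P (t - \<tau>))\<bar> \<le> 4 * K * \<tau>\<^sup>2"
    by (rule weak_deriv_2_extrapolation[OF _ P(1) p2(2)]) (use p2(3) K m in auto)
qed

lemma time_continuous_l2:
  fixes u :: "real \<Rightarrow> real \<Rightarrow> 'v::euclidean_space"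
  assumes c: "time_continuous T (L2_norm a b) u" and t: "t \<in> {0..T}"
  shows "sqint a b (u t)" "((\<lambda>s. l2 a b (\<lambda>x. u s x - u t x)) \<longlongrightarrow> 0) (at t within {0..T})"
proof -
  have s: "sqint a b (u t)" if "t \<in> {0..T}" for t
    using c that by (auto simp: time_continuous_def L2_norm_less_top)
  show "sqint a b (u t)" by (rule s[OF t])
  have "((\<lambda>s. L2_norm a b (\<lambda>x. u s x - u t x)) \<longlongrightarrow> 0) (at t within {0..T})"
    using c t by (auto simp: time_continuous_def)
  moreover have "eventually (\<lambda>s. L2_norm a b (\<lambda>x. u s x - u t x) = ennreal (l2 a b (\<lambda>x. u s x - u t
      x))) (at t within {0..T})"
    unfolding eventually_at_filter
    by (intro always_eventually allI impI) (simp add: L2_norm_eq sqint_diff[OF s s[OF t]])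
  ultimately have "((\<lambda>s. ennreal (l2 a b (\<lambda>x. u s x - u t x))) \<longlongrightarrow> ennreal 0) (at t within {0..T})"
    by (simp add: tendsto_cong)
  thus "((\<lambda>s. l2 a b (\<lambda>x. u s x - u t x)) \<longlongrightarrow> 0) (at t within {0..T})"
    by (subst (asm) tendsto_ennreal_iff) (auto simp: l2_nonneg)
qed

lemma nn_integral_l2_bound:
  assumes "sqint a b u" "sqint a b d"
  shows "(\<integral>\<^sup>+x. ennreal (norm (u x) * norm (d x)) \<partial>ivl a b) \<le> ennreal (l2 a b u * l2 a b d)"
proof -
  have i: "integrable (ivl a b) (\<lambda>x. norm (u x) * norm (d x))"
    using integrable_inner_sqint[OF sqint_norm[OF assms(1)] sqint_norm[OF assms(2)]] by simp
  have "(\<integral>\<^sup>+x. ennreal (norm (u x) * norm (d x)) \<partial>ivl a b) = ennreal (\<integral>x. norm (u x) * norm (d x)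
      \<partial>ivl a b)"
    by (rule nn_integral_eq_integral[OF i]) auto
  also have "\<dots> \<le> ennreal (l2 a b u * l2 a b d)"
    using l2_Cauchy_Schwarz[OF sqint_norm[OF assms(1)] sqint_norm[OF assms(2)]]
    by (intro ennreal_leI) (simp add: l2_norm)
  finally show ?thesis .
qed

lemma nn_integral_l2_bound_AE:
  fixes z :: "real \<Rightarrow> real \<Rightarrow> 'v::euclidean_space"
  assumes "M \<ge> 0" and d: "sqint a b d" and z: "AE t in ivl 0 T. L2_norm a b (z t) \<le> ennreal M"
  shows "AE t in ivl 0 T. (\<integral>\<^sup>+x. ennreal (norm (z t x) * norm (d x)) \<partial>ivl a b) \<le> ennreal (M * l2 a b d)"
  using z
proof eventually_elim
  case (elim t)
  hence "sqint a b (z t)" "l2 a b (z t) \<le> M" using assms(1) by (auto simp: L2_norm_le_ennreal)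
  thus ?case
    by (intro order_trans[OF nn_integral_l2_bound[OF _ d]] ennreal_leI mult_right_mono l2_nonneg)
qed

text \<open>
  Duality: the pairing with \<open>f\<close> is controlled by \<open>M\<close> times the norm of \<open>f\<close>. Taking for \<open>f\<close> the
  very increment (or extrapolation error) to be estimated, at fixed times, makes the left side
  the square of its norm.
\<close>

lemma l2_time_increments:
  fixes u v w :: "real \<Rightarrow> real \<Rightarrow> 'v::euclidean_space"
  assumes wd: "weak_dt T a b u v" "weak_dt T a b v w" and T: "0 < T" and M: "M \<ge> 0"
    and b: "AE t in ivl 0 T. L2_norm a b (u t) \<le> ennreal M" "AE t in ivl 0 T. L2_norm a b (v t) \<le>
        ennreal M"
      "AE t in ivl 0 T. L2_norm a b (w t) \<le> ennreal M"
    and c: "time_continuous T (L2_norm a b) u"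
  shows "0 \<le> s \<Longrightarrow> s \<le> t \<Longrightarrow> t \<le> T \<Longrightarrow> l2 a b (\<lambda>x. u t x - u s x) \<le> M * (t - s)"
    "0 \<le> t - \<tau> \<Longrightarrow> 0 \<le> s \<Longrightarrow> s \<le> \<tau> \<Longrightarrow> 0 < \<tau> \<Longrightarrow> t + s \<le> T \<Longrightarrow>
      l2 a b (\<lambda>x. u (t + s) x - u t x - (s / \<tau>) *\<^sub>R (u t x - u (t - \<tau>) x)) \<le> 4 * M * \<tau>\<^sup>2"
proof -
  note sq = time_continuous_l2(1)[OF c]
  note nn = nn_integral_l2_bound_AE[OF M]
  have cont: "continuous_on {0..T} (\<lambda>t. \<integral>x. u t x \<bullet> d x \<partial>ivl a b)" if d: "sqint a b d" for d ::
      "real \<Rightarrow> 'v"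
    unfolding continuous_on_def
  proof
    fix t assume t: "t \<in> {0..T}"
    have "((\<lambda>s. l2 a b (\<lambda>x. u s x - u t x) * l2 a b d) \<longlongrightarrow> 0 * l2 a b d) (at t within {0..T})"
      by (intro tendsto_intros time_continuous_l2(2)[OF c t])
    hence l: "((\<lambda>s. l2 a b (\<lambda>x. u s x - u t x) * l2 a b d) \<longlongrightarrow> 0) (at t within {0..T})" by simp
    have "((\<lambda>s. (\<integral>x. u s x \<bullet> d x \<partial>ivl a b) - (\<integral>x. u t x \<bullet> d x \<partial>ivl a b)) \<longlongrightarrow> 0) (at t within {0..T})"
    proof (rule Lim_null_comparison[OF _ l])
      show "\<forall>\<^sub>F s in at t within {0..T}. norm ((\<integral>x. u s x \<bullet> d x \<partial>ivl a b) - (\<integral>x. u t x \<bullet> d x \<partial>ivl a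
          b)) \<le> l2 a b (\<lambda>x. u s x - u t x) * l2 a b d"
        unfolding eventually_at_filter
      proof (intro always_eventually allI impI)
        fix s assume s: "s \<in> {0..T}"
        have "(\<integral>x. u s x \<bullet> d x \<partial>ivl a b) - (\<integral>x. u t x \<bullet> d x \<partial>ivl a b) = (\<integral>x. (u s x - u t x) \<bullet> d x
            \<partial>ivl a b)"
          using integrable_inner_sqint[OF sq[OF s] d] integrable_inner_sqint[OF sq[OF t] d] by (simp
              add: inner_diff_left)
        thus "norm ((\<integral>x. u s x \<bullet> d x \<partial>ivl a b) - (\<integral>x. u t x \<bullet> d x \<partial>ivl a b)) \<le> l2 a b (\<lambda>x. u s x - u
            t x) * l2 a b d"
          using l2_Cauchy_Schwarz[OF sqint_diff[OF sq[OF s] sq[OF t]] d] by simp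
      qed
    qed
    thus "((\<lambda>t. \<integral>x. u t x \<bullet> d x \<partial>ivl a b) \<longlongrightarrow> (\<integral>x. u t x \<bullet> d x \<partial>ivl a b)) (at t within {0..T})"
      by (rule LIM_zero_cancel)
  qed
  \<comment> \<open>Cancels one factor of the norm, also if it vanishes.\<close>
  have fin: "l2 a b d \<le> L" if "l2 a b d * l2 a b d \<le> L * l2 a b d" "L \<ge> 0" for L and d :: "real \<Rightarrow> 'v"
    using that l2_nonneg[of a b d] by (cases "l2 a b d = 0") auto
  have inc: "sqint a b d \<Longrightarrow> 0 \<le> s \<Longrightarrow> s \<le> t \<Longrightarrow> t \<le> T \<Longrightarrow>
      \<bar>(\<integral>x. u t x \<bullet> d x \<partial>ivl a b) - (\<integral>x. u s x \<bullet> d x \<partial>ivl a b)\<bar> \<le> (M * l2 a b d) * (t - s)" for d s t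
    by (rule pairing_increments(1)[OF wd _ T _ nn[OF _ b(1)] nn[OF _ b(2)] nn[OF _ b(3)] cont refl,
        of d])
      (use M in \<open>auto simp: sqint_def l2_nonneg\<close>)
  have ext: "sqint a b d \<Longrightarrow> 0 \<le> t - \<tau> \<Longrightarrow> 0 \<le> s \<Longrightarrow> s \<le> \<tau> \<Longrightarrow> 0 < \<tau> \<Longrightarrow> t + s \<le> T \<Longrightarrow>
      \<bar>(\<integral>x. u (t + s) x \<bullet> d x \<partial>ivl a b) - (\<integral>x. u t x \<bullet> d x \<partial>ivl a b)
        - (s / \<tau>) * ((\<integral>x. u t x \<bullet> d x \<partial>ivl a b) - (\<integral>x. u (t - \<tau>) x \<bullet> d x \<partial>ivl a b))\<bar> \<le> 4 * (M * l2 a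
            b d) * \<tau>\<^sup>2" for d s t \<tau>
    by (rule pairing_increments(2)[OF wd _ T _ nn[OF _ b(1)] nn[OF _ b(2)] nn[OF _ b(3)] cont refl,
        of d])
      (use M in \<open>auto simp: sqint_def l2_nonneg\<close>)
  show "l2 a b (\<lambda>x. u t x - u s x) \<le> M * (t - s)" if st: "0 \<le> s" "s \<le> t" "t \<le> T"
  proof -
    define d where "d = (\<lambda>x. u t x - u s x)"
    have s1: "sqint a b (u t)" "sqint a b (u s)" using st by (auto intro: sq)
    have d: "sqint a b d" unfolding d_def by (intro sqint_diff s1)
    have "(\<integral>x. u t x \<bullet> d x \<partial>ivl a b) - (\<integral>x. u s x \<bullet> d x \<partial>ivl a b) = (\<integral>x. (u t x - u s x) \<bullet> d x \<partial>ivl a b)"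
      using integrable_inner_sqint[OF s1(1) d] integrable_inner_sqint[OF s1(2) d] by (simp add:
          inner_diff_left)
    also have "\<dots> = l2 a b d * l2 a b d"
      by (simp add: power2_eq_square[symmetric] l2_sq power2_norm_eq_inner d_def)
    finally have "l2 a b d * l2 a b d \<le> (M * (t - s)) * l2 a b d"
      using inc[OF d st] by (simp add: mult_ac)
    thus ?thesis unfolding d_def[symmetric] by (rule fin) (use M st in auto)
  qed
  show "l2 a b (\<lambda>x. u (t + s) x - u t x - (s / \<tau>) *\<^sub>R (u t x - u (t - \<tau>) x)) \<le> 4 * M * \<tau>\<^sup>2"
    if st: "0 \<le> t - \<tau>" "0 \<le> s" "s \<le> \<tau>" "0 < \<tau>" "t + s \<le> T"
  proof -
    define d where "d = (\<lambda>x. u (t + s) x - u t x - (s / \<tau>) *\<^sub>R (u t x - u (t - \<tau>) x))"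
    have s1: "sqint a b (u (t + s))" "sqint a b (u t)" "sqint a b (u (t - \<tau>))" using st by (auto
        intro!: sq)
    have d: "sqint a b d" unfolding d_def by (intro sqint_diff sqint_scaleR s1)
    note ii = integrable_inner_sqint[OF s1(1) d] integrable_inner_sqint[OF s1(2) d]
        integrable_inner_sqint[OF s1(3) d]
    have "(\<integral>x. u (t + s) x \<bullet> d x \<partial>ivl a b) - (\<integral>x. u t x \<bullet> d x \<partial>ivl a b)
        - (s / \<tau>) * ((\<integral>x. u t x \<bullet> d x \<partial>ivl a b) - (\<integral>x. u (t - \<tau>) x \<bullet> d x \<partial>ivl a b))
      = (\<integral>x. u (t + s) x \<bullet> d x - u t x \<bullet> d x - (s / \<tau>) * (u t x \<bullet> d x - u (t - \<tau>) x \<bullet> d x) \<partial>ivl a b)"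
      using ii by (simp del: times_divide_eq_left)
    also have "\<dots> = (\<integral>x. d x \<bullet> d x \<partial>ivl a b)"
      by (rule Bochner_Integration.integral_cong[OF refl]) (simp add: d_def[THEN fun_cong]
          inner_diff_left)
    also have "\<dots> = l2 a b d * l2 a b d"
      by (simp add: power2_eq_square[symmetric] l2_sq power2_norm_eq_inner)
    finally have "l2 a b d * l2 a b d \<le> (4 * M * \<tau>\<^sup>2) * l2 a b d"
      using ext[OF d st] by (simp add: mult_ac)
    thus ?thesis unfolding d_def[symmetric] by (rule fin) (use M st in auto)
  qed
qed

text \<open>
  The dual argument for the supremum norm: \<open>f\<close> is the sign of \<open>d\<close> where \<open>\<bar>d\<bar>\<close> exceeds \<open>L\<close>. There
  \<open>d f - L \<bar>f\<bar>\<close> is positive, and its integral is not, so that the set is null.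
\<close>

lemma AE_le_if_dual_bound:
  fixes d :: "real \<Rightarrow> real"
  assumes d: "sqint a b d" and f: "f = (\<lambda>x. if \<bar>d x\<bar> > L then sgn (d x) else 0)"
    and le: "(\<integral>x. d x * f x \<partial>ivl a b) \<le> L * (\<integral>x. \<bar>f x\<bar> \<partial>ivl a b)"
    and L: "L \<ge> 0"
  shows "AE x in ivl a b. \<bar>d x\<bar> \<le> L"
proof -
  have dm [measurable]: "d \<in> borel_measurable (ivl a b)" using d by (simp add: sqint_def)
  have fm: "f \<in> borel_measurable (ivl a b)" unfolding f by measurable
  have sf: "sqint a b f"
    by (rule sqint_bounded[OF fm, of 1]) (auto simp: f sgn_real_def)
  have i1: "integrable (ivl a b) (\<lambda>x. d x * f x)" using integrable_inner_sqint[OF d sf] by simp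
  have i2: "integrable (ivl a b) (\<lambda>x. \<bar>f x\<bar>)" using sqint_integrable[OF sf] by simp
  let ?g = "\<lambda>x. d x * f x - L * \<bar>f x\<bar>"
  have gi: "integrable (ivl a b) ?g" using i1 i2 by simp
  have g0: "0 \<le> ?g x" for x
    using L by (auto simp: f sgn_real_def abs_if)
  have "integral\<^sup>L (ivl a b) ?g \<le> 0" using i1 i2 le by simp
  moreover have "0 \<le> integral\<^sup>L (ivl a b) ?g" using g0 by (intro integral_nonneg_AE AE_I2)
  ultimately have "integral\<^sup>L (ivl a b) ?g = 0" by simp
  hence "AE x in ivl a b. ?g x = 0"
    using integral_nonneg_eq_0_iff_AE[OF gi] g0 by simp
  thus ?thesis
  proof eventually_elim
    case (elim x)
    thus ?case using L by (auto simp: f sgn_real_def abs_if split: if_splits)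
  qed
qed

lemma Linf_finite:
  assumes "Linf_norm a b u < top"
  obtains K where "K \<ge> 0" "Linf_norm a b u \<le> ennreal K"
  using assms by (cases "Linf_norm a b u") auto

lemma time_continuous_Linf:
  fixes u :: "real \<Rightarrow> real \<Rightarrow> real"
  assumes c: "time_continuous T (Linf_norm a b) u" and t: "t \<in> {0..T}"
  shows "u t \<in> borel_measurable (ivl a b)" "sqint a b (u t)"
    "e > 0 \<Longrightarrow> eventually (\<lambda>s. AE x in ivl a b. \<bar>u s x - u t x\<bar> \<le> e) (at t within {0..T})"
proof -
  obtain K where K: "K \<ge> 0" "Linf_norm a b (u t) \<le> ennreal K"
  proof (rule Linf_finite)
    show "Linf_norm a b (u t) < top" using c t by (auto simp: time_continuous_def)
  qed
  show m: "u t \<in> borel_measurable (ivl a b)" by (rule Linf_norm_AE(1)[OF K(2,1)])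
  show "sqint a b (u t)" by (rule sqint_bounded[OF m Linf_norm_AE(2)[OF K(2,1)]])
  assume e: "e > 0"
  have "((\<lambda>s. Linf_norm a b (\<lambda>x. u s x - u t x)) \<longlongrightarrow> 0) (at t within {0..T})"
    using c t by (auto simp: time_continuous_def)
  hence "eventually (\<lambda>s. Linf_norm a b (\<lambda>x. u s x - u t x) < ennreal e) (at t within {0..T})"
    by (rule order_tendstoD) (use e in simp)
  thus "eventually (\<lambda>s. AE x in ivl a b. \<bar>u s x - u t x\<bar> \<le> e) (at t within {0..T})"
  proof eventually_elim
    case (elim s)
    have "AE x in ivl a b. norm (u s x - u t x) \<le> e"
      by (rule Linf_norm_AE(2)[OF less_imp_le[OF elim]]) (use e in simp)
    thus ?case by simp
  qed
qed

lemma Linf_time_bound: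
  fixes u :: "real \<Rightarrow> real \<Rightarrow> real"
  assumes c: "time_continuous T (Linf_norm a b) u" and T: "0 < T" and M: "M \<ge> 0"
    and b: "AE t in ivl 0 T. Linf_norm a b (u t) \<le> ennreal M" and t: "t \<in> {0..T}"
  shows "AE x in ivl a b. \<bar>u t x\<bar> \<le> M"
proof -
  have "AE x in ivl a b. \<bar>u t x\<bar> \<le> M + 1 / real (Suc n)" for n
  proof -
    define e where "e = 1 / real (Suc n)"
    have e: "e > 0" by (simp add: e_def)
    obtain d where d: "d > 0" "\<And>s. s \<in> {0..T} \<Longrightarrow> s \<noteq> t \<Longrightarrow> dist s t < d \<Longrightarrow> AE x in ivl a b. \<bar>u s x - u t
        x\<bar> \<le> e"
      using time_continuous_Linf(3)[OF c t e] unfolding eventually_at by blast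
    obtain s where s: "s \<in> {0<..<T}" "\<bar>s - t\<bar> < d" "Linf_norm a b (u s) \<le> ennreal M"
      using AE_ivl_near[OF b T t d(1)] by blast
    have a1: "AE x in ivl a b. \<bar>u s x - u t x\<bar> \<le> e"
    proof (cases "s = t")
      case True thus ?thesis using e by simp
    next
      case False
      show ?thesis by (rule d(2)) (use s False in \<open>auto simp: dist_real_def\<close>)
    qed
    have a2: "AE x in ivl a b. \<bar>u s x\<bar> \<le> M" using Linf_norm_AE(2)[OF s(3) M] by simp
    from a1 a2 show ?thesis unfolding e_def[symmetric] by eventually_elim linarith
  qed
  hence "AE x in ivl a b. \<forall>n. \<bar>u t x\<bar> \<le> M + 1 / real (Suc n)" by (subst AE_all_countable) blast
  thus ?thesis
  proof eventually_elim
    case (elim x)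
    have "(\<lambda>n. M + inverse (real (Suc n))) \<longlonglongrightarrow> M + 0"
      by (intro tendsto_intros LIMSEQ_inverse_real_of_nat)
    thus ?case using elim by (intro LIMSEQ_le_const[of "\<lambda>n. M + inverse (real (Suc n))"]) (auto
        simp: inverse_eq_divide)
  qed
qed

text \<open>
  The analogue of the bounds in the mean square, with the pairing between \<open>L\<^sup>1\<close> and \<open>L\<^sup>\<infinity>\<close>: only
  the integral of \<open>\<bar>f\<bar>\<close> enters the bound.
\<close>

lemma Linf_time_increments:
  fixes u v w :: "real \<Rightarrow> real \<Rightarrow> real"
  assumes wd: "weak_dt T a b u v" "weak_dt T a b v w" and T: "0 < T" and M: "M \<ge> 0"
    and b: "AE t in ivl 0 T. Linf_norm a b (u t) \<le> ennreal M" "AE t in ivl 0 T. Linf_norm a b (v t)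
        \<le> ennreal M"
      "AE t in ivl 0 T. Linf_norm a b (w t) \<le> ennreal M"
    and c: "time_continuous T (Linf_norm a b) u"
  shows "0 \<le> s \<Longrightarrow> s \<le> t \<Longrightarrow> t \<le> T \<Longrightarrow> AE x in ivl a b. \<bar>u t x - u s x\<bar> \<le> M * (t - s)"
    "0 \<le> t - \<tau> \<Longrightarrow> 0 \<le> s \<Longrightarrow> s \<le> \<tau> \<Longrightarrow> 0 < \<tau> \<Longrightarrow> t + s \<le> T \<Longrightarrow>
      AE x in ivl a b. \<bar>u (t + s) x - u t x - (s / \<tau>) * (u t x - u (t - \<tau>) x)\<bar> \<le> 4 * M * \<tau>\<^sup>2"
proof -
  note sq = time_continuous_Linf(2)[OF c]
  have nn: "AE t in ivl 0 T. (\<integral>\<^sup>+x. ennreal (norm (z t x) * norm (f x)) \<partial>ivl a b) \<le> ennreal (M *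
      (\<integral>x. \<bar>f x\<bar> \<partial>ivl a b))"
    if z: "AE t in ivl 0 T. Linf_norm a b (z t) \<le> ennreal M" and f: "sqint a b f" for z :: "real \<Rightarrow>
        real \<Rightarrow> real" and f :: "real \<Rightarrow> real"
    using z
  proof eventually_elim
    case (elim t)
    have i: "integrable (ivl a b) (\<lambda>x. M * \<bar>f x\<bar>)" using sqint_integrable[OF f] by simp
    have "AE x in ivl a b. norm (z t x) \<le> M" by (rule Linf_norm_AE(2)[OF elim M])
    hence "(\<integral>\<^sup>+x. ennreal (norm (z t x) * norm (f x)) \<partial>ivl a b) \<le> (\<integral>\<^sup>+x. ennreal (M * \<bar>f x\<bar>) \<partial>ivl a b)"
      by (intro nn_integral_mono_AE) (auto elim!: eventually_mono intro!: ennreal_leI mult_right_mono)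
    also have "\<dots> = ennreal (\<integral>x. M * \<bar>f x\<bar> \<partial>ivl a b)"
      using M by (intro nn_integral_eq_integral[OF i]) auto
    finally show ?case by simp
  qed
  have cont: "continuous_on {0..T} (\<lambda>t. \<integral>x. u t x \<bullet> f x \<partial>ivl a b)" if f: "sqint a b f" for f ::
      "real \<Rightarrow> real"
    unfolding continuous_on_def
  proof (intro ballI tendstoI)
    fix t e assume t: "t \<in> {0..T}" and e: "(e::real) > 0"
    let ?F = "\<integral>x. \<bar>f x\<bar> \<partial>ivl a b"
    have F: "?F \<ge> 0" by (intro integral_nonneg_AE AE_I2) simp
    define e' where "e' = e / (?F + 1)"
    have e': "e' > 0" "e' * ?F < e"
    proof -
      show "e' > 0" unfolding e'_def using e F by (intro divide_pos_pos) linarith+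
      have "e' * ?F < e' * (?F + 1)" using \<open>e' > 0\<close> by simp
      also have "\<dots> = e" unfolding e'_def using F by (intro nonzero_eq_divide_eq[THEN iffD1]) linarith+
      finally show "e' * ?F < e" .
    qed
    have ev: "eventually (\<lambda>s. s \<in> {0..T}) (at t within {0..T})" by (simp add: eventually_at_filter)
    show "eventually (\<lambda>s. dist (\<integral>x. u s x \<bullet> f x \<partial>ivl a b) (\<integral>x. u t x \<bullet> f x \<partial>ivl a b) < e) (at t
        within {0..T})"
      using time_continuous_Linf(3)[OF c t e'(1)] ev
    proof eventually_elim
      case (elim s)
      have i: "integrable (ivl a b) (\<lambda>x. (u s x - u t x) * f x)"
        using integrable_inner_sqint[OF sqint_diff[OF sq[OF elim(2)] sq[OF t]] f] by simp
      have fi: "integrable (ivl a b) (\<lambda>x. \<bar>f x\<bar>)" using sqint_integrable[OF f] by simp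
      have "(\<integral>x. u s x \<bullet> f x \<partial>ivl a b) - (\<integral>x. u t x \<bullet> f x \<partial>ivl a b) = (\<integral>x. (u s x - u t x) * f x
          \<partial>ivl a b)"
        using integrable_inner_sqint[OF sq[OF elim(2)] f] integrable_inner_sqint[OF sq[OF t] f] by
            (simp add: left_diff_distrib)
      also have "\<bar>\<dots>\<bar> \<le> (\<integral>x. \<bar>(u s x - u t x) * f x\<bar> \<partial>ivl a b)" by (rule integral_abs_bound)
      also have "\<dots> \<le> (\<integral>x. e' * \<bar>f x\<bar> \<partial>ivl a b)"
      proof (rule integral_mono_AE)
        show "integrable (ivl a b) (\<lambda>x. \<bar>(u s x - u t x) * f x\<bar>)" using i by (rule integrable_abs)
        show "integrable (ivl a b) (\<lambda>x. e' * \<bar>f x\<bar>)" using fi by simp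
        show "AE x in ivl a b. \<bar>(u s x - u t x) * f x\<bar> \<le> e' * \<bar>f x\<bar>"
          using elim(1) by eventually_elim (simp add: abs_mult mult_right_mono)
      qed
      also have "\<dots> = e' * ?F" by simp
      finally show ?case using e' by (simp add: dist_real_def)
    qed
  qed
  have abs1: "(\<integral>x. \<bar>f x\<bar> \<partial>ivl a b) \<ge> 0" for f :: "real \<Rightarrow> real" by (intro integral_nonneg_AE AE_I2) simp
  have inc: "sqint a b f \<Longrightarrow> 0 \<le> s \<Longrightarrow> s \<le> t \<Longrightarrow> t \<le> T \<Longrightarrow>
      \<bar>(\<integral>x. u t x \<bullet> f x \<partial>ivl a b) - (\<integral>x. u s x \<bullet> f x \<partial>ivl a b)\<bar> \<le> (M * (\<integral>x. \<bar>f x\<bar> \<partial>ivl a b)) * (t -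
          s)" for f s t
    by (rule pairing_increments(1)[OF wd _ T _ nn[OF b(1)] nn[OF b(2)] nn[OF b(3)] cont refl, of f])
      (use M abs1 in \<open>auto simp: sqint_def\<close>)
  have ext: "sqint a b f \<Longrightarrow> 0 \<le> t - \<tau> \<Longrightarrow> 0 \<le> s \<Longrightarrow> s \<le> \<tau> \<Longrightarrow> 0 < \<tau> \<Longrightarrow> t + s \<le> T \<Longrightarrow>
      \<bar>(\<integral>x. u (t + s) x \<bullet> f x \<partial>ivl a b) - (\<integral>x. u t x \<bullet> f x \<partial>ivl a b)
        - (s / \<tau>) * ((\<integral>x. u t x \<bullet> f x \<partial>ivl a b) - (\<integral>x. u (t - \<tau>) x \<bullet> f x \<partial>ivl a b))\<bar> \<le> 4 * (M * (\<integral>x.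
            \<bar>f x\<bar> \<partial>ivl a b)) * \<tau>\<^sup>2" for f s t \<tau>
    by (rule pairing_increments(2)[OF wd _ T _ nn[OF b(1)] nn[OF b(2)] nn[OF b(3)] cont refl, of f])
      (use M abs1 in \<open>auto simp: sqint_def\<close>)
  have sf: "sqint a b (\<lambda>x. if \<bar>d x\<bar> > L then sgn (d x) else 0)" if d: "sqint a b d" for d :: "real \<Rightarrow>
      real" and L
  proof (rule sqint_bounded[of _ _ _ 1])
    have [measurable]: "d \<in> borel_measurable (ivl a b)" using d by (simp add: sqint_def)
    show "(\<lambda>x. if \<bar>d x\<bar> > L then sgn (d x) else 0) \<in> borel_measurable (ivl a b)" by measurable
  qed (auto simp: sgn_real_def)
  show "AE x in ivl a b. \<bar>u t x - u s x\<bar> \<le> M * (t - s)" if st: "0 \<le> s" "s \<le> t" "t \<le> T"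
  proof -
    define d where "d = (\<lambda>x. u t x - u s x)"
    define L where "L = M * (t - s)"
    define f where "f = (\<lambda>x. if \<bar>d x\<bar> > L then sgn (d x) else 0)"
    have s1: "sqint a b (u t)" "sqint a b (u s)" using st by (auto intro: sq)
    have d: "sqint a b d" unfolding d_def by (intro sqint_diff s1)
    have f: "sqint a b f" unfolding f_def by (rule sf[OF d])
    have "(\<integral>x. d x * f x \<partial>ivl a b) = (\<integral>x. u t x \<bullet> f x \<partial>ivl a b) - (\<integral>x. u s x \<bullet> f x \<partial>ivl a b)"
      using integrable_inner_sqint[OF s1(1) f] integrable_inner_sqint[OF s1(2) f] by (simp add:
          d_def left_diff_distrib)
    also have "\<dots> \<le> L * (\<integral>x. \<bar>f x\<bar> \<partial>ivl a b)" using inc[OF f st] by (simp add: L_def mult_ac)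
    finally have "AE x in ivl a b. \<bar>d x\<bar> \<le> L"
      by (rule AE_le_if_dual_bound[OF d f_def]) (use M st in \<open>simp add: L_def\<close>)
    thus ?thesis by (simp add: d_def L_def)
  qed
  show "AE x in ivl a b. \<bar>u (t + s) x - u t x - (s / \<tau>) * (u t x - u (t - \<tau>) x)\<bar> \<le> 4 * M * \<tau>\<^sup>2"
    if st: "0 \<le> t - \<tau>" "0 \<le> s" "s \<le> \<tau>" "0 < \<tau>" "t + s \<le> T"
  proof -
    define d where "d = (\<lambda>x. u (t + s) x - u t x - (s / \<tau>) * (u t x - u (t - \<tau>) x))"
    define L where "L = 4 * M * \<tau>\<^sup>2"
    define f where "f = (\<lambda>x. if \<bar>d x\<bar> > L then sgn (d x) else 0)"
    have s1: "sqint a b (u (t + s))" "sqint a b (u t)" "sqint a b (u (t - \<tau>))" using st by (auto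
        intro!: sq)
    have d: "sqint a b d" unfolding d_def
      using sqint_diff[OF sqint_diff[OF s1(1,2)] sqint_scaleR[OF sqint_diff[OF s1(2,3)], of "s /
          \<tau>"]] by simp
    have f: "sqint a b f" unfolding f_def by (rule sf[OF d])
    note ii = integrable_inner_sqint[OF s1(1) f] integrable_inner_sqint[OF s1(2) f]
        integrable_inner_sqint[OF s1(3) f]
    have "(\<integral>x. d x * f x \<partial>ivl a b) = (\<integral>x. u (t + s) x \<bullet> f x - u t x \<bullet> f x - (s / \<tau>) * (u t x \<bullet> f x -
        u (t - \<tau>) x \<bullet> f x) \<partial>ivl a b)"
      by (rule Bochner_Integration.integral_cong[OF refl]) (simp add: d_def left_diff_distrib
          right_diff_distrib)
    also have "\<dots> = (\<integral>x. u (t + s) x \<bullet> f x \<partial>ivl a b) - (\<integral>x. u t x \<bullet> f x \<partial>ivl a b)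
        - (s / \<tau>) * ((\<integral>x. u t x \<bullet> f x \<partial>ivl a b) - (\<integral>x. u (t - \<tau>) x \<bullet> f x \<partial>ivl a b))"
      using ii by (simp del: times_divide_eq_left)
    also have "\<dots> \<le> L * (\<integral>x. \<bar>f x\<bar> \<partial>ivl a b)" using ext[OF f st] by (simp add: L_def mult_ac)
    finally have "AE x in ivl a b. \<bar>d x\<bar> \<le> L"
      by (rule AE_le_if_dual_bound[OF d f_def]) (use M st in \<open>simp add: L_def\<close>)
    thus ?thesis by (simp add: d_def L_def)
  qed
qed

section \<open>Extrapolation error of a product\<close>

lemma sqint_mult:
  fixes u :: "real \<Rightarrow> 'v::euclidean_space"
  assumes u: "sqint a b u" and w: "w \<in> borel_measurable (ivl a b)" "AE x in ivl a b. \<bar>w x\<bar> \<le> K" "K \<ge> 0"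
  shows "sqint a b (\<lambda>x. w x *\<^sub>R u x)" "l2 a b (\<lambda>x. w x *\<^sub>R u x) \<le> K * l2 a b u"
proof -
  have m: "(\<lambda>x. w x *\<^sub>R u x) \<in> borel_measurable (ivl a b)"
    using u w by (intro borel_measurable_scaleR) (auto simp: sqint_def)
  have ae: "AE x in ivl a b. norm (w x *\<^sub>R u x) \<le> K * norm (u x)"
    using w(2) by eventually_elim (auto intro: mult_right_mono)
  show s: "sqint a b (\<lambda>x. w x *\<^sub>R u x)" by (rule sqint_bound[OF u m ae])
  have "l2 a b (\<lambda>x. w x *\<^sub>R u x) \<le> l2 a b (\<lambda>x. K *\<^sub>R u x)"
    by (rule l2_mono_AE[OF sqint_scaleR[OF u] s]) (use ae w(3) in simp)
  thus "l2 a b (\<lambda>x. w x *\<^sub>R u x) \<le> K * l2 a b u" using w(3) by (simp add: l2_scaleR)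
qed

text \<open>
  Write \<open>Dp\<close>, \<open>Dv\<close> for the increments and \<open>R\<close>, \<open>Rv\<close> for the extrapolation errors of the factors.
  Then the error of the product is \<open>v2 R + Rv (p1 + \<theta> Dp) + (\<theta>\<^sup>2 + \<theta>) Dv Dp\<close>, so it is of order
  \<open>\<tau>\<^sup>2\<close> without a product rule for weak derivatives. The three terms contribute \<open>4\<close>, \<open>8\<close> and \<open>2\<close>
  to the constant.
\<close>

lemma product_extrapolation:
  fixes p0 p1 p2 :: "real \<Rightarrow> 'v::euclidean_space" and v0 v1 v2 :: "real \<Rightarrow> real"
  assumes p: "sqint a b p0" "sqint a b p1" "sqint a b p2"
    and v: "v0 \<in> borel_measurable (ivl a b)" "v1 \<in> borel_measurable (ivl a b)" "v2 \<in>
        borel_measurable (ivl a b)"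
    and \<theta>: "0 \<le> \<theta>" "\<theta> \<le> 1" and \<tau>: "0 \<le> \<tau>" "\<tau> \<le> 1" and M: "M \<ge> 0"
    and b2: "AE x in ivl a b. \<bar>v2 x\<bar> \<le> M" and bp: "l2 a b p1 \<le> M"
    and dv: "AE x in ivl a b. \<bar>v1 x - v0 x\<bar> \<le> M * \<tau>" and dp: "l2 a b (\<lambda>x. p1 x - p0 x) \<le> M * \<tau>"
    and ev: "AE x in ivl a b. \<bar>v2 x - v1 x - \<theta> * (v1 x - v0 x)\<bar> \<le> 4 * M * \<tau>\<^sup>2"
    and ep: "l2 a b (\<lambda>x. p2 x - p1 x - \<theta> *\<^sub>R (p1 x - p0 x)) \<le> 4 * M * \<tau>\<^sup>2"
  shows "l2 a b (\<lambda>x. v2 x *\<^sub>R p2 x - v1 x *\<^sub>R p1 x - \<theta> *\<^sub>R (v1 x *\<^sub>R p1 x - v0 x *\<^sub>R p0 x)) \<le> 14 *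
      M\<^sup>2 * \<tau>\<^sup>2"
proof -
  note [measurable] = v
  define R where "R = (\<lambda>x. p2 x - p1 x - \<theta> *\<^sub>R (p1 x - p0 x))"
  define D where "D = (\<lambda>x. p1 x - p0 x)"
  define Rv where "Rv = (\<lambda>x. v2 x - v1 x - \<theta> * (v1 x - v0 x))"
  define Dv where "Dv = (\<lambda>x. v1 x - v0 x)"
  define S where "S = (\<lambda>x. p1 x + \<theta> *\<^sub>R D x)"
  have sD: "sqint a b D" unfolding D_def by (intro sqint_diff p)
  have sR: "sqint a b R" unfolding R_def by (intro sqint_diff sqint_scaleR p)
  have sS: "sqint a b S" unfolding S_def by (intro sqint_add sqint_scaleR sD p)
  have mRv: "Rv \<in> borel_measurable (ivl a b)" unfolding Rv_def by measurable
  have mDv: "Dv \<in> borel_measurable (ivl a b)" unfolding Dv_def by measurable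
  have mT: "(\<lambda>x. (\<theta>\<^sup>2 + \<theta>) * Dv x) \<in> borel_measurable (ivl a b)" using mDv by measurable
  have t2: "\<theta>\<^sup>2 + \<theta> \<le> 2" using \<theta> by (simp add: power2_eq_square) (smt (verit) mult_left_le)
  have aT: "AE x in ivl a b. \<bar>(\<theta>\<^sup>2 + \<theta>) * Dv x\<bar> \<le> 2 * (M * \<tau>)"
    using dv
  proof eventually_elim
    case (elim x)
    have "(\<theta>\<^sup>2 + \<theta>) * \<bar>Dv x\<bar> \<le> 2 * (M * \<tau>)"
      using elim t2 M \<tau> \<theta> by (intro mult_mono) (auto simp: Dv_def)
    thus ?case using \<theta> by (simp add: abs_mult)
  qed
  have S: "l2 a b S \<le> 2 * M"
  proof -
    have "l2 a b S \<le> l2 a b p1 + \<theta> * l2 a b D"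
      unfolding S_def using l2_triangle[OF p(2) sqint_scaleR[OF sD, of \<theta>]] \<theta> by (simp add: l2_scaleR)
    also have "\<dots> \<le> M + 1 * (M * 1)"
      using dp M \<tau> \<theta> by (intro add_mono bp mult_mono order_trans[OF dp[folded D_def]]) (auto intro:
          mult_left_le simp: l2_nonneg)
    finally show ?thesis by simp
  qed
  have ev': "AE x in ivl a b. \<bar>Rv x\<bar> \<le> 4 * M * \<tau>\<^sup>2" using ev by (simp add: Rv_def)
  note c1 = sqint_mult[OF sR v(3) b2 M]
  note c2 = sqint_mult[OF sS mRv ev']
  note c3 = sqint_mult[OF sD mT aT]
  have nn: "0 \<le> 4 * M * \<tau>\<^sup>2" "0 \<le> 2 * (M * \<tau>)" using M \<tau> by auto
  have eq: "(\<lambda>x. v2 x *\<^sub>R p2 x - v1 x *\<^sub>R p1 x - \<theta> *\<^sub>R (v1 x *\<^sub>R p1 x - v0 x *\<^sub>R p0 x))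
      = (\<lambda>x. (v2 x *\<^sub>R R x + Rv x *\<^sub>R S x) + ((\<theta>\<^sup>2 + \<theta>) * Dv x) *\<^sub>R D x)"
    by (simp add: fun_eq_iff R_def Rv_def S_def D_def Dv_def algebra_simps power2_eq_square)
  have "l2 a b (\<lambda>x. v2 x *\<^sub>R p2 x - v1 x *\<^sub>R p1 x - \<theta> *\<^sub>R (v1 x *\<^sub>R p1 x - v0 x *\<^sub>R p0 x))
     \<le> l2 a b (\<lambda>x. v2 x *\<^sub>R R x) + l2 a b (\<lambda>x. Rv x *\<^sub>R S x) + l2 a b (\<lambda>x. ((\<theta>\<^sup>2 + \<theta>) * Dv x) *\<^sub>R D x)"
    unfolding eq
    by (rule order_trans[OF l2_triangle[OF sqint_add[OF c1(1) c2(1)[OF nn(1)]] c3(1)[OF nn(2)]]])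
       (intro add_right_mono l2_triangle c1 c2 nn)
  also have "\<dots> \<le> M * (4 * M * \<tau>\<^sup>2) + (4 * M * \<tau>\<^sup>2) * (2 * M) + 2 * (M * \<tau>) * (M * \<tau>)"
  proof (intro add_mono)
    show "l2 a b (\<lambda>x. v2 x *\<^sub>R R x) \<le> M * (4 * M * \<tau>\<^sup>2)"
      by (rule order_trans[OF c1(2)]) (intro mult_left_mono ep[folded R_def] M)
    show "l2 a b (\<lambda>x. Rv x *\<^sub>R S x) \<le> (4 * M * \<tau>\<^sup>2) * (2 * M)"
      by (rule order_trans[OF c2(2)[OF nn(1)]]) (intro mult_left_mono S nn)
    show "l2 a b (\<lambda>x. ((\<theta>\<^sup>2 + \<theta>) * Dv x) *\<^sub>R D x) \<le> 2 * (M * \<tau>) * (M * \<tau>)"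
      by (rule order_trans[OF c3(2)[OF nn(2)]]) (intro mult_left_mono dp[folded D_def] nn)
  qed
  also have "\<dots> = 14 * M\<^sup>2 * \<tau>\<^sup>2" by (simp add: power2_eq_square algebra_simps)
  finally show ?thesis .
qed

section \<open>The unitary group of the free Dirac operator\<close>

definition delta :: "real \<Rightarrow> real \<Rightarrow> int \<Rightarrow> real" where
  "delta a b l = sqrt (1 + (mu a b l)\<^sup>2)"

lemma delta: "delta a b l > 0" "(delta a b l)\<^sup>2 = 1 + (mu a b l)\<^sup>2"
  by (auto simp: delta_def add_pos_nonneg)

lemma Gam_entries: "Gam a b l $ 1 $ 1 = 1" "Gam a b l $ 1 $ 2 = of_real (mu a b l)"
  "Gam a b l $ 2 $ 1 = of_real (mu a b l)" "Gam a b l $ 2 $ 2 = -1"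
  by (simp_all add: Gam_def sigma1_def sigma3_def vector_2 scaleR_conv_of_real[where 'a=complex])

lemma Gam_vec: "(Gam a b l *v x) $ 1 = x $ 1 + of_real (mu a b l) * x $ 2"
  "(Gam a b l *v x) $ 2 = of_real (mu a b l) * x $ 1 - x $ 2"
  by (simp_all add: matrix_vector_mult_def sum_2 Gam_entries)

lemma Gam_Gam: "Gam a b l *v (Gam a b l *v x) = (of_real ((delta a b l)\<^sup>2)) *s x"
  unfolding delta(2) by (simp add: vec_eq_iff forall_2 Gam_vec algebra_simps power2_eq_square)

text \<open>
  The operator \<open>\<alpha> + \<beta> \<Gamma>\<^sub>l\<close>. As \<open>\<Gamma>\<^sub>l\<^sup>2 = \<delta>\<^sub>l\<^sup>2\<close>, these operators form a commutative algebra that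
  contains all matrices of the method, and matrix identities reduce to identities between two
  scalar coefficients.
\<close>

definition opG :: "real \<Rightarrow> real \<Rightarrow> int \<Rightarrow> complex \<Rightarrow> complex \<Rightarrow> complex^2 \<Rightarrow> complex^2" where
  "opG a b l \<alpha> \<beta> x = \<alpha> *s x + \<beta> *s (Gam a b l *v x)"

lemma Gam_smult: "Gam a b l *v (c *s x) = c *s (Gam a b l *v x)"
  by (rule vector_scalar_commute)

lemma opG_opG: "opG a b l \<alpha> \<beta> (opG a b l \<alpha>' \<beta>' x) =
    opG a b l (\<alpha> * \<alpha>' + \<beta> * \<beta>' * of_real ((delta a b l)\<^sup>2)) (\<alpha> * \<beta>' + \<beta> * \<alpha>') x"
  unfolding opG_def matrix_vector_right_distrib Gam_smult Gam_Gam
  by (simp add: vec_eq_iff algebra_simps)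

lemma opG_lin: "opG a b l \<alpha> \<beta> x + opG a b l \<alpha>' \<beta>' x = opG a b l (\<alpha> + \<alpha>') (\<beta> + \<beta>') x"
  "opG a b l \<alpha> \<beta> x - opG a b l \<alpha>' \<beta>' x = opG a b l (\<alpha> - \<alpha>') (\<beta> - \<beta>') x"
  "c *s opG a b l \<alpha> \<beta> x = opG a b l (c * \<alpha>) (c * \<beta>) x"
  "opG a b l \<alpha> \<beta> (c *s x) = opG a b l (c * \<alpha>) (c * \<beta>) x"
  "opG a b l \<alpha> \<beta> (x + y) = opG a b l \<alpha> \<beta> x + opG a b l \<alpha> \<beta> y"
  "opG a b l \<alpha> \<beta> (x - y) = opG a b l \<alpha> \<beta> x - opG a b l \<alpha> \<beta> y"
  unfolding opG_def matrix_vector_right_distrib matrix_vector_mult_diff_distrib Gam_smult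
  by (simp_all add: vec_eq_iff algebra_simps)

lemma opG_id: "opG a b l 1 0 x = x" by (simp add: opG_def)

lemma opG_Gam: "Gam a b l *v x = opG a b l 0 1 x" by (simp add: opG_def)

lemma mat_vec: "mat c *v x = c *s (x :: complex^2)"
  by (simp add: vec_eq_iff forall_2 matrix_vector_mult_def mat_def sum_2)

lemma opG_cong: "\<alpha> = \<alpha>' \<Longrightarrow> \<beta> = \<beta>' \<Longrightarrow> opG a b l \<alpha> \<beta> x = opG a b l \<alpha>' \<beta>' x"
  by simp

lemma delta_inverse: "inverse (complex_of_real (delta a b l)) * of_real (delta a b l) = 1"
  using delta(1)[of a b l] by simp

lemma matrix_eqI: "(\<And>x. A *v x = B *v x) \<Longrightarrow> A = (B :: complex^2^2)"
  by (intro matrix_eq[THEN iffD2] allI)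

lemma Gam_inv: "matrix_inv (Gam a b l) *v x = opG a b l 0 ((inverse (of_real (delta a b l)))\<^sup>2) x"
proof -
  let ?G = "Gam a b l"
  define D r where "D = complex_of_real (delta a b l)" and "r = inverse D"
  have rD: "r * D = 1" using delta_inverse by (simp add: r_def D_def)
  define I where "I = mat (r\<^sup>2) ** ?G"
  have Iv: "I *v x = opG a b l 0 (r\<^sup>2) x" for x
    by (simp add: I_def matrix_vector_mul_assoc[symmetric] mat_vec opG_def)
  have rD2: "r\<^sup>2 * D\<^sup>2 = 1" using rD by (simp add: power_mult_distrib[symmetric])
  have "(?G ** I) *v x = mat 1 *v x" "(I ** ?G) *v x = mat 1 *v x" for x
    unfolding matrix_vector_mul_assoc[symmetric] Iv opG_Gam opG_opG
    using rD2 by (simp_all add: D_def[symmetric] opG_id)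
  hence GI: "?G ** I = mat 1" "I ** ?G = mat 1" by (intro matrix_eqI; blast)+
  have "?G ** matrix_inv ?G = mat 1 \<and> matrix_inv ?G ** ?G = mat 1"
    unfolding matrix_inv_def by (rule someI[of _ I]) (simp add: GI)
  hence "matrix_inv ?G = I"
    using GI by (metis matrix_mul_assoc matrix_mul_lid matrix_mul_rid)
  thus ?thesis using Iv by (simp add: r_def D_def)
qed

lemma matrix_scaleR_left: "(r *\<^sub>R A) ** B = r *\<^sub>R (A ** (B :: complex^2^2))"
  by (simp add: vec_eq_iff matrix_matrix_mult_def scaleR_sum_right)
lemma matrix_scaleR_right: "A ** (r *\<^sub>R B) = r *\<^sub>R (A ** (B :: complex^2^2))"
  by (simp add: vec_eq_iff matrix_matrix_mult_def scaleR_sum_right)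

text \<open>
  A square root \<open>B\<close> of \<open>-1\<close> behaves like the imaginary unit: even and odd terms of the
  exponential series are those of cosine and sine.
\<close>

lemma mat_exp_rotation:
  assumes B: "B ** B = - mat 1"
  shows "mat_exp (y *\<^sub>R B) = cos y *\<^sub>R mat 1 + sin y *\<^sub>R B"
proof -
  have t: "(1 / fact n) *\<^sub>R (((**) (y *\<^sub>R B) ^^ n) (mat 1)) = (cos_coeff n *\<^sub>R y ^ n) *\<^sub>R mat 1 +
      (sin_coeff n *\<^sub>R y ^ n) *\<^sub>R B" for n
  proof (induction n)
    case 0 show ?case by (simp add: cos_coeff_def sin_coeff_def)
  next
    case (Suc n)
    have "(1 / fact (Suc n)) *\<^sub>R (((**) (y *\<^sub>R B) ^^ Suc n) (mat 1))
      = (1 / real (Suc n)) *\<^sub>R ((y *\<^sub>R B) ** ((1 / fact n) *\<^sub>R (((**) (y *\<^sub>R B) ^^ n) (mat 1))))"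
      by (simp add: matrix_scaleR_right)
    also have "\<dots> = (1 / real (Suc n)) *\<^sub>R ((cos_coeff n *\<^sub>R y ^ Suc n) *\<^sub>R B - (sin_coeff n *\<^sub>R y ^
        Suc n) *\<^sub>R mat 1)"
      unfolding Suc.IH by (simp add: matrix_add_ldistrib matrix_scaleR_left matrix_scaleR_right B
          mult_ac)
    also have "\<dots> = (cos_coeff (Suc n) *\<^sub>R y ^ Suc n) *\<^sub>R mat 1 + (sin_coeff (Suc n) *\<^sub>R y ^ Suc n) *\<^sub>R B"
      unfolding cos_coeff_Suc sin_coeff_Suc by (simp add: scaleR_diff_right del: of_nat_Suc power_Suc)
    finally show ?case .
  qed
  have "(\<lambda>n. (cos_coeff n *\<^sub>R y ^ n) *\<^sub>R mat 1 + (sin_coeff n *\<^sub>R y ^ n) *\<^sub>R B) sums (cos y *\<^sub>R mat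
      1 + sin y *\<^sub>R B)"
    by (intro sums_add sums_scaleR_left cos_converges sin_converges)
  thus ?thesis unfolding mat_exp_def t by (rule sums_unique[symmetric])
qed

lemma expGam_vec:
  "expGam a b \<tau> l *v x = opG a b l (of_real (cos (delta a b l * \<tau>)))
     (- \<i> * of_real (sin (delta a b l * \<tau>) * inverse (delta a b l))) x"
proof -
  let ?d = "delta a b l"
  define D r where "D = complex_of_real ?d" and "r = inverse D"
  have rD: "r * D = 1" using delta_inverse by (simp add: r_def D_def)
  define B where "B = mat (- \<i> * r) ** Gam a b l"
  have Bv: "B *v x = opG a b l 0 (- \<i> * r) x" for x
    by (simp add: B_def matrix_vector_mul_assoc[symmetric] mat_vec opG_def)
  have rD2: "- \<i> * r * (- \<i> * r) * D\<^sup>2 = -1"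
  proof -
    have "\<i> * \<i> = -1" by simp
    thus ?thesis using rD by algebra
  qed
  have "(B ** B) *v x = (- mat 1) *v x" for x
  proof -
    have "(B ** B) *v x = opG a b l (-1) 0 x"
      unfolding matrix_vector_mul_assoc[symmetric] Bv opG_opG using rD2 by (simp add: D_def[symmetric])
    also have "\<dots> = (- mat 1) *v x" by (simp add: opG_def vec_eq_iff forall_2 matrix_vector_mult_def
        mat_def sum_2)
    finally show ?thesis .
  qed
  hence BB: "B ** B = - mat 1" by (rule matrix_eqI)
  have sc: "(q *\<^sub>R A) *v z = of_real q *s (A *v z)" for q and A :: "complex^2^2" and z
    by (simp add: vec_eq_iff forall_2 matrix_vector_mult_def sum_2 scaleR_conv_of_real[where
        'a=complex] algebra_simps)
  have "(mat (- \<i> * of_real \<tau>) ** Gam a b l) *v z = ((?d * \<tau>) *\<^sub>R B) *v z" for z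
  proof -
    have "(D * of_real \<tau>) * (- \<i> * r) = - \<i> * of_real \<tau> * (r * D)" by simp
    also have "\<dots> = - \<i> * of_real \<tau>" unfolding rD by simp
    finally have e: "(D * of_real \<tau>) * (- \<i> * r) = - \<i> * of_real \<tau>" .
    show ?thesis
      unfolding sc Bv matrix_vector_mul_assoc[symmetric] mat_vec opG_Gam opG_lin(3) of_real_mult
          D_def[symmetric] e by simp
  qed
  hence "mat (- \<i> * of_real \<tau>) ** Gam a b l = (?d * \<tau>) *\<^sub>R B" by (rule matrix_eqI)
  hence "expGam a b \<tau> l = cos (?d * \<tau>) *\<^sub>R mat 1 + sin (?d * \<tau>) *\<^sub>R B"
    by (simp add: expGam_def mat_exp_rotation[OF BB])
  hence "expGam a b \<tau> l *v x = of_real (cos (?d * \<tau>)) *s x + of_real (sin (?d * \<tau>)) *s opG a b l 0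
      (- \<i> * r) x"
    by (simp add: matrix_vector_mult_add_rdistrib sc Bv)
  thus ?thesis by (simp add: opG_def r_def D_def mult_ac)
qed

lemma cos_sin_complex: "complex_of_real (sin y) * of_real (sin y) = 1 - of_real (cos y) * of_real
    (cos y)"
proof -
  have "sin y * sin y = 1 - cos y * cos y" using sin_cos_squared_add3[of y] by linarith
  thus ?thesis by (metis of_real_1 of_real_diff of_real_mult)
qed

lemma norm_expGam: "norm (expGam a b \<tau> l *v x) = norm x"
proof -
  let ?d = "delta a b l"
  define c s m where "c = cos (?d * \<tau>)" and "s = sin (?d * \<tau>) * inverse ?d" and "m = mu a b l"
  have "s * ?d = sin (?d * \<tau>)" using delta(1)[of a b l] by (simp add: s_def)
  hence "c\<^sup>2 + (s * ?d)\<^sup>2 = 1" by (simp add: c_def)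
  hence cs: "c\<^sup>2 + s\<^sup>2 * (1 + m\<^sup>2) = 1" by (simp add: power_mult_distrib delta(2) m_def)
  have n: "(norm y)\<^sup>2 = (Re (y $ 1))\<^sup>2 + (Im (y $ 1))\<^sup>2 + (Re (y $ 2))\<^sup>2 + (Im (y $ 2))\<^sup>2" for y ::
      "complex^2"
    unfolding power2_norm_eq_inner inner_vec_def inner_complex_def sum_2 by (simp add: power2_eq_square)
  have "(norm (expGam a b \<tau> l *v x))\<^sup>2 = (c\<^sup>2 + s\<^sup>2 * (1 + m\<^sup>2)) * (norm x)\<^sup>2"
    unfolding expGam_vec c_def[symmetric] s_def[symmetric] n opG_def
    by (simp add: Gam_vec m_def[symmetric] power2_eq_square algebra_simps)
  thus ?thesis using cs by simp
qed

lemma expGam_inverse: "expGam a b \<tau> l *v (expGam a b (- \<tau>) l *v x) = x"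
proof -
  let ?d = "delta a b l"
  define D r where "D = complex_of_real ?d" and "r = inverse D"
  have rD: "r * D = 1" using delta_inverse by (simp add: r_def D_def)
  define c s where "c = complex_of_real (cos (?d * \<tau>))" and "s = complex_of_real (sin (?d * \<tau>))"
  have cs: "s * s = 1 - c * c" unfolding c_def s_def by (rule cos_sin_complex)
  have E: "expGam a b \<tau> l *v y = opG a b l c (- \<i> * (s * r)) y" for y
    by (simp add: expGam_vec c_def s_def r_def D_def)
  have E': "expGam a b (- \<tau>) l *v y = opG a b l c (\<i> * (s * r)) y" for y
    by (simp add: expGam_vec c_def s_def r_def D_def)
  have "opG a b l (c * c + - \<i> * (s * r) * (\<i> * (s * r)) * D\<^sup>2) (c * (\<i> * (s * r)) + - \<i> * (s * r) *
      c) x = opG a b l 1 0 x"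
  proof (rule opG_cong)
    have "\<i> * \<i> = -1" by simp
    thus "c * c + - \<i> * (s * r) * (\<i> * (s * r)) * D\<^sup>2 = 1" using cs rD by algebra
  qed simp
  thus ?thesis unfolding E E' opG_opG by (simp add: D_def opG_id)
qed

lemma expGam_0: "expGam a b 0 l *v x = x"
  by (simp add: expGam_vec opG_id)

lemma opG_has_vector_derivative:
  assumes "(\<alpha> has_vector_derivative \<alpha>') (at s within S)" "(\<beta> has_vector_derivative \<beta>') (at s within S)"
    and z: "(z has_vector_derivative z') (at s within S)"
  shows "((\<lambda>s. opG a b l (\<alpha> s) (\<beta> s) (z s)) has_vector_derivative
     opG a b l \<alpha>' \<beta>' (z s) + opG a b l (\<alpha> s) (\<beta> s) z') (at s within S)"
proof -
  have G: "((\<lambda>s. Gam a b l *v z s) has_vector_derivative Gam a b l *v z') (at s within S)"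
    by (rule bounded_linear.has_vector_derivative[OF matrix_vector_mul_bounded_linear z])
  have "((\<lambda>s. \<alpha> s *s z s + \<beta> s *s (Gam a b l *v z s)) has_vector_derivative
     (\<alpha> s *s z' + \<alpha>' *s z s) + (\<beta> s *s (Gam a b l *v z') + \<beta>' *s (Gam a b l *v z s))) (at s within S)"
    by (intro has_vector_derivative_add smult.has_vector_derivative assms G)
  thus ?thesis by (simp add: opG_def algebra_simps)
qed

lemma of_real_deriv: "(f has_real_derivative D) (at s) \<Longrightarrow> ((\<lambda>s. complex_of_real (f s))
    has_vector_derivative of_real D) (at s within S)"
  using bounded_linear.has_vector_derivative[OF bounded_linear_of_real]
      has_real_derivative_iff_has_vector_derivative
    has_field_derivative_at_within by blast

text \<open>\<open>e\<^sup>i\<^sup>s\<^sup>\<Gamma>\<close> is the integrating factor for \<open>z' = -i \<Gamma> z\<close>.\<close>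

lemma expGam_derivative:
  assumes z: "(z has_vector_derivative z') (at s within S)"
  shows "((\<lambda>s. expGam a b (- s) l *v z s) has_vector_derivative
     expGam a b (- s) l *v (z' + \<i> *s (Gam a b l *v z s))) (at s within S)"
proof -
  let ?d = "delta a b l"
  have d: "?d \<noteq> 0" using delta(1)[of a b l] by simp
  define D r where "D = complex_of_real ?d" and "r = inverse D"
  have rD: "r * D = 1" using delta_inverse by (simp add: r_def D_def)
  define C Sn where "C = complex_of_real (cos (?d * - s))" and "Sn = complex_of_real (sin (?d * - s))"
  have E: "expGam a b (- s) l *v y = opG a b l C (- \<i> * (Sn * r)) y" for y
    by (simp add: expGam_vec C_def Sn_def r_def D_def)
  have "((\<lambda>s. opG a b l (of_real (cos (?d * - s))) (- \<i> * of_real (sin (?d * - s) * inverse ?d)) (z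
      s)) has_vector_derivative
     opG a b l (of_real (?d * sin (?d * - s))) (- \<i> * of_real (- cos (?d * - s))) (z s)
      + opG a b l (of_real (cos (?d * - s))) (- \<i> * of_real (sin (?d * - s) * inverse ?d)) z') (at s
          within S)"
  proof (intro opG_has_vector_derivative z has_vector_derivative_mult_right of_real_deriv)
    show "((\<lambda>s. cos (?d * - s)) has_real_derivative ?d * sin (?d * - s)) (at s)"
      by (auto intro!: derivative_eq_intros)
    show "((\<lambda>s. sin (?d * - s) * inverse ?d) has_real_derivative - cos (?d * - s)) (at s)"
      using d by (auto intro!: derivative_eq_intros)
  qed
  moreover have "opG a b l (of_real (?d * sin (?d * - s))) (- \<i> * of_real (- cos (?d * - s))) (z s)
      = opG a b l (D * Sn) (\<i> * C) (z s)"
    by (rule opG_cong) (simp_all add: D_def Sn_def C_def)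
  moreover have "opG a b l (D * Sn) (\<i> * C) (z s) = expGam a b (- s) l *v (\<i> *s (Gam a b l *v z s))"
    unfolding E opG_Gam opG_lin(3) opG_opG
  proof (rule opG_cong)
    have "\<i> * \<i> = -1" by simp
    hence "D * Sn = C * (\<i> * 0) + - \<i> * (Sn * r) * (\<i> * 1) * D\<^sup>2" using rD by algebra
    thus "D * Sn = C * (\<i> * 0) + - \<i> * (Sn * r) * (\<i> * 1) * complex_of_real (?d\<^sup>2)" by (simp only:
        D_def of_real_power)
  qed simp
  ultimately show ?thesis
    unfolding matrix_vector_right_distrib expGam_vec[symmetric] by (simp only: add.commute)
qed

section \<open>The numerical step as the exact flow of an affine forcing\<close>

text \<open>
  \<open>J1\<close> and \<open>J2\<close> are the integrals over \<open>[0,s]\<close> of \<open>e\<^sup>i\<^sup>r\<^sup>\<Gamma>\<close> and \<open>r e\<^sup>i\<^sup>r\<^sup>\<Gamma>\<close>. Multiplied by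
  \<open>e\<^sup>-\<^sup>i\<^sup>s\<^sup>\<Gamma>\<close> they become the matrices \<open>Q\<^sup>(\<^sup>1\<^sup>)(s)\<close> and \<open>Q\<^sup>(\<^sup>2\<^sup>)(s)\<close> of the method, so that a
  step of the method is the exact solution of the linear equation with a forcing that is affine
  in time.
\<close>

definition J1 :: "real \<Rightarrow> real \<Rightarrow> int \<Rightarrow> real \<Rightarrow> complex^2 \<Rightarrow> complex^2" where
  "J1 a b l s = (let d = delta a b l; r = inverse d in
     opG a b l (of_real (sin (d * s) * r)) (- \<i> * of_real ((cos (d * s) - 1) * r\<^sup>2)))"

definition J2 :: "real \<Rightarrow> real \<Rightarrow> int \<Rightarrow> real \<Rightarrow> complex^2 \<Rightarrow> complex^2" where
  "J2 a b l s = (let d = delta a b l; r = inverse d in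
     opG a b l (of_real (s * sin (d * s) * r + (cos (d * s) - 1) * r\<^sup>2))
       (\<i> * of_real (sin (d * s) * r ^ 3 - s * cos (d * s) * r\<^sup>2)))"

lemma J1_deriv: "((\<lambda>s. J1 a b l s g) has_vector_derivative expGam a b (- s) l *v g) (at s within S)"
proof -
  let ?d = "delta a b l"
  let ?r = "inverse ?d"
  have d: "?d \<noteq> 0" using delta(1)[of a b l] by simp
  have "((\<lambda>s. opG a b l (of_real (sin (?d * s) * ?r)) (- \<i> * of_real ((cos (?d * s) - 1) * ?r\<^sup>2)) g)
    has_vector_derivative
      opG a b l (of_real (cos (?d * s))) (- \<i> * of_real (- sin (?d * s) * ?r)) g
      + opG a b l (of_real (sin (?d * s) * ?r)) (- \<i> * of_real ((cos (?d * s) - 1) * ?r\<^sup>2)) 0) (at s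
          within S)"
  proof (intro opG_has_vector_derivative has_vector_derivative_const
      has_vector_derivative_mult_right of_real_deriv)
    show "((\<lambda>s. sin (?d * s) * ?r) has_real_derivative cos (?d * s)) (at s)"
      by (rule DERIV_cong[of _ "cos (?d * s) * ?d * ?r"]) (use d in \<open>auto intro!: derivative_eq_intros\<close>)
    show "((\<lambda>s. (cos (?d * s) - 1) * ?r\<^sup>2) has_real_derivative - sin (?d * s) * ?r) (at s)"
      by (rule DERIV_cong[of _ "- sin (?d * s) * ?d * ?r\<^sup>2"])
        (use d in \<open>auto intro!: derivative_eq_intros simp: power2_eq_square\<close>)
  qed
  thus ?thesis unfolding J1_def Let_def expGam_vec by (simp add: opG_def)
qed

lemma J2_deriv: "((\<lambda>s. J2 a b l s g) has_vector_derivative expGam a b (- s) l *v (s *\<^sub>R g)) (at s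
    within S)"
proof -
  let ?d = "delta a b l"
  let ?r = "inverse ?d"
  have d: "?d \<noteq> 0" using delta(1)[of a b l] by simp
  have rd: "?r * ?d = 1" using d by simp
  let ?\<alpha> = "\<lambda>s. s * sin (?d * s) * ?r + (cos (?d * s) - 1) * ?r\<^sup>2"
  let ?\<beta> = "\<lambda>s. sin (?d * s) * ?r ^ 3 - s * cos (?d * s) * ?r\<^sup>2"
  have "((\<lambda>s. opG a b l (of_real (?\<alpha> s)) (\<i> * of_real (?\<beta> s)) g)
    has_vector_derivative
      opG a b l (of_real (s * cos (?d * s))) (\<i> * of_real (s * sin (?d * s) * ?r)) g
      + opG a b l (of_real (?\<alpha> s)) (\<i> * of_real (?\<beta> s)) 0) (at s within S)"
  proof (intro opG_has_vector_derivative has_vector_derivative_const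
      has_vector_derivative_mult_right of_real_deriv)
    define q where "q = ?r"
    have q: "q * ?d = 1" using rd by (simp add: q_def)
    have "((\<lambda>s. s * sin (?d * s) * q + (cos (?d * s) - 1) * q\<^sup>2) has_real_derivative
        (sin (?d * s) + s * (cos (?d * s) * ?d)) * q - sin (?d * s) * ?d * q\<^sup>2) (at s)"
      by (auto intro!: derivative_eq_intros)
    moreover have "(sin (?d * s) + s * (cos (?d * s) * ?d)) * q - sin (?d * s) * ?d * q\<^sup>2 = s * cos
        (?d * s)"
      using q by algebra
    ultimately show "(?\<alpha> has_real_derivative s * cos (?d * s)) (at s)" by (simp add: q_def)
    have "((\<lambda>s. sin (?d * s) * q ^ 3 - s * cos (?d * s) * q\<^sup>2) has_real_derivative
        cos (?d * s) * ?d * q ^ 3 - (cos (?d * s) + s * (- sin (?d * s) * ?d)) * q\<^sup>2) (at s)"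
      by (auto intro!: derivative_eq_intros)
    moreover have "cos (?d * s) * ?d * q ^ 3 - (cos (?d * s) + s * (- sin (?d * s) * ?d)) * q\<^sup>2 = s
        * sin (?d * s) * q"
      using q by algebra
    ultimately show "(?\<beta> has_real_derivative s * sin (?d * s) * ?r) (at s)" by (simp add: q_def)
  qed
  thus ?thesis unfolding J2_def Let_def expGam_vec smult_of_real[symmetric] opG_lin(4) by (simp add:
      opG_def mult_ac)
qed

lemma J_0: "J1 a b l 0 g = 0" "J2 a b l 0 g = 0"
  by (simp_all add: J1_def J2_def Let_def opG_def)

text \<open>
  The coefficient identities behind the next lemma as polynomial identities, where \<open>C\<close>, \<open>S\<close>,
  \<open>D\<close>, \<open>r\<close>, \<open>I\<close> stand for cosine, sine, \<open>\<delta>\<^sub>l\<close>, its inverse and the imaginary unit.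
\<close>

lemma step_coefficients:
  fixes C S D r I t :: complex
  assumes "r * D = 1" "S * S = 1 - C * C" "I * I = -1"
  shows "C * (S * r) + (- I * (S * r)) * (- I * ((C - 1) * r\<^sup>2)) * D\<^sup>2 = - I * (0 * (1 - C) + r\<^sup>2 *
      (0 - - I * (S * r)) * D\<^sup>2)"
    "C * (- I * ((C - 1) * r\<^sup>2)) + (- I * (S * r)) * (S * r) = - I * (0 * (0 - - I * (S * r)) + r\<^sup>2
        * (1 - C))"
    "C * (t * S * r + (C - 1) * r\<^sup>2) + (- I * (S * r)) * (I * (S * r ^ 3 - t * C * r\<^sup>2)) * D\<^sup>2
       = (1 - C) * r\<^sup>2"
    "C * (I * (S * r ^ 3 - t * C * r\<^sup>2)) + (- I * (S * r)) * (t * S * r + (C - 1) * r\<^sup>2)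
       = - I * t * r\<^sup>2 + I * S * r ^ 3"
  using assms by algebra+

lemma expGam_J:
  "expGam a b \<tau> l *v J1 a b l \<tau> g = Q1 a b \<tau> l *v g"
  "expGam a b \<tau> l *v J2 a b l \<tau> g = Q2 a b \<tau> l *v g"
proof -
  let ?d = "delta a b l"
  define D r where "D = complex_of_real ?d" and "r = inverse D"
  have rD: "r * D = 1" using delta_inverse by (simp add: r_def D_def)
  define C S t where "C = complex_of_real (cos (?d * \<tau>))" and "S = complex_of_real (sin (?d * \<tau>))"
      and "t = complex_of_real \<tau>"
  have cs: "S * S = 1 - C * C" unfolding C_def S_def by (rule cos_sin_complex)
  have ii: "\<i> * \<i> = -1" by simp
  have E: "expGam a b \<tau> l *v y = opG a b l C (- \<i> * (S * r)) y" for y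
    by (simp add: expGam_vec C_def S_def r_def D_def)
  have j1: "J1 a b l \<tau> g = opG a b l (S * r) (- \<i> * ((C - 1) * r\<^sup>2)) g"
    by (simp add: J1_def Let_def C_def S_def r_def D_def)
  have j2: "J2 a b l \<tau> g = opG a b l (t * S * r + (C - 1) * r\<^sup>2) (\<i> * (S * r ^ 3 - t * C * r\<^sup>2)) g"
    by (simp add: J2_def Let_def C_def S_def r_def D_def t_def)
  have G: "matrix_inv (Gam a b l) *v y = opG a b l 0 (r\<^sup>2) y" for y
    by (simp add: Gam_inv r_def D_def)
  have D2: "complex_of_real (?d\<^sup>2) = D\<^sup>2" by (simp add: D_def)
  have "Q1 a b \<tau> l *v g = - \<i> *s (matrix_inv (Gam a b l) *v (opG a b l 1 0 g - expGam a b \<tau> l *v g))"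
    unfolding Q1_def matrix_vector_mul_assoc[symmetric] mat_vec matrix_vector_mult_diff_rdistrib
        opG_id by simp
  also have "\<dots> = expGam a b \<tau> l *v J1 a b l \<tau> g"
    unfolding j1 E G opG_lin opG_opG D2 by (rule opG_cong) (rule step_coefficients(1,2)[OF rD cs ii,
        symmetric])+
  finally show "expGam a b \<tau> l *v J1 a b l \<tau> g = Q1 a b \<tau> l *v g" by simp
  have "Q2 a b \<tau> l *v g = (- \<i> * t) *s (matrix_inv (Gam a b l) *v g)
     + matrix_inv (Gam a b l) *v (matrix_inv (Gam a b l) *v (opG a b l 1 0 g - expGam a b \<tau> l *v g))"
    unfolding Q2_def matrix_vector_mult_add_rdistrib matrix_vector_mul_assoc[symmetric] mat_vec
        matrix_vector_mult_diff_rdistrib opG_id t_def by simp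
  also have "\<dots> = opG a b l ((1 - C) * r\<^sup>2) (- \<i> * t * r\<^sup>2 + \<i> * S * r ^ 3) g"
    unfolding E G opG_lin opG_opG D2
  proof (rule opG_cong)
    show "- \<i> * t * 0 + (0 * (0 * (1 - C) + r\<^sup>2 * (0 - - \<i> * (S * r)) * D\<^sup>2) + r\<^sup>2 * (0 * (0 - - \<i> *
        (S * r)) + r\<^sup>2 * (1 - C)) * D\<^sup>2) = (1 - C) * r\<^sup>2"
      using rD by algebra
    show "- \<i> * t * r\<^sup>2 + (0 * (0 * (0 - - \<i> * (S * r)) + r\<^sup>2 * (1 - C)) + r\<^sup>2 * (0 * (1 - C) + r\<^sup>2
        * (0 - - \<i> * (S * r)) * D\<^sup>2)) = - \<i> * t * r\<^sup>2 + \<i> * S * r ^ 3"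
      using rD by algebra
  qed
  also have "\<dots> = expGam a b \<tau> l *v J2 a b l \<tau> g"
    unfolding j2 E opG_opG D2 by (rule opG_cong) (rule step_coefficients(3,4)[OF rD cs ii, symmetric])+
  finally show "expGam a b \<tau> l *v J2 a b l \<tau> g = Q2 a b \<tau> l *v g" by simp
qed

section \<open>The potential operator\<close>

definition GU :: "(real \<Rightarrow> real \<Rightarrow> real) \<Rightarrow> (real \<Rightarrow> real \<Rightarrow> real) \<Rightarrow> real \<Rightarrow> (real \<Rightarrow> complex^2) \<Rightarrow> real \<Rightarrow>
    complex^2" where
  "GU V A t U x = G_mat V A t x *v U x"

lemma GU_eq: "GU V A t U x = V t x *\<^sub>R U x - A t x *\<^sub>R (sigma1 *v U x)"
  by (simp add: GU_def G_mat_def vec_eq_iff forall_2 matrix_vector_mult_def mat_def sum_2 sigma1_def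
      vector_2
      scaleR_conv_of_real[where 'a=complex] algebra_simps)

lemma norm_sigma1: "norm (sigma1 *v y) = norm y"
proof -
  have "(norm (sigma1 *v y))\<^sup>2 = (norm y)\<^sup>2"
    unfolding power2_norm_eq_inner inner_vec_def sum_2 by (simp add: matrix_vector_mult_def sum_2
        sigma1_def vector_2)
  thus ?thesis by simp
qed

lemma sqint_sigma1: "sqint a b U \<Longrightarrow> sqint a b (\<lambda>x. sigma1 *v U x)" "l2 a b (\<lambda>x. sigma1 *v U x) = l2 a b U"
proof -
  assume U: "sqint a b U"
  have "(\<lambda>x. sigma1 *v U x) \<in> borel_measurable (ivl a b)"
    using U by (intro borel_measurable_continuous_on[where f="\<lambda>y. sigma1 *v y"] linear_continuous_on
        matrix_vector_mul_bounded_linear)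
      (simp add: sqint_def)
  thus "sqint a b (\<lambda>x. sigma1 *v U x)"
    by (rule sqint_bound[OF U, where K=1]) (simp add: norm_sigma1)
qed (simp add: l2_def norm_sigma1)

lemma GU_bound:
  assumes U: "sqint a b U" and K: "K \<ge> 0"
    and V: "V t \<in> borel_measurable (ivl a b)" "AE x in ivl a b. \<bar>V t x\<bar> \<le> K"
    and A: "A t \<in> borel_measurable (ivl a b)" "AE x in ivl a b. \<bar>A t x\<bar> \<le> K"
  shows "sqint a b (GU V A t U)" "l2 a b (GU V A t U) \<le> 2 * K * l2 a b U"
proof -
  have e: "GU V A t U = (\<lambda>x. V t x *\<^sub>R U x - A t x *\<^sub>R (sigma1 *v U x))" by (rule ext) (rule GU_eq)
  note 1 = sqint_mult[OF U V K] and 2 = sqint_mult[OF sqint_sigma1(1)[OF U] A K]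
  show "sqint a b (GU V A t U)" unfolding e by (rule sqint_diff[OF 1(1) 2(1)])
  have "l2 a b (GU V A t U) \<le> l2 a b (\<lambda>x. V t x *\<^sub>R U x) + l2 a b (\<lambda>x. A t x *\<^sub>R (sigma1 *v U x))"
    unfolding e by (rule l2_triangle_diff[OF 1(1) 2(1)])
  also have "\<dots> \<le> K * l2 a b U + K * l2 a b U"
    using 1(2) 2(2) unfolding sqint_sigma1(2) by (rule add_mono)
  finally show "l2 a b (GU V A t U) \<le> 2 * K * l2 a b U" by simp
qed

lemma GU_diff: "GU V A t (\<lambda>x. U x - W x) x = GU V A t U x - GU V A t W x"
  unfolding GU_eq matrix_vector_mult_diff_distrib by (simp add: algebra_simps)

lemma fourier_bound:
  assumes "a < b" "sqint a b f"
  shows "norm (fourier_coeff a b f l) \<le> l2 a b f / sqrt (b - a)"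
proof -
  have "(b - a) * (norm (fourier_coeff a b f l))\<^sup>2 \<le> (l2 a b f)\<^sup>2"
    using Bessel[OF assms(1) _ assms(2), of "{l}"] by simp
  hence "(norm (fourier_coeff a b f l))\<^sup>2 \<le> (l2 a b f / sqrt (b - a))\<^sup>2"
    using assms(1) by (simp add: power_divide field_simps)
  thus ?thesis
    by (rule power2_le_imp_le) (use assms(1) l2_nonneg[of a b f] in simp)
qed

section \<open>Error analysis for potentials and waves regular at all times\<close>

text \<open>
  The properties of a potential that the error analysis uses, valid at every time: a bound, a
  Lipschitz bound and a second-order extrapolation bound in the supremum norm.
\<close>

locale potential =
  fixes a b T K :: real and W :: "real \<Rightarrow> real \<Rightarrow> real"
  assumes measurable: "t \<in> {0..T} \<Longrightarrow> W t \<in> borel_measurable (ivl a b)"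
    and bound: "t \<in> {0..T} \<Longrightarrow> AE x in ivl a b. \<bar>W t x\<bar> \<le> K"
    and lipschitz: "0 \<le> s \<Longrightarrow> s \<le> t \<Longrightarrow> t \<le> T \<Longrightarrow> AE x in ivl a b. \<bar>W t x - W s x\<bar> \<le> K * (t - s)"
    and extrapolation: "0 \<le> t - \<tau> \<Longrightarrow> 0 \<le> s \<Longrightarrow> s \<le> \<tau> \<Longrightarrow> 0 < \<tau> \<Longrightarrow> t + s \<le> T \<Longrightarrow>
      AE x in ivl a b. \<bar>W (t + s) x - W t x - (s / \<tau>) * (W t x - W (t - \<tau>) x)\<bar> \<le> 4 * K * \<tau>\<^sup>2"

locale wave = V: potential a b T K V + A: potential a b T K A
  for a b T K V A +
  fixes \<Phi> :: "real \<Rightarrow> real \<Rightarrow> complex^2"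
  assumes ab: "a < b" and K: "K \<ge> 1"
    and sq: "t \<in> {0..T} \<Longrightarrow> sqint a b (\<Phi> t)"
    and bound: "t \<in> {0..T} \<Longrightarrow> l2 a b (\<Phi> t) \<le> K"
    and lipschitz: "0 \<le> s \<Longrightarrow> s \<le> t \<Longrightarrow> t \<le> T \<Longrightarrow> l2 a b (\<lambda>x. \<Phi> t x - \<Phi> s x) \<le> K * (t - s)"
    and extrapolation: "0 \<le> t - \<tau> \<Longrightarrow> 0 \<le> s \<Longrightarrow> s \<le> \<tau> \<Longrightarrow> 0 < \<tau> \<Longrightarrow> t + s \<le> T \<Longrightarrow>
      l2 a b (\<lambda>x. \<Phi> (t + s) x - \<Phi> t x - (s / \<tau>) *\<^sub>R (\<Phi> t x - \<Phi> (t - \<tau>) x)) \<le> 4 * K * \<tau>\<^sup>2"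
begin

lemma K0: "K \<ge> 0" using K by simp

lemma GU_sq: "t \<in> {0..T} \<Longrightarrow> sqint a b U \<Longrightarrow> sqint a b (GU V A t U)"
  "t \<in> {0..T} \<Longrightarrow> sqint a b U \<Longrightarrow> l2 a b (GU V A t U) \<le> 2 * K * l2 a b U"
  by (rule GU_bound; use K0 V.measurable V.bound A.measurable A.bound in blast)+

lemma product_lipschitz:
  assumes W: "potential a b T K W" and p: "sqint a b (p t)" "sqint a b (p s)" "l2 a b (p s) \<le> K"
    "l2 a b (\<lambda>x. p t x - p s x) \<le> K * (t - s)"
    and st: "0 \<le> s" "s \<le> t" "t \<le> T"
  shows "sqint a b (\<lambda>x. W t x *\<^sub>R p t x - W s x *\<^sub>R p s x)"
    "l2 a b (\<lambda>x. W t x *\<^sub>R p t x - W s x *\<^sub>R (p s x :: complex^2)) \<le> 2 * K\<^sup>2 * (t - s)"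
proof -
  interpret W: potential a b T K W by (rule W)
  have tT: "t \<in> {0..T}" "s \<in> {0..T}" using st by auto
  have K1: "0 \<le> K * (t - s)" using st K0 by simp
  have dm: "(\<lambda>x. W t x - W s x) \<in> borel_measurable (ivl a b)"
    using W.measurable[OF tT(1)] W.measurable[OF tT(2)] by (rule borel_measurable_diff)
  have e: "(\<lambda>x. W t x *\<^sub>R p t x - W s x *\<^sub>R p s x)
     = (\<lambda>x. W t x *\<^sub>R (p t x - p s x) + (W t x - W s x) *\<^sub>R p s x)"
    by (simp add: fun_eq_iff algebra_simps)
  note 1 = sqint_mult[OF sqint_diff[OF p(1,2)] W.measurable[OF tT(1)] W.bound[OF tT(1)] K0]
  note 2 = sqint_mult[OF p(2) dm W.lipschitz[OF st] K1]
  show "sqint a b (\<lambda>x. W t x *\<^sub>R p t x - W s x *\<^sub>R p s x)" unfolding e by (rule sqint_add[OF 1(1) 2(1)])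
  have "l2 a b (\<lambda>x. W t x *\<^sub>R p t x - W s x *\<^sub>R p s x) \<le> K * (K * (t - s)) + (K * (t - s)) * K"
    unfolding e
    by (rule order_trans[OF l2_triangle[OF 1(1) 2(1)]], rule add_mono;
        rule order_trans[OF 1(2)] order_trans[OF 2(2)], rule mult_left_mono; (rule p K0 K1))
  thus "l2 a b (\<lambda>x. W t x *\<^sub>R p t x - W s x *\<^sub>R (p s x :: complex^2)) \<le> 2 * K\<^sup>2 * (t - s)"
    by (simp add: power2_eq_square algebra_simps)
qed

lemma sigma1_\<Phi>:
  shows "t \<in> {0..T} \<Longrightarrow> sqint a b (\<lambda>x. sigma1 *v \<Phi> t x)"
    "t \<in> {0..T} \<Longrightarrow> l2 a b (\<lambda>x. sigma1 *v \<Phi> t x) \<le> K"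
    "0 \<le> s \<Longrightarrow> s \<le> t \<Longrightarrow> t \<le> T \<Longrightarrow> l2 a b (\<lambda>x. sigma1 *v \<Phi> t x - sigma1 *v \<Phi> s x) \<le> K * (t - s)"
    "0 \<le> t - \<tau> \<Longrightarrow> 0 \<le> s \<Longrightarrow> s \<le> \<tau> \<Longrightarrow> 0 < \<tau> \<Longrightarrow> t + s \<le> T \<Longrightarrow>
      l2 a b (\<lambda>x. sigma1 *v \<Phi> (t + s) x - sigma1 *v \<Phi> t x - (s / \<tau>) *\<^sub>R (sigma1 *v \<Phi> t x - sigma1 *v
          \<Phi> (t - \<tau>) x)) \<le> 4 * K * \<tau>\<^sup>2"
proof -
  have sc: "r *\<^sub>R (sigma1 *v y) = sigma1 *v (r *\<^sub>R y)" for r y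
    by (simp add: linear_scale[OF matrix_vector_mul_linear])
  show "t \<in> {0..T} \<Longrightarrow> sqint a b (\<lambda>x. sigma1 *v \<Phi> t x)"
    "t \<in> {0..T} \<Longrightarrow> l2 a b (\<lambda>x. sigma1 *v \<Phi> t x) \<le> K"
    using sqint_sigma1 sq bound by auto
  show "0 \<le> s \<Longrightarrow> s \<le> t \<Longrightarrow> t \<le> T \<Longrightarrow> l2 a b (\<lambda>x. sigma1 *v \<Phi> t x - sigma1 *v \<Phi> s x) \<le> K * (t - s)"
    unfolding matrix_vector_mult_diff_distrib[symmetric] sqint_sigma1(2) by (rule lipschitz)
  show "0 \<le> t - \<tau> \<Longrightarrow> 0 \<le> s \<Longrightarrow> s \<le> \<tau> \<Longrightarrow> 0 < \<tau> \<Longrightarrow> t + s \<le> T \<Longrightarrow>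
      l2 a b (\<lambda>x. sigma1 *v \<Phi> (t + s) x - sigma1 *v \<Phi> t x - (s / \<tau>) *\<^sub>R (sigma1 *v \<Phi> t x - sigma1 *v
          \<Phi> (t - \<tau>) x)) \<le> 4 * K * \<tau>\<^sup>2"
    unfolding matrix_vector_mult_diff_distrib[symmetric] sc sqint_sigma1(2) by (rule extrapolation)
qed

lemma GU_lipschitz:
  assumes st: "0 \<le> s" "s \<le> t" "t \<le> T"
  shows "l2 a b (\<lambda>x. GU V A t (\<Phi> t) x - GU V A s (\<Phi> s) x) \<le> 4 * K\<^sup>2 * (t - s)"
proof -
  have tT: "t \<in> {0..T}" "s \<in> {0..T}" using st by auto
  have V: "potential a b T K V" and A: "potential a b T K A" by unfold_locales
  note 1 = product_lipschitz[OF V sq[OF tT(1)] sq[OF tT(2)] bound[OF tT(2)] lipschitz[OF st] st]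
  note 2 = product_lipschitz[where p="\<lambda>t x. sigma1 *v \<Phi> t x", OF A sigma1_\<Phi>(1)[OF tT(1)]
      sigma1_\<Phi>(1)[OF tT(2)] sigma1_\<Phi>(2)[OF tT(2)] sigma1_\<Phi>(3)[OF st] st]
  have e: "(\<lambda>x. GU V A t (\<Phi> t) x - GU V A s (\<Phi> s) x) =
     (\<lambda>x. (V t x *\<^sub>R \<Phi> t x - V s x *\<^sub>R \<Phi> s x) - (A t x *\<^sub>R (sigma1 *v \<Phi> t x) - A s x *\<^sub>R (sigma1 *v
         \<Phi> s x)))"
    by (simp add: fun_eq_iff GU_eq)
  show ?thesis unfolding e using l2_triangle_diff[OF 1(1) 2(1)] 1(2) 2(2) by simp
qed

lemma GU_extrapolation:
  assumes st: "0 \<le> t - \<tau>" "0 \<le> s" "s \<le> \<tau>" "0 < \<tau>" "t + s \<le> T" and \<tau>: "\<tau> \<le> 1"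
  shows "l2 a b (\<lambda>x. GU V A (t + s) (\<Phi> (t + s)) x - GU V A t (\<Phi> t) x
      - (s / \<tau>) *\<^sub>R (GU V A t (\<Phi> t) x - GU V A (t - \<tau>) (\<Phi> (t - \<tau>)) x)) \<le> 28 * K\<^sup>2 * \<tau>\<^sup>2"
proof -
  have tT: "t - \<tau> \<in> {0..T}" "t \<in> {0..T}" "t + s \<in> {0..T}" using st by auto
  have st1: "0 \<le> t - \<tau>" "t - \<tau> \<le> t" "t \<le> T" using st by auto
  have \<theta>: "0 \<le> s / \<tau>" "s / \<tau> \<le> 1" using st by auto
  have \<tau>0: "0 \<le> \<tau>" using st by simp
  define F where "F = (\<lambda>(W :: real \<Rightarrow> real \<Rightarrow> real) (p :: real \<Rightarrow> real \<Rightarrow> complex^2) x.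
      W (t + s) x *\<^sub>R p (t + s) x - W t x *\<^sub>R p t x - (s / \<tau>) *\<^sub>R (W t x *\<^sub>R p t x - W (t - \<tau>) x *\<^sub>R
          p (t - \<tau>) x))"
  have 1: "l2 a b (F V \<Phi>) \<le> 14 * K\<^sup>2 * \<tau>\<^sup>2"
    unfolding F_def
    by (rule product_extrapolation[OF sq[OF tT(1)] sq[OF tT(2)] sq[OF tT(3)]
       V.measurable[OF tT(1)] V.measurable[OF tT(2)] V.measurable[OF tT(3)] \<theta> \<tau>0 \<tau> K0 V.bound[OF
           tT(3)] bound[OF tT(2)]])
      (use V.lipschitz[OF st1] lipschitz[OF st1] V.extrapolation[OF st(1-5)] extrapolation[OF
          st(1-5)] in auto)
  have 2: "l2 a b (F A (\<lambda>t x. sigma1 *v \<Phi> t x)) \<le> 14 * K\<^sup>2 * \<tau>\<^sup>2"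
    unfolding F_def
    by (rule product_extrapolation[OF sigma1_\<Phi>(1)[OF tT(1)] sigma1_\<Phi>(1)[OF tT(2)] sigma1_\<Phi>(1)[OF tT(3)]
       A.measurable[OF tT(1)] A.measurable[OF tT(2)] A.measurable[OF tT(3)] \<theta> \<tau>0 \<tau> K0 A.bound[OF
           tT(3)] sigma1_\<Phi>(2)[OF tT(2)]])
      (use A.lipschitz[OF st1] sigma1_\<Phi>(3)[OF st1] A.extrapolation[OF st(1-5)] sigma1_\<Phi>(4)[OF
          st(1-5)] in auto)
  have s1: "sqint a b (F V \<Phi>)" unfolding F_def
    by (intro sqint_diff sqint_scaleR sqint_mult(1)[OF sq V.measurable V.bound K0] tT)
  have s2: "sqint a b (F A (\<lambda>t x. sigma1 *v \<Phi> t x))" unfolding F_def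
    by (intro sqint_diff sqint_scaleR sqint_mult(1)[OF sigma1_\<Phi>(1) A.measurable A.bound K0] tT)
  have e: "(\<lambda>x. GU V A (t + s) (\<Phi> (t + s)) x - GU V A t (\<Phi> t) x
      - (s / \<tau>) *\<^sub>R (GU V A t (\<Phi> t) x - GU V A (t - \<tau>) (\<Phi> (t - \<tau>)) x)) = (\<lambda>x. F V \<Phi> x - F A (\<lambda>t x.
          sigma1 *v \<Phi> t x) x)"
    by (simp add: fun_eq_iff GU_eq F_def scaleR_diff_right)
  show ?thesis unfolding e using l2_triangle_diff[OF s1 s2] 1 2 by simp
qed

end

text \<open>
  A mean value inequality for finitely many vector functions with the Euclidean norm of all of
  them: apply the scalar mean value theorem to the sum of the \<open>y\<^sub>l\<close>, each paired with its own
  total increment.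
\<close>

lemma L2_set_mean_value:
  fixes y D :: "int \<Rightarrow> real \<Rightarrow> complex^2"
  assumes A: "finite A" and \<tau>: "0 < \<tau>"
    and d: "\<And>l s. l \<in> A \<Longrightarrow> s \<in> {0..\<tau>} \<Longrightarrow> (y l has_vector_derivative D l s) (at s within {0..\<tau>})"
    and R: "\<And>s. s \<in> {0..\<tau>} \<Longrightarrow> L2_set (\<lambda>l. norm (D l s)) A \<le> R"
  shows "L2_set (\<lambda>l. norm (y l \<tau> - y l 0)) A \<le> R * \<tau>"
proof -
  define w where "w = (\<lambda>l. y l \<tau> - y l 0)"
  define h where "h = (\<lambda>s. \<Sum>l\<in>A. w l \<bullet> y l s)"
  have hd: "(h has_derivative (\<lambda>r. r * (\<Sum>l\<in>A. w l \<bullet> D l s))) (at s within {0..\<tau>})" if "s \<in> {0..\<tau>}" for s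
  proof -
    have "(h has_vector_derivative (\<Sum>l\<in>A. w l \<bullet> D l s)) (at s within {0..\<tau>})"
      unfolding h_def
      by (intro has_vector_derivative_sum bounded_linear.has_vector_derivative[OF
          bounded_linear_inner_right] d that)
    thus ?thesis by (simp add: has_vector_derivative_def)
  qed
  obtain x where x: "x \<in> {0<..<\<tau>}" "h \<tau> - h 0 = (\<tau> - 0) * (\<Sum>l\<in>A. w l \<bullet> D l x)"
    using mvt_simple[OF \<tau>, of h "\<lambda>s r. r * (\<Sum>l\<in>A. w l \<bullet> D l s)"] hd by auto
  let ?W = "L2_set (\<lambda>l. norm (w l)) A"
  have "?W\<^sup>2 = (\<Sum>l\<in>A. w l \<bullet> w l)"
    by (simp add: L2_set_def sum_nonneg power2_norm_eq_inner)
  also have "\<dots> = h \<tau> - h 0"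
    by (simp add: h_def w_def inner_diff_right sum_subtractf)
  also have "\<dots> \<le> \<tau> * (\<Sum>l\<in>A. \<bar>norm (w l)\<bar> * \<bar>norm (D l x)\<bar>)"
    unfolding x(2) using \<tau> by (auto intro!: mult_left_mono sum_mono norm_cauchy_schwarz)
  also have "\<dots> \<le> \<tau> * (?W * L2_set (\<lambda>l. norm (D l x)) A)"
    using \<tau> by (intro mult_left_mono L2_set_mult_ineq) auto
  also have "\<dots> \<le> \<tau> * (?W * R)"
    using \<tau> x(1) by (intro mult_left_mono R) (auto simp: L2_set_nonneg)
  finally have q: "?W * ?W \<le> (R * \<tau>) * ?W" by (simp add: power2_eq_square mult_ac)
  have R0: "R \<ge> 0" using R[of 0] \<tau> L2_set_nonneg order_trans by (metis atLeastAtMost_iff less_imp_le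
      order_refl)
  show ?thesis
  proof (cases "?W = 0")
    case True thus ?thesis using R0 \<tau> by (simp add: w_def)
  next
    case False
    hence "?W > 0" using L2_set_nonneg[of "\<lambda>l. norm (w l)" A] by linarith
    thus ?thesis using q by (simp add: w_def)
  qed
qed

lemma l2_trig_sum:
  assumes "a < b" "finite A"
  shows "l2 a b (trig_sum a b A c) = sqrt (b - a) * L2_set (\<lambda>l. norm (c l)) A"
proof -
  have "(l2 a b (trig_sum a b A c))\<^sup>2 = (\<integral>x. trig_sum a b A c x \<bullet> trig_sum a b A c x \<partial>ivl a b)"
    by (simp add: l2_sq power2_norm_eq_inner)
  also have "\<dots> = (b - a) * (\<Sum>l\<in>A. fourier_coeff a b (trig_sum a b A c) l \<bullet> c l)"
    by (rule inner_trig_sum[OF assms(1) integrable_trig_sum])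
  also have "\<dots> = (sqrt (b - a) * L2_set (\<lambda>l. norm (c l)) A)\<^sup>2"
    using assms by (simp add: fourier_coeff_trig_sum power2_norm_eq_inner[symmetric]
        power_mult_distrib L2_set_def sum_nonneg)
  finally show ?thesis
    by (rule power2_eq_imp_eq) (use assms in \<open>auto simp: l2_nonneg L2_set_nonneg\<close>)
qed

lemma Bessel_L2_set:
  assumes "a < b" "finite A" "sqint a b f"
  shows "sqrt (b - a) * L2_set (\<lambda>l. norm (fourier_coeff a b f l)) A \<le> l2 a b f"
proof (rule power2_le_imp_le)
  show "(sqrt (b - a) * L2_set (\<lambda>l. norm (fourier_coeff a b f l)) A)\<^sup>2 \<le> (l2 a b f)\<^sup>2"
    using Bessel[OF assms] assms(1) by (simp add: power_mult_distrib L2_set_def sum_nonneg)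
qed (rule l2_nonneg)

text \<open>Every iterate lies in \<open>Y\<^sub>N\<close>, hence it is determined by its coefficients.\<close>

lemma ewi_fs_is_trig_sum:
  assumes "a < b"
  shows "ewi_fs a b \<epsilon> V A \<Phi>0 N \<tau> n = trig_sum a b (modes N) (fourier_coeff a b (ewi_fs a b \<epsilon> V A \<Phi>0
      N \<tau> n))"
proof -
  have "\<exists>c. ewi_fs a b \<epsilon> V A \<Phi>0 N \<tau> n = trig_sum a b (modes N) c"
    by (cases "(a, b, \<epsilon>, V, A, \<Phi>0, N, \<tau>, n)" rule: ewi_fs.cases) (auto simp: P_N_def
        trig_poly_trig_sum Let_def simp del: One_nat_def)
  then obtain c where c: "ewi_fs a b \<epsilon> V A \<Phi>0 N \<tau> n = trig_sum a b (modes N) c" by blast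
  show ?thesis unfolding c
    by (intro ext) (simp add: trig_sum_def[of a b "modes N"] fourier_coeff_trig_sum[OF assms
        finite_modes])
qed

lemma ewi_fs_coeff_1:
  assumes "a < b" "l \<in> modes N"
  shows "fourier_coeff a b (ewi_fs a b \<epsilon> V A \<Phi>0 N \<tau> (Suc 0)) l =
    expGam a b \<tau> l *v (fourier_coeff a b (ewi_fs a b \<epsilon> V A \<Phi>0 N \<tau> 0) l
      - (\<i> * of_real \<epsilon>) *s (J1 a b l \<tau> (fourier_coeff a b (GU V A 0 (ewi_fs a b \<epsilon> V A \<Phi>0 N \<tau> 0)) l)))"
proof -
  let ?U = "ewi_fs a b \<epsilon> V A \<Phi>0 N \<tau> 0"
  define g where "g = fourier_coeff a b (GU V A 0 ?U) l"
  have "fourier_coeff a b (ewi_fs a b \<epsilon> V A \<Phi>0 N \<tau> (Suc 0)) l = expGam a b \<tau> l *v fourier_coeff a b ?U l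
        - \<epsilon> *\<^sub>R ((matrix_inv (Gam a b l) ** (mat 1 - expGam a b \<tau> l)) *v g)"
    using assms(2) by (simp add: Let_def trig_poly_trig_sum fourier_coeff_trig_sum[OF assms(1)
        finite_modes] GPhi_coeff_def GU_def[abs_def] g_def
        del: ewi_fs.simps(1))
  also have "\<epsilon> *\<^sub>R ((matrix_inv (Gam a b l) ** (mat 1 - expGam a b \<tau> l)) *v g) = (\<i> * of_real \<epsilon>) *s
      (Q1 a b \<tau> l *v g)"
    unfolding Q1_def matrix_vector_mul_assoc[symmetric] mat_vec vector_smult_assoc
    by (simp add: smult_of_real[symmetric] mult.commute mult.left_commute)
  finally show ?thesis
    by (simp add: matrix_vector_mult_diff_distrib vector_scalar_commute expGam_J(1) g_def)
qed

lemma ewi_fs_coeff_2: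
  assumes "a < b" "l \<in> modes N" "t = real (Suc n) * \<tau>" "t' = real n * \<tau>"
    and U: "U = ewi_fs a b \<epsilon> V A \<Phi>0 N \<tau> (Suc n)" and U': "U' = ewi_fs a b \<epsilon> V A \<Phi>0 N \<tau> n"
  shows "fourier_coeff a b (ewi_fs a b \<epsilon> V A \<Phi>0 N \<tau> (Suc (Suc n))) l =
    expGam a b \<tau> l *v (fourier_coeff a b U l
      - (\<i> * of_real \<epsilon>) *s (J1 a b l \<tau> (fourier_coeff a b (GU V A t U) l)
        + J2 a b l \<tau> ((1 / \<tau>) *\<^sub>R (fourier_coeff a b (GU V A t U) l - fourier_coeff a b (GU V A t'
            U') l))))"
  using assms(2)
  by (simp add: Let_def trig_poly_trig_sum fourier_coeff_trig_sum[OF assms(1) finite_modes]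
      GPhi_coeff_def GU_def[abs_def]
      assms(3,4) U[symmetric] U'[symmetric] matrix_vector_mult_diff_distrib vector_scalar_commute
          expGam_J
      matrix_vector_right_distrib algebra_simps smult.add_right
      del: of_nat_Suc)

text \<open>
  The sequence \<open>q\<^sup>n (L + 1) S - S / 2\<close> with \<open>q = 1 + 2 \<kappa> L\<close> solves the recursion in which the
  older error is replaced by the newer one, and it dominates \<open>e\<close> since it is increasing.
\<close>

lemma two_step_Gronwall:
  fixes e :: "nat \<Rightarrow> real"
  assumes "e 0 \<le> L * S" "e 1 \<le> L * S" and L: "L \<ge> 0" "\<kappa> \<ge> 0" "S \<ge> 0"
    and step: "\<And>n. Suc (Suc n) \<le> m \<Longrightarrow> e (Suc (Suc n)) \<le> e (Suc n) + \<kappa> * (L * (S + e (Suc n) + e n))"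
    and n: "n \<le> m"
  shows "e n \<le> exp (2 * L * (\<kappa> * real n)) * (L + 1) * S"
proof -
  define q where "q = 1 + 2 * \<kappa> * L"
  define B where "B = (\<lambda>n. q ^ n * ((L + 1) * S) - S / 2)"
  have q: "q \<ge> 1" using L by (simp add: q_def)
  have LS: "0 \<le> (L + 1) * S" using L by simp
  have Bm: "B n \<le> B (Suc n)" for n
    unfolding B_def using q LS by (intro diff_right_mono mult_right_mono power_increasing) auto
  have BS: "B (Suc n) = B n + \<kappa> * (L * (S + B n + B n))" for n
    by (simp add: B_def q_def algebra_simps)
  have B0: "B 0 \<ge> L * S" using L by (simp add: B_def algebra_simps)
  have "n \<le> m \<longrightarrow> e n \<le> B n" "Suc n \<le> m \<longrightarrow> e (Suc n) \<le> B (Suc n)" for n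
  proof (induction n)
    case 0
    show "0 \<le> m \<longrightarrow> e 0 \<le> B 0" using assms(1) B0 by simp
    show "Suc 0 \<le> m \<longrightarrow> e (Suc 0) \<le> B (Suc 0)" using assms(2) B0 Bm[of 0] by simp
  next
    case (Suc n)
    show "Suc n \<le> m \<longrightarrow> e (Suc n) \<le> B (Suc n)" by (rule Suc)
    show "Suc (Suc n) \<le> m \<longrightarrow> e (Suc (Suc n)) \<le> B (Suc (Suc n))"
    proof
      assume m: "Suc (Suc n) \<le> m"
      have 1: "e (Suc n) \<le> B (Suc n)" "e n \<le> B (Suc n)" using Suc m Bm[of n] by auto
      have "e (Suc (Suc n)) \<le> e (Suc n) + \<kappa> * (L * (S + e (Suc n) + e n))" by (rule step[OF m])
      also have "\<dots> \<le> B (Suc n) + \<kappa> * (L * (S + B (Suc n) + B (Suc n)))"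
        using 1 L by (intro add_mono mult_left_mono) auto
      finally show "e (Suc (Suc n)) \<le> B (Suc (Suc n))" unfolding BS[of "Suc n"] .
    qed
  qed
  hence "e n \<le> B n" using n by blast
  also have "\<dots> \<le> q ^ n * ((L + 1) * S)" using L by (simp add: B_def)
  also have "\<dots> \<le> exp (2 * \<kappa> * L) ^ n * ((L + 1) * S)"
    using q LS exp_ge_add_one_self[of "2 * \<kappa> * L"] by (intro mult_right_mono power_mono) (auto simp:
        q_def)
  also have "exp (2 * \<kappa> * L) ^ n = exp (2 * L * (\<kappa> * real n))"
    by (simp add: exp_of_nat_mult[symmetric] mult_ac)
  finally show ?thesis by (simp add: mult.assoc)
qed

text \<open>
  In terms of Fourier coefficients the Dirac equation is a system of ordinary differential
  equations in the classical sense, coupled only through the potential.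
\<close>

locale dirac_wave = wave +
  fixes \<epsilon> :: real
  assumes eps: "0 < \<epsilon>" "\<epsilon> \<le> 1"
    and coefficient_ode: "\<And>l t. t \<in> {0..T} \<Longrightarrow>
      ((\<lambda>t. fourier_coeff a b (\<Phi> t) l) has_vector_derivative
        - \<i> *s (Gam a b l *v fourier_coeff a b (\<Phi> t) l + of_real \<epsilon> *s fourier_coeff a b (GU V A t (\<Phi>
            t)) l)) (at t within {0..T})"
begin

text \<open>
  Apply the integrating factor \<open>e\<^sup>i\<^sup>s\<^sup>\<Gamma>\<close> to the exact coefficients on \<open>[t, t + \<tau>]\<close> and to the
  step of the method with forcing \<open>p0 + s p1\<close>. The rotated difference \<open>y\<close> has derivative \<open>-i\<epsilon>
  e\<^sup>i\<^sup>s\<^sup>\<Gamma>\<close> times the coefficients of the defect \<open>F s\<close>. Unitarity removes the rotations, so that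
  the error of the coefficients grows by at most \<open>\<epsilon> \<tau> B\<close>; Bessel's inequality passes from the
  coefficients of the defect to its norm.
\<close>

lemma one_step:
  fixes p0 p1 :: "int \<Rightarrow> complex^2"
  assumes t: "0 \<le> t" "t + \<tau> \<le> T" "0 < \<tau>" and A: "finite M"
    and u: "\<And>l. l \<in> M \<Longrightarrow> u' l = expGam a b \<tau> l *v (u l - (\<i> * of_real \<epsilon>) *s (J1 a b l \<tau> (p0 l) + J2 a
        b l \<tau> (p1 l)))"
    and F: "\<And>s. s \<in> {0..\<tau>} \<Longrightarrow> sqint a b (F s)" "\<And>s. s \<in> {0..\<tau>} \<Longrightarrow> l2 a b (F s) \<le> B"
      "\<And>s l. s \<in> {0..\<tau>} \<Longrightarrow> l \<in> M \<Longrightarrow>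
        fourier_coeff a b (F s) l = fourier_coeff a b (GU V A (t + s) (\<Phi> (t + s))) l - p0 l - s *\<^sub>R p1 l"
  shows "sqrt (b - a) * L2_set (\<lambda>l. norm (fourier_coeff a b (\<Phi> (t + \<tau>)) l - u' l)) M
    \<le> sqrt (b - a) * L2_set (\<lambda>l. norm (fourier_coeff a b (\<Phi> t) l - u l)) M + \<epsilon> * \<tau> * B"
proof -
  let ?c = "\<lambda>s l. fourier_coeff a b (\<Phi> s) l"
  define y where "y = (\<lambda>l s. expGam a b (- s) l *v ?c (t + s) l
      - (u l - (\<i> * of_real \<epsilon>) *s (J1 a b l s (p0 l) + J2 a b l s (p1 l))))"
  define D where "D = (\<lambda>l s. expGam a b (- s) l *v (- (\<i> * of_real \<epsilon>) *s fourier_coeff a b (F s) l))"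
  have yd: "(y l has_vector_derivative D l s) (at s within {0..\<tau>})" if l: "l \<in> M" and s: "s \<in>
      {0..\<tau>}" for l s
  proof -
    let ?g = "fourier_coeff a b (GU V A (t + s) (\<Phi> (t + s))) l"
    let ?c' = "- \<i> *s (Gam a b l *v ?c (t + s) l + of_real \<epsilon> *s ?g)"
    have "((\<lambda>r. ?c r l) has_vector_derivative ?c') (at (t + s) within (\<lambda>s. t + s) ` {0..\<tau>})"
      by (rule has_vector_derivative_within_subset[OF coefficient_ode]) (use s t in auto)
    moreover have "((\<lambda>s. t + s) has_vector_derivative 1) (at s within {0..\<tau>})"
      by (auto intro!: derivative_eq_intros)
    ultimately have cd: "((\<lambda>s. ?c (t + s) l) has_vector_derivative ?c') (at s within {0..\<tau>})"
      using vector_diff_chain_within[of "\<lambda>s. t + s" 1 s "{0..\<tau>}" "\<lambda>r. ?c r l"] by (simp add: o_def)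
    have e: "?c' + \<i> *s (Gam a b l *v ?c (t + s) l) = - (\<i> * of_real \<epsilon>) *s ?g"
    proof -
      have "- \<i> *s (v + of_real \<epsilon> *s g) + \<i> *s v = - (\<i> * of_real \<epsilon>) *s g" for v g :: "complex^2"
        by (simp add: vec_eq_iff algebra_simps)
      thus ?thesis .
    qed
    have "(y l has_vector_derivative
       expGam a b (- s) l *v (?c' + \<i> *s (Gam a b l *v ?c (t + s) l))
        - (0 - (\<i> * of_real \<epsilon>) *s (expGam a b (- s) l *v p0 l + expGam a b (- s) l *v (s *\<^sub>R p1
            l)))) (at s within {0..\<tau>})"
      unfolding y_def
      by (intro has_vector_derivative_diff has_vector_derivative_const expGam_derivative[OF cd]
        bounded_linear.has_vector_derivative[OF smult.bounded_linear_right]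
            has_vector_derivative_add J1_deriv J2_deriv)
    moreover have "expGam a b (- s) l *v (?c' + \<i> *s (Gam a b l *v ?c (t + s) l))
        - (0 - (\<i> * of_real \<epsilon>) *s (expGam a b (- s) l *v p0 l + expGam a b (- s) l *v (s *\<^sub>R p1 l)))
            = D l s"
      unfolding e
      unfolding D_def F(3)[OF s l] matrix_vector_right_distrib[symmetric]
          vector_scalar_commute[symmetric]
        matrix_vector_mult_diff_distrib[symmetric]
      by (simp add: vector_scalar_commute[symmetric] matrix_vector_right_distrib[symmetric])
        (rule arg_cong[where f="\<lambda>z. expGam a b (- s) l *v z"], simp add: vec_eq_iff algebra_simps)
    ultimately show ?thesis by simp
  qed
  have B: "L2_set (\<lambda>l. norm (D l s)) M \<le> \<epsilon> * (B / sqrt (b - a))" if s: "s \<in> {0..\<tau>}" for s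
  proof -
    have "L2_set (\<lambda>l. norm (D l s)) M = L2_set (\<lambda>l. \<epsilon> * norm (fourier_coeff a b (F s) l)) M"
      unfolding D_def norm_expGam using eps by (simp add: norm_vec_smult norm_mult)
    also have "\<dots> = \<epsilon> * L2_set (\<lambda>l. norm (fourier_coeff a b (F s) l)) M"
      using eps by (simp add: L2_set_right_distrib)
    also have "\<dots> \<le> \<epsilon> * (B / sqrt (b - a))"
    proof (intro mult_left_mono)
      have "sqrt (b - a) * L2_set (\<lambda>l. norm (fourier_coeff a b (F s) l)) M \<le> B"
        using Bessel_L2_set[OF ab A F(1)[OF s]] F(2)[OF s] by linarith
      thus "L2_set (\<lambda>l. norm (fourier_coeff a b (F s) l)) M \<le> B / sqrt (b - a)"
        using ab by (simp add: field_simps)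
    qed (use eps in auto)
    finally show ?thesis .
  qed
  have mv: "L2_set (\<lambda>l. norm (y l \<tau> - y l 0)) M \<le> \<epsilon> * (B / sqrt (b - a)) * \<tau>"
    by (rule L2_set_mean_value[OF A t(3) yd B])
  have y0: "y l 0 = ?c t l - u l" for l
    by (simp add: y_def expGam_0 J_0)
  have y\<tau>: "norm (y l \<tau>) = norm (?c (t + \<tau>) l - u' l)" if "l \<in> M" for l
  proof -
    have "expGam a b \<tau> l *v y l \<tau> = ?c (t + \<tau>) l - u' l"
      unfolding y_def matrix_vector_mult_diff_distrib[of _ "expGam a b (- \<tau>) l *v ?c (t + \<tau>) l"]
          expGam_inverse u[OF that] ..
    thus ?thesis using norm_expGam by metis
  qed
  have "L2_set (\<lambda>l. norm (?c (t + \<tau>) l - u' l)) M = L2_set (\<lambda>l. norm (y l \<tau>)) M"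
    by (rule L2_set_cong) (auto simp: y\<tau>)
  also have "\<dots> \<le> L2_set (\<lambda>l. norm (y l \<tau> - y l 0) + norm (y l 0)) M"
    by (intro L2_set_mono) (auto intro: norm_triangle_sub order_trans[OF norm_triangle_sub[of _ "y _
        0"]] simp: add.commute)
  also have "\<dots> \<le> L2_set (\<lambda>l. norm (y l \<tau> - y l 0)) M + L2_set (\<lambda>l. norm (y l 0)) M"
    by (rule L2_set_triangle_ineq)
  also have "\<dots> \<le> \<epsilon> * (B / sqrt (b - a)) * \<tau> + L2_set (\<lambda>l. norm (?c t l - u l)) M"
    using mv by (simp add: y0)
  finally have "sqrt (b - a) * L2_set (\<lambda>l. norm (?c (t + \<tau>) l - u' l)) M
     \<le> sqrt (b - a) * (\<epsilon> * (B / sqrt (b - a)) * \<tau> + L2_set (\<lambda>l. norm (?c t l - u l)) M)"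
    using ab by (intro mult_left_mono) auto
  also have "\<dots> = sqrt (b - a) * L2_set (\<lambda>l. norm (?c t l - u l)) M + \<epsilon> * \<tau> * B"
    using ab by (simp add: field_simps)
  finally show ?thesis .
qed

text \<open>
  Let \<open>e n\<close> be the norm of \<open>P\<^sub>N\<Phi>(t\<^sub>n) - \<Phi>\<^sub>N\<^sup>n\<close>. The defect of a step splits into the
  extrapolation error of \<open>G \<Phi>\<close>, of order \<open>\<tau>\<^sup>2\<close>, and \<open>G\<close> applied to the total errors at the last
  two levels, at most \<open>H + e\<close> each. This gives a two-step recursion with increments proportional
  to \<open>\<epsilon> \<tau>\<close>. The first step uses a constant forcing, whose defect is only of order \<open>\<tau>\<close>, but it is
  made once.
\<close>

lemma error_bound:
  assumes N: "even N" "0 < N" and \<tau>: "0 < \<tau>" "\<tau> \<le> 1" and m: "real m * \<tau> \<le> T"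
    and init: "AE x in ivl a b. \<Phi> 0 x = \<Phi>0 x" and H: "H \<ge> 0"
    and proj: "\<And>t. t \<in> {0..T} \<Longrightarrow> l2 a b (\<lambda>x. \<Phi> t x - P_N a b N (\<Phi> t) x) \<le> H"
  shows "sqint a b (\<lambda>x. \<Phi> (real m * \<tau>) x - ewi_fs a b \<epsilon> V A \<Phi>0 N \<tau> m x)"
    "l2 a b (\<lambda>x. \<Phi> (real m * \<tau>) x - ewi_fs a b \<epsilon> V A \<Phi>0 N \<tau> m x)
      \<le> H + exp (2 * (28 * K\<^sup>2) * (\<epsilon> * \<tau> * real m)) * (28 * K\<^sup>2 + 1) * (H + \<tau>\<^sup>2)"
proof -
  let ?M = "modes N"
  let ?F = "fourier_coeff a b"
  define U where "U = ewi_fs a b \<epsilon> V A \<Phi>0 N \<tau>"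
  define t where "t = (\<lambda>n::nat. real n * \<tau>)"
  define W where "W = (\<lambda>n x. \<Phi> (t n) x - U n x)"
  define e where "e = (\<lambda>n. sqrt (b - a) * L2_set (\<lambda>l. norm (?F (\<Phi> (t n)) l - ?F (U n) l)) ?M)"
  have tT: "t n \<in> {0..T}" if "n \<le> m" for n
  proof -
    have "real n * \<tau> \<le> real m * \<tau>" using that \<tau> by (intro mult_right_mono) auto
    hence "real n * \<tau> \<le> T" using m by (rule order_trans)
    thus ?thesis using \<tau> by (simp add: t_def)
  qed
  have tS: "t (Suc n) = t n + \<tau>" for n by (simp add: t_def algebra_simps)
  have t0: "t 0 = 0" by (simp add: t_def)
  have Usum: "U n = trig_sum a b ?M (?F (U n))" for n unfolding U_def by (rule ewi_fs_is_trig_sum[OF ab])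
  have Us: "sqint a b (U n)" for n by (subst Usum) (rule sqint_trig_sum)
  have Ws: "sqint a b (W n)" if "n \<le> m" for n unfolding W_def by (intro sqint_diff sq Us tT that)
  have Wb: "l2 a b (W n) \<le> H + e n" if n: "n \<le> m" for n
  proof -
    \<comment> \<open>The total error consists of the projection error and a trigonometric sum whose norm is \<open>e n\<close>.\<close>
    have 1: "W n x = (\<Phi> (t n) x - P_N a b N (\<Phi> (t n)) x) + trig_sum a b ?M (\<lambda>l. ?F (\<Phi> (t n)) l - ?F
        (U n) l) x" for x
      unfolding W_def P_N_def trig_poly_trig_sum using fun_cong[OF Usum[of n], of x]
      by (simp add: trig_sum_def smult.diff_right sum_subtractf)
    have s: "sqint a b (\<lambda>x. \<Phi> (t n) x - P_N a b N (\<Phi> (t n)) x)"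
      unfolding P_N_def trig_poly_trig_sum by (intro sqint_diff sq tT n sqint_trig_sum)
    have "l2 a b (W n) \<le> l2 a b (\<lambda>x. \<Phi> (t n) x - P_N a b N (\<Phi> (t n)) x) + l2 a b (trig_sum a b ?M
        (\<lambda>l. ?F (\<Phi> (t n)) l - ?F (U n) l))"
      unfolding 1 by (rule l2_triangle[OF s sqint_trig_sum])
    thus ?thesis using proj[OF tT[OF n]] unfolding l2_trig_sum[OF ab finite_modes] e_def by linarith
  qed
  have e_nonneg: "e n \<ge> 0" for n unfolding e_def using ab by (simp add: L2_set_nonneg)
  have e0: "e 0 = 0"
  proof -
    have m0: "\<Phi> 0 \<in> borel_measurable (ivl a b)" using sq[OF tT[of 0]] by (simp add: t0 sqint_def)
    have "?F (\<Phi> 0) l = ?F \<Phi>0 l" for l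
      by (rule fourier_coeff_cong[OF init sqint_integrable]) (use sq[OF tT[of 0]]
          measurable_ivl_AE[OF m0 init] in \<open>auto simp: t0\<close>)
    moreover have "?F (U 0) l = ?F \<Phi>0 l" if "l \<in> ?M" for l
      using that by (simp add: U_def P_N_def trig_poly_trig_sum fourier_coeff_trig_sum[OF ab
          finite_modes])
    ultimately have "e 0 = sqrt (b - a) * L2_set (\<lambda>l. 0) ?M"
      unfolding e_def t0 by (intro arg_cong2[where f="(*)"] L2_set_cong refl) auto
    thus ?thesis by (simp add: L2_set_def)
  qed
  let ?S = "H + \<tau>\<^sup>2" and ?L = "28 * K\<^sup>2"
  have KK: "K \<le> K\<^sup>2" using K by (simp add: power2_eq_square)
  have first: "e 1 \<le> ?L * ?S" if "1 \<le> m"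
  proof -
    let ?p = "\<lambda>l. ?F (GU V A 0 (U 0)) l"
    let ?G = "\<lambda>s x. GU V A s (\<Phi> s) x - GU V A 0 (U 0) x"
    have T0: "0 \<in> {0..T}" "\<tau> \<le> T" using tT[of 0] tT[OF that] by (auto simp: t_def)
    have sT: "s \<in> {0..\<tau>} \<Longrightarrow> s \<in> {0..T}" for s using T0 by auto
    have "sqrt (b - a) * L2_set (\<lambda>l. norm (?F (\<Phi> (0 + \<tau>)) l - ?F (U 1) l)) ?M
      \<le> sqrt (b - a) * L2_set (\<lambda>l. norm (?F (\<Phi> 0) l - ?F (U 0) l)) ?M + \<epsilon> * \<tau> * (4 * K\<^sup>2 * \<tau> + 2 * K
          * H)"
    proof (rule one_step[where ?p0.0 = ?p and ?p1.0 = "\<lambda>_. 0" and F = ?G])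
      show "?F (U 1) l = expGam a b \<tau> l *v (?F (U 0) l - (\<i> * of_real \<epsilon>) *s (J1 a b l \<tau> (?p l) + J2
          a b l \<tau> 0))" if "l \<in> ?M" for l
        using ewi_fs_coeff_1[OF ab that, of \<epsilon> V A \<Phi>0 \<tau>] by (simp add: U_def J2_def Let_def opG_def
            del: ewi_fs.simps)
      fix s assume s: "s \<in> {0..\<tau>}"
      have i: "sqint a b (GU V A s (\<Phi> s))" "sqint a b (GU V A 0 (U 0))" "sqint a b (GU V A 0 (\<Phi> 0))"
        by (intro GU_sq sq sT[OF s] T0 Us)+
      show "sqint a b (?G s)" by (intro sqint_diff i)
      show "?F (?G s) l = ?F (GU V A (0 + s) (\<Phi> (0 + s))) l - ?p l - s *\<^sub>R 0" for l
        by (simp add: fourier_coeff_diff[OF sqint_integrable[OF i(1)] sqint_integrable[OF i(2)]])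
      have W0: "W 0 = (\<lambda>x. \<Phi> 0 x - U 0 x)" by (simp add: W_def t0)
      have "?G s = (\<lambda>x. (GU V A s (\<Phi> s) x - GU V A 0 (\<Phi> 0) x) + GU V A 0 (W 0) x)"
        unfolding W0 GU_diff by simp
      hence "l2 a b (?G s) \<le> l2 a b (\<lambda>x. GU V A s (\<Phi> s) x - GU V A 0 (\<Phi> 0) x) + l2 a b (GU V A 0 (W 0))"
        using l2_triangle[OF sqint_diff[OF i(1,3)] GU_sq(1)[OF T0(1) Ws[of 0]]] by simp
      also have "\<dots> \<le> 4 * K\<^sup>2 * (s - 0) + 2 * K * (H + e 0)"
      proof (rule add_mono)
        show "l2 a b (\<lambda>x. GU V A s (\<Phi> s) x - GU V A 0 (\<Phi> 0) x) \<le> 4 * K\<^sup>2 * (s - 0)"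
          by (rule GU_lipschitz) (use s T0 in auto)
        show "l2 a b (GU V A 0 (W 0)) \<le> 2 * K * (H + e 0)"
          by (rule order_trans[OF GU_sq(2)[OF T0(1) Ws[of 0]]]) (use K0 Wb[of 0] in \<open>auto intro!:
              mult_left_mono\<close>)
      qed
      also have "\<dots> \<le> 4 * K\<^sup>2 * \<tau> + 2 * K * H"
        using s by (simp add: e0 mult_left_mono)
      finally show "l2 a b (?G s) \<le> 4 * K\<^sup>2 * \<tau> + 2 * K * H" .
    qed (use \<tau> T0 finite_modes in auto)
    hence "e 1 \<le> e 0 + \<epsilon> * \<tau> * (4 * K\<^sup>2 * \<tau> + 2 * K * H)" by (simp add: e_def t_def)
    also have "\<dots> = \<epsilon> * (4 * K\<^sup>2 * \<tau>\<^sup>2 + \<tau> * (2 * K * H))" by (simp add: e0 power2_eq_square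
        algebra_simps)
    also have "\<dots> \<le> 1 * (4 * K\<^sup>2 * \<tau>\<^sup>2 + 1 * (2 * K * H))"
      using eps \<tau> K H by (intro mult_mono add_mono mult_right_mono) auto
    also have "\<dots> \<le> ?L * ?S"
    proof -
      have "2 * K * H \<le> 28 * K\<^sup>2 * H" using KK K0 H by (intro mult_right_mono) auto
      moreover have "4 * K\<^sup>2 * \<tau>\<^sup>2 \<le> 28 * K\<^sup>2 * \<tau>\<^sup>2" by (intro mult_right_mono) auto
      ultimately show ?thesis unfolding distrib_left by linarith
    qed
    finally show ?thesis .
  qed
  have step: "e (Suc (Suc n)) \<le> e (Suc n) + (\<epsilon> * \<tau>) * (?L * (?S + e (Suc n) + e n))" if n: "Suc (Suc
      n) \<le> m" for n
  proof -
    have nm: "n \<le> m" "Suc n \<le> m" using n by auto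
    let ?t = "t (Suc n)" and ?t' = "t n"
    have tt: "?t - \<tau> = ?t'" "?t + \<tau> \<le> T" using tT[OF n] by (auto simp: tS)
    have tin: "?t \<in> {0..T}" "?t' \<in> {0..T}" by (intro tT nm)+
    define g g' where "g = GU V A ?t (U (Suc n))" and "g' = GU V A ?t' (U n)"
    have gs: "sqint a b g" "sqint a b g'" unfolding g_def g'_def by (intro GU_sq Us tin)+
    let ?p0 = "\<lambda>l. ?F g l" and ?p1 = "\<lambda>l. (1 / \<tau>) *\<^sub>R (?F g l - ?F g' l)"
    let ?G = "\<lambda>s x. GU V A (?t + s) (\<Phi> (?t + s)) x - g x - (s / \<tau>) *\<^sub>R (g x - g' x)"
    let ?B = "28 * K\<^sup>2 * \<tau>\<^sup>2 + 2 * K * (H + e (Suc n)) + (2 * K * (H + e (Suc n)) + 2 * K * (H + e n))"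
    have "sqrt (b - a) * L2_set (\<lambda>l. norm (?F (\<Phi> (?t + \<tau>)) l - ?F (U (Suc (Suc n))) l)) ?M
      \<le> sqrt (b - a) * L2_set (\<lambda>l. norm (?F (\<Phi> ?t) l - ?F (U (Suc n)) l)) ?M + \<epsilon> * \<tau> * ?B"
    proof (rule one_step[where ?p0.0 = ?p0 and ?p1.0 = ?p1 and F = ?G])
      show "?F (U (Suc (Suc n))) l = expGam a b \<tau> l *v (?F (U (Suc n)) l - (\<i> * of_real \<epsilon>) *s (J1 a
          b l \<tau> (?p0 l) + J2 a b l \<tau> (?p1 l)))" if "l \<in> ?M" for l
        unfolding g_def g'_def U_def by (rule ewi_fs_coeff_2[OF ab that]) (simp_all add: t_def)
      fix s assume s: "s \<in> {0..\<tau>}"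
      have sT: "?t + s \<in> {0..T}" using s tt tin by auto
      have i: "sqint a b (GU V A (?t + s) (\<Phi> (?t + s)))" "sqint a b (GU V A ?t (\<Phi> ?t))" "sqint a b
          (GU V A ?t' (\<Phi> ?t'))"
        by (intro GU_sq sq sT tin)+
      show "sqint a b (?G s)" by (intro sqint_diff sqint_scaleR i gs)
      show "?F (?G s) l = ?F (GU V A (?t + s) (\<Phi> (?t + s))) l - ?p0 l - s *\<^sub>R ?p1 l" for l
        using fourier_coeff_diff[OF sqint_integrable[OF sqint_diff[OF i(1) gs(1)]]
            sqint_integrable[OF sqint_scaleR[OF sqint_diff[OF gs], of "s / \<tau>"]], of l]
          fourier_coeff_diff[OF sqint_integrable[OF i(1)] sqint_integrable[OF gs(1)], of l]
          fourier_coeff_diff[OF sqint_integrable[OF gs(1)] sqint_integrable[OF gs(2)], of l]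
        by (simp add: fourier_coeff_scaleR)
      define X where "X = (\<lambda>x. GU V A (?t + s) (\<Phi> (?t + s)) x - GU V A ?t (\<Phi> ?t) x
        - (s / \<tau>) *\<^sub>R (GU V A ?t (\<Phi> ?t) x - GU V A (?t - \<tau>) (\<Phi> (?t - \<tau>)) x))"
      define Y where "Y = GU V A ?t (W (Suc n))"
      define Z where "Z = (\<lambda>x. (s / \<tau>) *\<^sub>R (GU V A ?t (W (Suc n)) x - GU V A ?t' (W n) x))"
      have wi: "sqint a b (GU V A ?t (W (Suc n)))" "sqint a b (GU V A ?t' (W n))"
        by (intro GU_sq Ws nm tin)+
      have Xs: "sqint a b X" unfolding X_def tt by (intro sqint_diff sqint_scaleR i)
      have Ys: "sqint a b Y" unfolding Y_def by (rule wi)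
      have Zs: "sqint a b Z" unfolding Z_def by (intro sqint_scaleR sqint_diff wi)
      have Wn: "GU V A r (W k) x = GU V A r (\<Phi> (t k)) x - GU V A r (U k) x" for r k x
        unfolding W_def by (rule GU_diff)
      \<comment> \<open>Subtracting the numerical values from the exact ones in the extrapolation formula leaves \<open>Y\<close>
        and \<open>Z\<close>.\<close>
      have dec: "?G s = (\<lambda>x. X x + Y x + Z x)"
        unfolding X_def Y_def Z_def Wn tt g_def g'_def by (simp add: fun_eq_iff scaleR_diff_right)
      have Xb: "l2 a b X \<le> 28 * K\<^sup>2 * \<tau>\<^sup>2" unfolding X_def
        by (rule GU_extrapolation) (use s \<tau> tt tin sT in auto)
      have wb: "l2 a b (GU V A ?t (W (Suc n))) \<le> 2 * K * (H + e (Suc n))" "l2 a b (GU V A ?t' (W n))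
          \<le> 2 * K * (H + e n)"
        by (rule order_trans[OF GU_sq(2)[OF tin(1) Ws[OF nm(2)]]], use K0 Wb[OF nm(2)] in \<open>auto
            intro!: mult_left_mono\<close>)
          (rule order_trans[OF GU_sq(2)[OF tin(2) Ws[OF nm(1)]]], use K0 Wb[OF nm(1)] in \<open>auto
              intro!: mult_left_mono\<close>)
      have Zb: "l2 a b Z \<le> 2 * K * (H + e (Suc n)) + 2 * K * (H + e n)"
      proof -
        have \<theta>: "\<bar>s / \<tau>\<bar> \<le> 1" using s \<tau> by auto
        have "l2 a b Z = \<bar>s / \<tau>\<bar> * l2 a b (\<lambda>x. GU V A ?t (W (Suc n)) x - GU V A ?t' (W n) x)"
          unfolding Z_def by (rule l2_scaleR)
        also have "\<dots> \<le> 1 * l2 a b (\<lambda>x. GU V A ?t (W (Suc n)) x - GU V A ?t' (W n) x)"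
          by (rule mult_right_mono[OF \<theta> l2_nonneg])
        also have "\<dots> \<le> l2 a b (GU V A ?t (W (Suc n))) + l2 a b (GU V A ?t' (W n))"
          using l2_triangle_diff[OF wi] by simp
        finally show ?thesis using wb by linarith
      qed
      have "l2 a b (?G s) \<le> l2 a b X + l2 a b Y + l2 a b Z"
        unfolding dec using l2_triangle[OF sqint_add[OF Xs Ys] Zs] l2_triangle[OF Xs Ys] by linarith
      thus "l2 a b (?G s) \<le> ?B" using Xb Zb wb(1) unfolding Y_def by linarith
    qed (use \<tau> tin tt finite_modes in auto)
    hence "e (Suc (Suc n)) \<le> e (Suc n) + \<epsilon> * \<tau> * ?B" by (simp add: e_def tS)
    also have "\<dots> \<le> e (Suc n) + \<epsilon> * \<tau> * (?L * (?S + e (Suc n) + e n))"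
    proof (intro add_left_mono mult_left_mono)
      have c: "c * K * z \<le> 28 * K\<^sup>2 * z" if "z \<ge> 0" "0 \<le> c" "c \<le> 28" for c z :: real
        using that KK K0 by (intro mult_right_mono mult_mono) auto
      have "?B = 28 * K\<^sup>2 * \<tau>\<^sup>2 + 6 * K * H + 4 * K * e (Suc n) + 2 * K * e n" by (simp add:
          algebra_simps)
      also have "\<dots> \<le> 28 * K\<^sup>2 * \<tau>\<^sup>2 + 28 * K\<^sup>2 * H + 28 * K\<^sup>2 * e (Suc n) + 28 * K\<^sup>2 * e n"
        by (intro add_mono c order_refl H e_nonneg) auto
      also have "\<dots> = ?L * (?S + e (Suc n) + e n)" by (simp add: algebra_simps)
      finally show "?B \<le> ?L * (?S + e (Suc n) + e n)" .
    qed (use eps \<tau> in auto)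
    finally show ?thesis .
  qed
  have S0: "0 \<le> ?S" "0 \<le> ?L" using H by auto
  have em: "e m \<le> exp (2 * ?L * (\<epsilon> * \<tau> * real m)) * (?L + 1) * ?S"
  proof (cases "1 \<le> m")
    case True
    show ?thesis
      by (rule two_step_Gronwall[OF _ first[OF True] S0(2) _ S0(1) step order_refl])
        (use S0 eps \<tau> in \<open>auto simp: e0 simp del: distrib_left_numeral\<close>)
  next
    case False
    hence "m = 0" by simp
    thus ?thesis using S0 H by (simp add: e0)
  qed
  show "sqint a b (\<lambda>x. \<Phi> (real m * \<tau>) x - ewi_fs a b \<epsilon> V A \<Phi>0 N \<tau> m x)"
    using Ws[OF order_refl] by (simp add: W_def t_def U_def)
  have "l2 a b (W m) \<le> H + exp (2 * ?L * (\<epsilon> * \<tau> * real m)) * (?L + 1) * ?S"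
    using Wb[OF order_refl] em by linarith
  thus "l2 a b (\<lambda>x. \<Phi> (real m * \<tau>) x - ewi_fs a b \<epsilon> V A \<Phi>0 N \<tau> m x)
      \<le> H + exp (2 * (28 * K\<^sup>2) * (\<epsilon> * \<tau> * real m)) * (28 * K\<^sup>2 + 1) * (H + \<tau>\<^sup>2)"
    by (simp add: W_def t_def U_def)
qed

end

section \<open>Regularity from the hypotheses on the solution and the potentials\<close>

lemma W_Linf_norm_witness:
  assumes "W_Linf_norm k T a b u < ennreal K"
  obtains v where "v 0 = u" "\<And>j. j < k \<Longrightarrow> weak_dt T a b (v j) (v (Suc j))"
    "\<And>j. j \<le> k \<Longrightarrow> Linf_time T a b (Linf_norm a b) (v j) \<le> ennreal K"
proof -
  obtain v where v: "v 0 = u" "\<forall>j<k. weak_dt T a b (v j) (v (Suc j))"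
      "(\<Sum>j\<le>k. Linf_time T a b (Linf_norm a b) (v j)) < ennreal K"
    using assms unfolding W_Linf_norm_def INF_less_iff by blast
  have "Linf_time T a b (Linf_norm a b) (v j) \<le> ennreal K" if "j \<le> k" for j
  proof -
    have "Linf_time T a b (Linf_norm a b) (v j) \<le> (\<Sum>j\<le>k. Linf_time T a b (Linf_norm a b) (v j))"
      using that by (intro member_le_sum) auto
    thus ?thesis using v(3) by simp
  qed
  thus ?thesis using that v by blast
qed

lemma potential_from_norm:
  assumes T: "0 < T" and K: "K \<ge> 0" and W: "W_Linf_norm 2 T a b W < ennreal K"
    and c: "time_continuous T (Linf_norm a b) W"
  shows "potential a b T K W"
proof -
  obtain v where v: "v 0 = W" "\<And>j. j < 2 \<Longrightarrow> weak_dt T a b (v j) (v (Suc j))"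
    "\<And>j. j \<le> 2 \<Longrightarrow> Linf_time T a b (Linf_norm a b) (v j) \<le> ennreal K"
    using W_Linf_norm_witness[OF W, of thesis] by blast
  have wd: "weak_dt T a b W (v 1)" "weak_dt T a b (v 1) (v 2)"
    using v(2)[of 0] v(2)[of 1] by (simp_all add: v(1) numeral_2_eq_2)
  have b: "AE t in ivl 0 T. Linf_norm a b (W t) \<le> ennreal K" "AE t in ivl 0 T. Linf_norm a b (v 1 t)
      \<le> ennreal K"
    "AE t in ivl 0 T. Linf_norm a b (v 2 t) \<le> ennreal K"
    using Linf_time_AE(2)[OF v(3)[of 0]] Linf_time_AE(2)[OF v(3)[of 1]] Linf_time_AE(2)[OF v(3)[of
        2]] by (simp_all add: v(1))
  show ?thesis
  proof
    show "W t \<in> borel_measurable (ivl a b)" if "t \<in> {0..T}" for t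
      by (rule time_continuous_Linf(1)[OF c that])
    show "AE x in ivl a b. \<bar>W t x\<bar> \<le> K" if "t \<in> {0..T}" for t
      by (rule Linf_time_bound[OF c T K b(1) that])
  qed (rule Linf_time_increments[OF wd T K b c]; assumption)+
qed

lemma Hp_norm_L2:
  fixes u :: "real \<Rightarrow> 'v::euclidean_space"
  assumes n: "Hp_norm a b k u \<le> ennreal M" "M \<ge> 0"
  shows "L2_norm a b u \<le> ennreal M"
proof -
  note u = Hp_norm_bound[OF n le0]
  have s: "sqint a b u" using u(1) by (simp add: Hp_space_def H_space_def L2_norm_less_top)
  note w = weak_dx_Hp[OF u(1) le0]
  have "AE x in ivl a b. u x = weak_dx a b 0 u x"
    by (rule weak_deriv_unique[OF weak_deriv_0[OF sqint_locally_integrable[OF s]] w(1)])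
  hence "l2 a b (weak_dx a b 0 u) = l2 a b u"
    by (intro l2_cong_AE(2)[OF s]) (use w(2) in \<open>auto simp: sqint_def\<close>)
  thus ?thesis using u(2) s n(2) by (simp add: L2_norm_le_ennreal)
qed

text \<open>
  A Lipschitz function of time satisfies everywhere a bound that it satisfies almost everywhere,
  as every time is a limit of good times. This transfers the almost-everywhere hypotheses to the
  grid points.
\<close>

lemma AE_bound_extends:
  fixes f :: "real \<Rightarrow> real"
  assumes ae: "AE s in ivl 0 T. f s \<le> B" and T: "0 < T" and K: "K \<ge> 0"
    and lip: "\<And>s t. s \<in> {0..T} \<Longrightarrow> t \<in> {0..T} \<Longrightarrow> f t \<le> f s + K * \<bar>s - t\<bar>" and t: "t \<in> {0..T}"
  shows "f t \<le> B"
proof (rule field_le_epsilon)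
  fix e :: real assume e: "e > 0"
  have "e / (K + 1) > 0" using e K by simp
  then obtain s where s: "s \<in> {0<..<T}" "\<bar>s - t\<bar> < e / (K + 1)" "f s \<le> B"
    using AE_ivl_near[OF ae T t] by blast
  have "f t \<le> f s + K * \<bar>s - t\<bar>" by (rule lip) (use s t in auto)
  also have "\<dots> \<le> B + (K + 1) * (e / (K + 1))"
    using s K by (intro add_mono mult_mono) auto
  also have "\<dots> = B + e" using K by simp
  finally show "f t \<le> B + e" .
qed

lemma P_N_diff:
  assumes "sqint a b u" "sqint a b w"
  shows "P_N a b N u x - P_N a b N w x = P_N a b N (\<lambda>x. u x - w x) x"
  using assms by (simp add: P_N_def trig_poly_trig_sum trig_sum_def fourier_coeff_diff[OF
      sqint_integrable sqint_integrable] smult.diff_right sum_subtractf)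

lemma P_N_contraction:
  assumes "a < b" "sqint a b u"
  shows "l2 a b (P_N a b N u) \<le> l2 a b u"
  unfolding P_N_def trig_poly_trig_sum l2_trig_sum[OF assms(1) finite_modes] by (rule
      Bessel_L2_set[OF assms(1) finite_modes assms(2)])

lemma sqint_P_N: "sqint a b (P_N a b N u)"
  unfolding P_N_def trig_poly_trig_sum by (rule sqint_trig_sum)

text \<open>The projection error depends continuously on the function, as the projection is a contraction.\<close>

lemma projection_error_lipschitz:
  assumes ab: "a < b" and s: "sqint a b u" "sqint a b w"
  shows "l2 a b (\<lambda>x. w x - P_N a b N w x) \<le> l2 a b (\<lambda>x. u x - P_N a b N u x) + 2 * l2 a b (\<lambda>x. w x -
      u x)"
proof -
  let ?d = "\<lambda>x. w x - u x"
  have d: "sqint a b ?d" by (intro sqint_diff s)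
  have e: "(\<lambda>x. w x - P_N a b N w x) = (\<lambda>x. (u x - P_N a b N u x) + (?d x - P_N a b N ?d x))"
    by (simp add: fun_eq_iff P_N_diff[OF s(2,1), symmetric])
  have "l2 a b (\<lambda>x. w x - P_N a b N w x) \<le> l2 a b (\<lambda>x. u x - P_N a b N u x) + l2 a b (\<lambda>x. ?d x - P_N
      a b N ?d x)"
    unfolding e by (intro l2_triangle sqint_diff s d sqint_P_N)
  also have "l2 a b (\<lambda>x. ?d x - P_N a b N ?d x) \<le> l2 a b ?d + l2 a b (P_N a b N ?d)"
    by (intro l2_triangle_diff d sqint_P_N)
  finally show ?thesis using P_N_contraction[OF ab d, of N] by simp
qed

lemma sqint_bounded_linear:
  fixes f :: "complex^2 \<Rightarrow> complex^2"
  assumes "bounded_linear f" "sqint a b u"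
  shows "sqint a b (\<lambda>x. f (u x))"
proof -
  obtain B where B: "\<And>x. norm (f x) \<le> norm x * B" using bounded_linear.bounded[OF assms(1)] by blast
  have "(\<lambda>x. f (u x)) \<in> borel_measurable (ivl a b)"
    using assms(2) by (intro borel_measurable_continuous_on[where f=f] linear_continuous_on
        assms(1)) (simp add: sqint_def)
  thus ?thesis
    by (rule sqint_bound[OF assms(2), where K=B], intro AE_I2) (subst mult.commute, rule B)
qed

text \<open>The Fourier coefficients turn \<open>-i \<sigma>\<^sub>1 \<partial>\<^sub>x + \<sigma>\<^sub>3\<close> into multiplication by \<open>\<Gamma>\<^sub>l\<close>.\<close>

lemma dirac_fourier:
  assumes ab: "a < b" and u: "u \<in> Hp_space a b k" "1 \<le> k" and ut: "sqint a b ut" and G: "sqint a b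
      (GU V A t u)"
    and eq: "AE x in ivl a b. \<i> *s ut x = ((- \<i>) *s (sigma1 *v weak_dx a b 1 u x) + sigma3 *v u x) +
        \<epsilon> *\<^sub>R (G_mat V A t x *v u x)"
  shows "fourier_coeff a b ut l = - \<i> *s (Gam a b l *v fourier_coeff a b u l + of_real \<epsilon> *s
      fourier_coeff a b (GU V A t u) l)"
proof -
  let ?F = "\<lambda>u. fourier_coeff a b u l"
  let ?D = "weak_dx a b 1 u"
  have s: "sqint a b u" using u(1) by (simp add: Hp_space_def H_space_def L2_norm_less_top)
  note D = weak_dx_Hp[OF u]
  note bl = matrix_vector_mul_bounded_linear
  have s1: "sqint a b (\<lambda>x. sigma1 *v ?D x)" by (rule sqint_bounded_linear[OF bl D(2)])
  have s2: "sqint a b (\<lambda>x. (- \<i>) *s (sigma1 *v ?D x))" by (rule sqint_bounded_linear[OF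
      smult.bounded_linear_right s1])
  have s3: "sqint a b (\<lambda>x. sigma3 *v u x)" by (rule sqint_bounded_linear[OF bl s])
  have s4: "sqint a b (\<lambda>x. \<epsilon> *\<^sub>R GU V A t u x)" by (rule sqint_scaleR[OF G])
  have s0: "sqint a b (\<lambda>x. \<i> *s ut x)" by (rule sqint_bounded_linear[OF smult.bounded_linear_right ut])
  have s5: "sqint a b (\<lambda>x. ((- \<i>) *s (sigma1 *v ?D x) + sigma3 *v u x) + \<epsilon> *\<^sub>R GU V A t u x)"
    by (intro sqint_add s2 s3 s4)
  have "\<i> *s ?F ut = ?F (\<lambda>x. \<i> *s ut x)" by (rule fourier_coeff_smult[OF sqint_integrable[OF ut],
      symmetric])
  also have "\<dots> = ?F (\<lambda>x. ((- \<i>) *s (sigma1 *v ?D x) + sigma3 *v u x) + \<epsilon> *\<^sub>R GU V A t u x)"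
    by (rule fourier_coeff_cong[OF _ sqint_integrable[OF s0]]) (use eq s5 in \<open>auto simp: GU_def
        sqint_def\<close>)
  also have "\<dots> = ((- \<i>) *s (sigma1 *v ?F ?D) + sigma3 *v ?F u) + \<epsilon> *\<^sub>R ?F (GU V A t u)"
    by (simp only: fourier_coeff_add[OF sqint_integrable[OF sqint_add[OF s2 s3]] sqint_integrable[OF s4]]
      fourier_coeff_add[OF sqint_integrable[OF s2] sqint_integrable[OF s3]]
      fourier_coeff_smult[OF sqint_integrable[OF s1]] fourier_coeff_matrix[OF sqint_integrable[OF D(2)]]
      fourier_coeff_matrix[OF sqint_integrable[OF s]] fourier_coeff_scaleR)
  also have "?F ?D = (\<i> * of_real (mu a b l)) *s ?F u"
    using fourier_weak_deriv[OF ab u D(1) sqint_integrable[OF D(2)]] by simp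
  also have "((- \<i>) *s (sigma1 *v ((\<i> * of_real (mu a b l)) *s ?F u)) + sigma3 *v ?F u) + \<epsilon> *\<^sub>R ?F
      (GU V A t u)
      = Gam a b l *v ?F u + of_real \<epsilon> *s ?F (GU V A t u)"
  proof -
    have "(- \<i>) *s (sigma1 *v ((\<i> * of_real (mu a b l)) *s y)) + sigma3 *v y = Gam a b l *v y" for y
      by (simp add: vec_eq_iff forall_2 matrix_vector_mult_def sum_2 Gam_entries sigma1_def
          sigma3_def vector_2 mult.assoc)
    thus ?thesis by (simp add: smult_of_real)
  qed
  finally have "- \<i> *s (\<i> *s ?F ut) = - \<i> *s (Gam a b l *v ?F u + of_real \<epsilon> *s ?F (GU V A t u))" by simp
  thus ?thesis by (simp add: vector_smult_assoc)
qed

lemma Lipschitz_continuous: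
  fixes f :: "real \<Rightarrow> 'v::real_normed_vector"
  assumes "\<And>s t. 0 \<le> s \<Longrightarrow> s \<le> t \<Longrightarrow> t \<le> T \<Longrightarrow> norm (f t - f s) \<le> C * (t - s)" "C \<ge> 0"
  shows "continuous_on {0..T} f"
proof (rule lipschitz_on_continuous_on[of C], rule lipschitz_onI)
  fix x y assume xy: "x \<in> {0..T}" "y \<in> {0..T}"
  show "dist (f x) (f y) \<le> C * dist x y"
    using assms(1)[of x y] assms(1)[of y x] xy by (cases "x \<le> y") (auto simp: dist_norm
        norm_minus_commute dist_real_def)
qed (rule assms)

lemma fourier_inner:
  assumes "a < b" "integrable (ivl a b) U"
  shows "(\<integral>x. U x \<bullet> (fmode a b l x *s w) \<partial>ivl a b) = (b - a) * (fourier_coeff a b U l \<bullet> w)"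
  using inner_trig_sum[OF assms, of "{l}" "\<lambda>_. w"] by (simp add: trig_sum_def)

context wave
begin

lemma coefficient_continuous: "continuous_on {0..T} (\<lambda>t. fourier_coeff a b (\<Phi> t) l)"
proof (rule Lipschitz_continuous)
  fix s t assume st: "0 \<le> s" "s \<le> t" "t \<le> T"
  hence q: "sqint a b (\<Phi> t)" "sqint a b (\<Phi> s)" by (auto intro: sq)
  have "norm (fourier_coeff a b (\<Phi> t) l - fourier_coeff a b (\<Phi> s) l) \<le> l2 a b (\<lambda>x. \<Phi> t x - \<Phi> s x) /
      sqrt (b - a)"
    using fourier_bound[OF ab sqint_diff[OF q]] by (simp add: fourier_coeff_diff[OF
        sqint_integrable[OF q(1)] sqint_integrable[OF q(2)]])
  also have "\<dots> \<le> K * (t - s) / sqrt (b - a)" by (intro divide_right_mono lipschitz st) (use ab in simp)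
  finally show "norm (fourier_coeff a b (\<Phi> t) l - fourier_coeff a b (\<Phi> s) l) \<le> (K / sqrt (b - a)) *
      (t - s)" by simp
qed (use ab K0 in simp)

lemma GU_coefficient_continuous: "continuous_on {0..T} (\<lambda>t. fourier_coeff a b (GU V A t (\<Phi> t)) l)"
proof (rule Lipschitz_continuous)
  fix s t assume st: "0 \<le> s" "s \<le> t" "t \<le> T"
  hence q: "sqint a b (GU V A t (\<Phi> t))" "sqint a b (GU V A s (\<Phi> s))" by (auto intro!: sq GU_sq)
  have "norm (fourier_coeff a b (GU V A t (\<Phi> t)) l - fourier_coeff a b (GU V A s (\<Phi> s)) l)
      \<le> l2 a b (\<lambda>x. GU V A t (\<Phi> t) x - GU V A s (\<Phi> s) x) / sqrt (b - a)"
    using fourier_bound[OF ab sqint_diff[OF q]] by (simp add: fourier_coeff_diff[OF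
        sqint_integrable[OF q(1)] sqint_integrable[OF q(2)]])
  also have "\<dots> \<le> 4 * K\<^sup>2 * (t - s) / sqrt (b - a)" by (intro divide_right_mono GU_lipschitz st) (use
      ab in simp)
  finally show "norm (fourier_coeff a b (GU V A t (\<Phi> t)) l - fourier_coeff a b (GU V A s (\<Phi> s)) l) \<le>
      (4 * K\<^sup>2 / sqrt (b - a)) * (t - s)" by simp
qed (use ab K0 in simp)

text \<open>
  Pairing with a mode makes the coefficient an integral of its weak derivative. The latter
  agrees almost everywhere with the continuous function \<open>F\<close>, so the coefficient is continuously
  differentiable.
\<close>

lemma coefficient_ode:
  assumes T: "0 < T" and wd: "weak_dt T a b \<Phi> \<Phi>t"
    and bt: "AE t in ivl 0 T. L2_norm a b (\<Phi>t t) \<le> ennreal K"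
    and eq: "AE t in ivl 0 T. fourier_coeff a b (\<Phi>t t) l = F t"
    and F: "continuous_on {0..T} F" and t: "t \<in> {0..T}"
  shows "((\<lambda>t. fourier_coeff a b (\<Phi> t) l) has_vector_derivative F t) (at t within {0..T})"
proof -
  let ?c = "\<lambda>t. fourier_coeff a b (\<Phi> t) l"
  have ae\<Phi>: "AE t in ivl 0 T. L2_norm a b (\<Phi> t) \<le> ennreal K"
    by (rule AE_I2) (use sq bound K0 in \<open>auto simp: L2_norm_le_ennreal\<close>)
  have increment: "?c t - ?c s = integral {s..t} F" if st: "0 \<le> s" "s \<le> t" "t \<le> T" for s t
  proof -
    have Fi: "F integrable_on {s..t}"
      by (rule integrable_continuous_real[OF continuous_on_subset[OF F]]) (use st in auto)
    have "(?c t - ?c s) \<bullet> w = integral {s..t} F \<bullet> w" for w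
    proof -
      define f where "f = (\<lambda>x. fmode a b l x *s w)"
      have fc: "continuous_on {a..b} f" unfolding f_def by (intro smult.continuous_on
          continuous_fmode continuous_on_const)
      have fs: "sqint a b f" by (rule sqint_continuous[OF fc])
      note nn = nn_integral_l2_bound_AE[OF K0 fs]
      have fm: "f \<in> borel_measurable (ivl a b)" using fs by (simp add: sqint_def)
      note P = weak_dt_pairing[OF wd fm T nn[OF ae\<Phi>] nn[OF bt]]
      define P where "P = (\<lambda>t. \<integral>x. \<Phi> t x \<bullet> f x \<partial>ivl a b)"
      define Q where "Q = (\<lambda>t. \<integral>x. \<Phi>t t x \<bullet> f x \<partial>ivl a b)"
      have Pc: "P r = (b - a) * (?c r \<bullet> w)" if "r \<in> {0..T}" for r
        unfolding P_def f_def by (rule fourier_inner[OF ab sqint_integrable[OF sq[OF that]]])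
      have "continuous_on {0..T} (\<lambda>r. (b - a) * (?c r \<bullet> w))"
        by (intro continuous_intros coefficient_continuous)
      hence Pcont: "continuous_on {0..T} P" by (rule continuous_on_eq) (simp add: Pc)
      have Qi: "integrable (ivl 0 T) Q" unfolding Q_def by (rule P(2))
      have Qi': "integrable (ivl s t) Q" by (rule integrable_ivl_subset[OF Qi]) (use st in auto)
      let ?Q0 = "\<lambda>r. (b - a) * (F r \<bullet> w)"
      have Q0i: "integrable (ivl s t) ?Q0"
        by (intro integrable_ivl_continuous continuous_intros continuous_on_subset[OF F]) (use st in
            auto)
      have QQ: "AE r in ivl 0 T. Q r = ?Q0 r"
        using bt eq
      proof eventually_elim
        case (elim r)
        have "sqint a b (\<Phi>t r)" using elim(1) K0 by (simp add: L2_norm_le_ennreal)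
        thus ?case unfolding Q_def f_def elim(2)[symmetric] by (intro fourier_inner[OF ab
            sqint_integrable])
      qed
      hence "AE r in lebesgue. r \<in> {0<..<T} \<longrightarrow> Q r = ?Q0 r"
        by (subst (asm) AE_restrict_space_iff) auto
      hence QQ': "AE r in ivl s t. Q r = ?Q0 r"
        using st by (subst AE_restrict_space_iff) (auto elim!: eventually_mono)
      have "P t - P s = integral {s..t} Q"
        by (rule weak_deriv_1_continuous[OF P(1)[folded P_def Q_def] Pcont Qi st])
      also have "\<dots> = integral\<^sup>L (ivl s t) Q" by (rule integral_ivl_eq[OF Qi', symmetric])
      also have "\<dots> = integral\<^sup>L (ivl s t) ?Q0"
        by (rule integral_cong_AE[OF borel_measurable_integrable[OF Qi']
            borel_measurable_integrable[OF Q0i] QQ'])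
      also have "\<dots> = integral {s..t} ?Q0" by (rule integral_ivl_eq[OF Q0i])
      also have "\<dots> = (b - a) * (integral {s..t} F \<bullet> w)"
        using integral_linear[OF Fi bounded_linear_inner_left, of w] by (simp add: o_def)
      finally have "(b - a) * ((?c t - ?c s) \<bullet> w) = (b - a) * (integral {s..t} F \<bullet> w)"
        using Pc[of t] Pc[of s] st by (simp add: inner_diff_left right_diff_distrib)
      thus ?thesis using ab by simp
    qed
    thus ?thesis by (metis vector_eq_rdot)
  qed
  have "((\<lambda>u. integral {0..u} F) has_vector_derivative F t) (at t within {0..T})"
    by (rule integral_has_vector_derivative[OF F t])
  hence "((\<lambda>u. ?c 0 + integral {0..u} F) has_vector_derivative 0 + F t) (at t within {0..T})"
    by (intro has_vector_derivative_add has_vector_derivative_const)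
  hence d: "((\<lambda>u. ?c 0 + integral {0..u} F) has_vector_derivative F t) (at t within {0..T})" by simp
  show ?thesis
  proof (rule has_vector_derivative_transform[OF t _ d])
    fix x assume "x \<in> {0..T}"
    thus "?c x = ?c 0 + integral {0..x} F" using increment[of 0 x] by (simp add: algebra_simps)
  qed
qed

end

theorem theorem3p1:
  fixes a b T0 M :: real and m0 :: nat
    and V A1 :: "real \<Rightarrow> real \<Rightarrow> real \<Rightarrow> real"
    and \<Phi>0 :: "real \<Rightarrow> real \<Rightarrow> complex^2"
    and \<Phi> \<Phi>t \<Phi>tt :: "real \<Rightarrow> real \<Rightarrow> real \<Rightarrow> complex^2"
  assumes "a < b" and "T0 > 0" and "m0 \<ge> 2"
    and initial_data: "\<And>\<epsilon>. 0 < \<epsilon> \<Longrightarrow> \<epsilon> \<le> 1 \<Longrightarrow>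
      periodic_bc a b 0 (\<Phi>0 \<epsilon>) \<and> periodic_bc a b 1 (\<Phi>0 \<epsilon>)"
    and solution: "\<And>\<epsilon>. 0 < \<epsilon> \<Longrightarrow> \<epsilon> \<le> 1 \<Longrightarrow>
      dirac_solution (T0 / \<epsilon>) a b \<epsilon> (V \<epsilon>) (A1 \<epsilon>) (\<Phi>0 \<epsilon>) (\<Phi> \<epsilon>) (\<Phi>t \<epsilon>)"
    and second_derivative: "\<And>\<epsilon>. 0 < \<epsilon> \<Longrightarrow> \<epsilon> \<le> 1 \<Longrightarrow>
      weak_dt (T0 / \<epsilon>) a b (\<Phi>t \<epsilon>) (\<Phi>tt \<epsilon>)"
    and A: "\<And>\<epsilon>. 0 < \<epsilon> \<Longrightarrow> \<epsilon> \<le> 1 \<Longrightarrow>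
      Linf_time (T0 / \<epsilon>) a b (Hp_norm a b m0) (\<Phi> \<epsilon>) \<le> ennreal M \<and>
      Linf_time (T0 / \<epsilon>) a b (L2_norm a b) (\<Phi>t \<epsilon>) \<le> ennreal M \<and>
      Linf_time (T0 / \<epsilon>) a b (L2_norm a b) (\<Phi>tt \<epsilon>) \<le> ennreal M"
    and potentials_continuous: "\<And>\<epsilon>. 0 < \<epsilon> \<Longrightarrow> \<epsilon> \<le> 1 \<Longrightarrow>
      time_continuous (T0 / \<epsilon>) (Linf_norm a b) (V \<epsilon>) \<and>
      time_continuous (T0 / \<epsilon>) (Linf_norm a b) (A1 \<epsilon>)"
    and B: "\<And>\<epsilon>. 0 < \<epsilon> \<Longrightarrow> \<epsilon> \<le> 1 \<Longrightarrow>
      W_Linf_norm 2 (T0 / \<epsilon>) a b (V \<epsilon>) + W_Linf_norm 2 (T0 / \<epsilon>) a b (A1 \<epsilon>) \<le> ennreal M"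
  shows "\<exists>\<tau>0>0. \<exists>C>0. \<forall>\<epsilon> N \<tau> n.
    0 < \<epsilon> \<longrightarrow> \<epsilon> \<le> 1 \<longrightarrow> even N \<longrightarrow> 0 < N \<longrightarrow> 0 < \<tau> \<longrightarrow> \<tau> \<le> \<tau>0 \<longrightarrow>
    real n \<le> (T0 / \<epsilon>) / \<tau> \<longrightarrow>
    L2_norm a b (\<lambda>x. \<Phi> \<epsilon> (real n * \<tau>) x - ewi_fs a b \<epsilon> (V \<epsilon>) (A1 \<epsilon>) (\<Phi>0 \<epsilon>) N \<tau> n x)
      \<le> ennreal (C * (((b - a) / real N) ^ m0 + \<tau>\<^sup>2))"
proof -
  \<comment> \<open>The strict inequality \<open>M < K\<close> provides weak derivatives of the potentials with bound \<open>K\<close>,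
    although the infimum in their norm need not be attained; \<open>1 \<le> K\<close> absorbs lower powers of \<open>K\<close>.\<close>
  define K where "K = max M 0 + 1"
  define L where "L = 28 * K\<^sup>2"
  define C where "C = K + exp (2 * L * T0) * (L + 1) * K"
  have K: "K \<ge> 1" "ennreal M \<le> ennreal K" "ennreal M < ennreal K"
  proof -
    have "1 \<le> K" "M < K" by (auto simp: K_def)
    thus "K \<ge> 1" "ennreal M \<le> ennreal K" "ennreal M < ennreal K"
      by (auto intro!: ennreal_leI ennreal_lessI)
  qed
  have K0: "K \<ge> 0" using K by simp
  have L0: "L \<ge> 0" by (simp add: L_def)
  have "C \<ge> K" using K0 L0 by (simp add: C_def)
  hence C: "C > 0" using K by simp
  have main: "L2_norm a b (\<lambda>x. \<Phi> \<epsilon> (real n * \<tau>) x - ewi_fs a b \<epsilon> (V \<epsilon>) (A1 \<epsilon>) (\<Phi>0 \<epsilon>) N \<tau> n x)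
      \<le> ennreal (C * (((b - a) / real N) ^ m0 + \<tau>\<^sup>2))"
    if eps: "0 < \<epsilon>" "\<epsilon> \<le> 1" and N: "even N" "0 < N" and \<tau>: "0 < \<tau>" "\<tau> \<le> 1" and n: "real n \<le> (T0 / \<epsilon>) / \<tau>"
    for \<epsilon> \<tau> :: real and N n :: nat
  proof -
    define T where "T = T0 / \<epsilon>"
    have T: "0 < T" using eps assms(2) by (simp add: T_def)
    let ?h = "(b - a) / real N"
    have h: "?h > 0" using assms(1) N by simp
    note sol = solution[OF eps, folded T_def, unfolded dirac_solution_def]
    have tc: "time_continuous T (L2_norm a b) (\<Phi> \<epsilon>)" and wd: "weak_dt T a b (\<Phi> \<epsilon>) (\<Phi>t \<epsilon>)"
      and init: "AE x in ivl a b. \<Phi> \<epsilon> 0 x = \<Phi>0 \<epsilon> x"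
      using sol by blast+
    have pde: "AE t in ivl 0 T. AE x in ivl a b.
           \<i> *s \<Phi>t \<epsilon> t x = ((- \<i>) *s (sigma1 *v weak_dx a b 1 (\<Phi> \<epsilon> t) x) + sigma3 *v \<Phi> \<epsilon> t x)
             + \<epsilon> *\<^sub>R (G_mat (V \<epsilon>) (A1 \<epsilon>) t x *v \<Phi> \<epsilon> t x)"
      using sol by (auto elim: eventually_mono)
    have wd2: "weak_dt T a b (\<Phi>t \<epsilon>) (\<Phi>tt \<epsilon>)" using second_derivative[OF eps] by (simp add: T_def)
    have bH: "AE t in ivl 0 T. Hp_norm a b m0 (\<Phi> \<epsilon> t) \<le> ennreal K"
      and bt: "AE t in ivl 0 T. L2_norm a b (\<Phi>t \<epsilon> t) \<le> ennreal K"
      and btt: "AE t in ivl 0 T. L2_norm a b (\<Phi>tt \<epsilon> t) \<le> ennreal K"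
      using A[OF eps, folded T_def] K(2) by (blast intro: Linf_time_AE(2) order_trans)+
    have bL: "AE t in ivl 0 T. L2_norm a b (\<Phi> \<epsilon> t) \<le> ennreal K"
      using bH by eventually_elim (rule Hp_norm_L2[OF _ K0])
    have WV: "W_Linf_norm 2 T a b (V \<epsilon>) < ennreal K" and WA: "W_Linf_norm 2 T a b (A1 \<epsilon>) < ennreal K"
      using B[OF eps, folded T_def] K(3) by (meson add_increasing add_increasing2 order.trans
          order_refl order_le_less_trans zero_le)+
    have pc: "time_continuous T (Linf_norm a b) (V \<epsilon>)" "time_continuous T (Linf_norm a b) (A1 \<epsilon>)"
      using potentials_continuous[OF eps] by (simp_all add: T_def)
    interpret V: potential a b T K "V \<epsilon>" by (rule potential_from_norm[OF T K0 WV pc(1)])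
    interpret A: potential a b T K "A1 \<epsilon>" by (rule potential_from_norm[OF T K0 WA pc(2)])
    note sq = time_continuous_l2(1)[OF tc]
    note inc = l2_time_increments[OF wd wd2 T K0 bL bt btt tc]
    have lip: "l2 a b (\<lambda>x. \<Phi> \<epsilon> t x - \<Phi> \<epsilon> s x) \<le> K * \<bar>s - t\<bar>" if "s \<in> {0..T}" "t \<in> {0..T}" for s t
    proof (cases "s \<le> t")
      case True thus ?thesis using inc(1)[of s t] that by simp
    next
      case False
      have "l2 a b (\<lambda>x. \<Phi> \<epsilon> t x - \<Phi> \<epsilon> s x) = l2 a b (\<lambda>x. \<Phi> \<epsilon> s x - \<Phi> \<epsilon> t x)"
        by (simp add: l2_def norm_minus_commute)
      thus ?thesis using inc(1)[of t s] that False by simp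
    qed
    have bound: "l2 a b (\<Phi> \<epsilon> t) \<le> K" if t: "t \<in> {0..T}" for t
    proof (rule AE_bound_extends[OF _ T K0 _ t, where f="\<lambda>t. l2 a b (\<Phi> \<epsilon> t)"])
      show "AE s in ivl 0 T. l2 a b (\<Phi> \<epsilon> s) \<le> K"
        using bL by eventually_elim (simp add: L2_norm_le_ennreal K0)
      fix s t assume st: "s \<in> {0..T}" "t \<in> {0..T}"
      show "l2 a b (\<Phi> \<epsilon> t) \<le> l2 a b (\<Phi> \<epsilon> s) + K * \<bar>s - t\<bar>"
        using l2_triangle[OF sq[OF st(1)] sqint_diff[OF sq[OF st(2)] sq[OF st(1)]]] lip[OF st] by simp
    qed
    \<comment> \<open>The Sobolev bound holds for almost every time, but the projection error is needed at the grid
      points.\<close>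
    have proj: "l2 a b (\<lambda>x. \<Phi> \<epsilon> t x - P_N a b N (\<Phi> \<epsilon> t) x) \<le> ?h ^ m0 * K" if t: "t \<in> {0..T}" for t
    proof (rule AE_bound_extends[OF _ T _ _ t, where f="\<lambda>t. l2 a b (\<lambda>x. \<Phi> \<epsilon> t x - P_N a b N (\<Phi> \<epsilon> t)
        x)" and K="2 * K"])
      show "AE s in ivl 0 T. l2 a b (\<lambda>x. \<Phi> \<epsilon> s x - P_N a b N (\<Phi> \<epsilon> s) x) \<le> ?h ^ m0 * K"
        using bH
      proof eventually_elim
        case (elim s)
        note u = Hp_norm_bound[OF elim K0 order_refl]
        have "l2 a b (\<lambda>x. \<Phi> \<epsilon> s x - P_N a b N (\<Phi> \<epsilon> s) x) \<le> ?h ^ m0 * l2 a b (weak_dx a b m0 (\<Phi> \<epsilon> s))"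
          by (rule projection_error[OF assms(1) u(1) _ weak_dx_Hp[OF u(1) order_refl] N]) (use
              assms(3) in simp)
        also have "\<dots> \<le> ?h ^ m0 * K" using h by (intro mult_left_mono u) auto
        finally show ?case .
      qed
      fix s t assume st: "s \<in> {0..T}" "t \<in> {0..T}"
      show "l2 a b (\<lambda>x. \<Phi> \<epsilon> t x - P_N a b N (\<Phi> \<epsilon> t) x) \<le> l2 a b (\<lambda>x. \<Phi> \<epsilon> s x - P_N a b N (\<Phi> \<epsilon> s) x)
          + 2 * K * \<bar>s - t\<bar>"
        using projection_error_lipschitz[OF assms(1) sq[OF st(1)] sq[OF st(2)], of N] lip[OF st] by simp
    qed (use K0 in simp)
    interpret wave a b T K "V \<epsilon>" "A1 \<epsilon>" "\<Phi> \<epsilon>"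
    proof
      show "a < b" "K \<ge> 1" by (fact assms K)+
    qed (use sq bound inc in blast)+
    let ?F = "\<lambda>l t. - \<i> *s (Gam a b l *v fourier_coeff a b (\<Phi> \<epsilon> t) l + of_real \<epsilon> *s fourier_coeff a
        b (GU (V \<epsilon>) (A1 \<epsilon>) t (\<Phi> \<epsilon> t)) l)"
    interpret dirac_wave a b T K "V \<epsilon>" "A1 \<epsilon>" "\<Phi> \<epsilon>" \<epsilon>
    proof
      show "0 < \<epsilon>" "\<epsilon> \<le> 1" by (fact eps)+
      fix l t assume t: "t \<in> {0..T}"
      show "((\<lambda>t. fourier_coeff a b (\<Phi> \<epsilon> t) l) has_vector_derivative ?F l t) (at t within {0..T})"
      proof (rule coefficient_ode[OF T wd bt _ _ t])
        show "continuous_on {0..T} (?F l)"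
          by (intro smult.continuous_on continuous_on_const continuous_on_add coefficient_continuous
              GU_coefficient_continuous
            bounded_linear.continuous_on[OF matrix_vector_mul_bounded_linear])
        have "AE t in ivl 0 T. t \<in> {0..T}" by (rule AE_I2) auto
        thus "AE t in ivl 0 T. fourier_coeff a b (\<Phi>t \<epsilon> t) l = ?F l t"
          using pde bH bt
        proof eventually_elim
          case (elim t)
          note u = Hp_norm_bound(1)[OF elim(3) K0 order_refl]
          have "sqint a b (\<Phi>t \<epsilon> t)" using elim(4) K0 by (simp add: L2_norm_le_ennreal)
          thus ?case
            by (intro dirac_fourier[OF assms(1) u _ _ GU_sq(1)[OF elim(1) sq[OF elim(1)]] elim(2)])
                (use assms(3) in simp_all)
        qed
      qed
    qed
    have nT: "real n * \<tau> \<le> T" unfolding T_def by (rule pos_le_divide_eq[THEN iffD1, OF \<tau>(1) n])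
    have H: "0 \<le> ?h ^ m0 * K" using h K0 by simp
    note eb = error_bound[OF N \<tau> nT init H proj]
    \<comment> \<open>Each step contributes a factor \<open>1 + O(\<epsilon> \<tau>)\<close>, and \<open>\<epsilon> \<tau> n \<le> T0\<close>: this makes the estimate uniform
      on the long time interval.\<close>
    have "\<epsilon> * \<tau> * real n = \<epsilon> * (real n * \<tau>)" by simp
    also have "\<dots> \<le> \<epsilon> * T" using nT eps by (intro mult_left_mono) auto
    also have "\<dots> = T0" using eps by (simp add: T_def)
    finally have en: "\<epsilon> * \<tau> * real n \<le> T0" .
    have "l2 a b (\<lambda>x. \<Phi> \<epsilon> (real n * \<tau>) x - ewi_fs a b \<epsilon> (V \<epsilon>) (A1 \<epsilon>) (\<Phi>0 \<epsilon>) N \<tau> n x)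
       \<le> ?h ^ m0 * K + exp (2 * L * (\<epsilon> * \<tau> * real n)) * (L + 1) * (?h ^ m0 * K + \<tau>\<^sup>2)"
      using eb(2) by (simp add: L_def)
    also have "\<dots> \<le> (?h ^ m0 + \<tau>\<^sup>2) * K + exp (2 * L * T0) * (L + 1) * ((?h ^ m0 + \<tau>\<^sup>2) * K)"
    proof (intro add_mono mult_mono)
      show "exp (2 * L * (\<epsilon> * \<tau> * real n)) \<le> exp (2 * L * T0)"
        using en L0 by (simp add: mult_left_mono)
      have "1 * \<tau>\<^sup>2 \<le> K * \<tau>\<^sup>2" using K by (intro mult_right_mono) auto
      thus "?h ^ m0 * K + \<tau>\<^sup>2 \<le> (?h ^ m0 + \<tau>\<^sup>2) * K" by (simp add: algebra_simps)
    qed (use K0 L0 h H in auto)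
    also have "\<dots> = C * (?h ^ m0 + \<tau>\<^sup>2)" by (simp add: C_def algebra_simps)
    finally show ?thesis
      using eb(1) by (simp add: L2_norm_eq ennreal_leI)
  qed
  show ?thesis
    by (rule exI[of _ 1], intro conjI exI[of _ C] allI impI) (use C main in auto)
qed

end
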